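(* Let $s \ge 2$ and $k \ge 1$ be integers, let $$\mathcal Q_k = \left\{ s - 1 - \frac{1}{2^{k-s+1} + \frac{a}{b}} \;:\; a, b \in \mathbb N,\ a \le 2^{k-s+1}\right\},$$ and let $\alpha \in \left(s - 1 - \frac{1}{2^{k-s+1}},\, s - 1\right) \setminus \mathcal Q_k$. Then the random hypergraph $G^s(n, n^{-\alpha})$ obeys the zero-one $k$-law.
   Context: For integers $s \ge 2$, $n \ge 1$ and $p\in[0,1]$, the random $s$-uniform hypergraph $G^s(n,p)$ is the random $s$-uniform hypergraph on vertex set $\{1,\dots,n\}$ in which each of the $\binom{n}{s}$ possible $s$-element edges is present independently with probability $p$. First-order properties of $s$-uniform hypergraphs are those expressible by first-order formulae built from the $s$-ary predicate symbol $N$ (meaning "these $s$ vertices form an edge"), equality, logical connectives, variables and quantifiers $\forall,\exists$ over vertices. The quantifier depth of a formula is the maximum number of nested quantifiers. $G^s(n,p(n))$ obeys the zero-one $k$-law if for every first-order property $L$ expressible by a formula of quantifier depth at most $k$, the probability $\Pr[G^s(n,p(n)) \models L]$ tends either to $0$ or to $1$ as $n\to\infty$. $\mathbb N=\{1,2,\dots\}$. *)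

theory Defs
  imports "HOL-Probability.Probability"
begin

datatype fo_formula =
    Equal nat nat
  | Edge "nat list"
  | Neg fo_formula
  | Conj fo_formula fo_formula
  | Disj fo_formula fo_formula
  | Imp fo_formula fo_formula
  | Iff fo_formula fo_formula
  | Exists nat fo_formula
  | Forall nat fo_formula

text \<open>The predicate symbol \<open>N\<close> is \<open>s\<close>-ary: every edge atom carries exactly \<open>s\<close> variables.\<close>

fun fo_wf :: "nat \<Rightarrow> fo_formula \<Rightarrow> bool" where
  "fo_wf s (Equal x y) = True"
| "fo_wf s (Edge xs) = (length xs = s)"
| "fo_wf s (Neg f) = fo_wf s f"
| "fo_wf s (Conj f g) = (fo_wf s f \<and> fo_wf s g)"
| "fo_wf s (Disj f g) = (fo_wf s f \<and> fo_wf s g)"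
| "fo_wf s (Imp f g) = (fo_wf s f \<and> fo_wf s g)"
| "fo_wf s (Iff f g) = (fo_wf s f \<and> fo_wf s g)"
| "fo_wf s (Exists x f) = fo_wf s f"
| "fo_wf s (Forall x f) = fo_wf s f"

fun fo_free :: "fo_formula \<Rightarrow> nat set" where
  "fo_free (Equal x y) = {x, y}"
| "fo_free (Edge xs) = set xs"
| "fo_free (Neg f) = fo_free f"
| "fo_free (Conj f g) = fo_free f \<union> fo_free g"
| "fo_free (Disj f g) = fo_free f \<union> fo_free g"
| "fo_free (Imp f g) = fo_free f \<union> fo_free g"
| "fo_free (Iff f g) = fo_free f \<union> fo_free g"
| "fo_free (Exists x f) = fo_free f - {x}"
| "fo_free (Forall x f) = fo_free f - {x}"

fun quantifier_depth :: "fo_formula \<Rightarrow> nat" where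
  "quantifier_depth (Equal x y) = 0"
| "quantifier_depth (Edge xs) = 0"
| "quantifier_depth (Neg f) = quantifier_depth f"
| "quantifier_depth (Conj f g) = max (quantifier_depth f) (quantifier_depth g)"
| "quantifier_depth (Disj f g) = max (quantifier_depth f) (quantifier_depth g)"
| "quantifier_depth (Imp f g) = max (quantifier_depth f) (quantifier_depth g)"
| "quantifier_depth (Iff f g) = max (quantifier_depth f) (quantifier_depth g)"
| "quantifier_depth (Exists x f) = Suc (quantifier_depth f)"
| "quantifier_depth (Forall x f) = Suc (quantifier_depth f)"

text \<open>A hypergraph is given by its vertex set \<open>V\<close> and edge set \<open>E\<close>. If all edges have \<open>s\<close>
  elements, an \<open>s\<close>-ary edge atom can only hold for pairwise distinct vertices.\<close>

fun fo_sat :: "'v set \<Rightarrow> 'v set set \<Rightarrow> (nat \<Rightarrow> 'v) \<Rightarrow> fo_formula \<Rightarrow> bool" where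
  "fo_sat V E v (Equal x y) = (v x = v y)"
| "fo_sat V E v (Edge xs) = (v ` set xs \<in> E)"
| "fo_sat V E v (Neg f) = (\<not> fo_sat V E v f)"
| "fo_sat V E v (Conj f g) = (fo_sat V E v f \<and> fo_sat V E v g)"
| "fo_sat V E v (Disj f g) = (fo_sat V E v f \<or> fo_sat V E v g)"
| "fo_sat V E v (Imp f g) = (fo_sat V E v f \<longrightarrow> fo_sat V E v g)"
| "fo_sat V E v (Iff f g) = (fo_sat V E v f \<longleftrightarrow> fo_sat V E v g)"
| "fo_sat V E v (Exists x f) = (\<exists>u\<in>V. fo_sat V E (v(x := u)) f)"
| "fo_sat V E v (Forall x f) = (\<forall>u\<in>V. fo_sat V E (v(x := u)) f)"

definition fo_sentence :: "nat \<Rightarrow> fo_formula \<Rightarrow> bool" where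
  "fo_sentence s f \<longleftrightarrow> fo_wf s f \<and> fo_free f = {}"

definition fo_models :: "'v set \<Rightarrow> 'v set set \<Rightarrow> fo_formula \<Rightarrow> bool" where
  "fo_models V E f \<longleftrightarrow> (\<forall>v. range v \<subseteq> V \<longrightarrow> fo_sat V E v f)"

text \<open>The distribution of the edge set of \<open>G\<^sup>s(n, p)\<close> on the vertex set \<open>{1..n}\<close>. Note that
  \<^const>\<open>bernoulli_pmf\<close> truncates a parameter outside of \<open>[0, 1]\<close> to that interval.\<close>

definition random_hypergraph :: "nat \<Rightarrow> nat \<Rightarrow> real \<Rightarrow> nat set set pmf" where
  "random_hypergraph s n p =
     map_pmf (\<lambda>c. {e. c e})
       (Pi_pmf {e. e \<subseteq> {1..n} \<and> card e = s} False (\<lambda>_. bernoulli_pmf p))"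

definition zero_one_law :: "nat \<Rightarrow> nat \<Rightarrow> (nat \<Rightarrow> real) \<Rightarrow> bool" where
  "zero_one_law s k p \<longleftrightarrow>
     (\<forall>f. fo_sentence s f \<and> quantifier_depth f \<le> k \<longrightarrow>
        (\<lambda>n. measure_pmf.prob (random_hypergraph s n (p n)) {E. fo_models {1..n} E f})
          \<longlonglongrightarrow> 0 \<or>
        (\<lambda>n. measure_pmf.prob (random_hypergraph s n (p n)) {E. fo_models {1..n} E f})
          \<longlonglongrightarrow> 1)"

text \<open>The exponent \<open>k - s + 1\<close> may be negative, hence the integer power.\<close>

definition exceptional_exponents :: "nat \<Rightarrow> nat \<Rightarrow> real set" where
  "exceptional_exponents s k =
     {real s - 1 - 1 / (2 powi (int k - int s + 1) + real a / real b) | a b :: nat.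
        a \<ge> 1 \<and> b \<ge> 1 \<and> real a \<le> 2 powi (int k - int s + 1)}"

end

theory Submission
  imports Defs "HOL-Real_Asymp.Real_Asymp"
begin

text \<open>Let \<open>m = k - s + 1\<close>; if \<open>m \<le> 0\<close> then no edge atom can hold, so let \<open>m \<ge> 1\<close>. Write
  \<open>\<alpha> = s - 1 - \<epsilon>\<close> with \<open>0 < \<epsilon> 2\<^sup>m < 1\<close>. For a set \<open>S\<close> of vertices spanning \<open>e\<close> edges let
  \<open>cyc S = (s - 1) e - |S|\<close> and \<open>wt S = \<epsilon> e - cyc S = |S| - \<alpha> e\<close>. With high probability every
  bounded \<open>S\<close> has \<open>wt S \<ge> 0\<close>, pendant edges can be attached everywhere, and every fixed hypergraph
  whose nonempty parts have positive weight has a copy that is not contained in an atypically dense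
  larger set. Any two hypergraphs with these properties satisfy the same sentences of depth \<open>k\<close>.

  Duplicator keeps an isomorphism between two sets \<open>C\<close>, \<open>C'\<close> containing the chosen vertices such that
  every bounded extension of either one has more than \<open>\<rho>\<close> new edges per new cycle. The first set is
  the closure of the first vertex for \<open>\<rho> = 2\<^sup>m\<close>. It has no part of weight zero: such a part with
  \<open>c\<close> cycles has more than \<open>2\<^sup>m (c + 1)\<close> edges because \<open>\<alpha>\<close> is not exceptional, and then the whole
  closure would have negative weight. In each of the next \<open>m\<close> rounds \<open>\<rho>\<close> is halved. The closure of
  \<open>C\<close> and the new vertex then adds at most \<open>\<rho>\<close> edges and no cycle, so it can be copied greedily, and
  the copy is automatically closed; if the new vertex is isolated from \<open>C\<close>, some vertex on the other
  side is isolated from \<open>C'\<close> as well. When \<open>\<rho> = 1\<close>, an edge outside \<open>C\<close> meets \<open>C\<close> in at most one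
  vertex, and in the remaining \<open>s - 2\<close> rounds every injective answer is good.\<close>

section \<open>The Ehrenfeucht game\<close>

text \<open>The exceptional exponents match the bound 2^m (c + 1) as follows. A single vertex spans
  no edge and has \<open>cyc\<close> equal to -1, so its closure, which admits at most 2^m new edges
  per new cycle, has at most 2^m (c + 1) edges when its \<open>cyc\<close> is c. A part of weight
  zero with e edges has 1 / \<epsilon> = e / c = 2^m + a / c with a = e - 2^m c, and e \<le> 2^m (c
  + 1) says a \<le> 2^m. Halving works because each new vertex again starts at -1: a closure with d
  new cycles over C has at most R (d + 1) new edges, while C requires more than 2 R d, so d < 1.

  The obstacle is that C is chosen after the hypergraph is drawn. Later rounds therefore take from
  probability only what holds for all bounded sets at once: nonnegative weights, pendant edges and
  copies avoiding a given set. That an answer has no unwanted edges or dense extensions follows from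
  the strength of C alone, and a vertex isolated from C is found by contradiction with nonnegative
  weight instead of by counting. Randomness has to supply a strong copy only in the first round,
  where nothing is fixed yet.\<close>

definition partial_iso :: "'a set set \<Rightarrow> 'b set set \<Rightarrow> 'a set \<Rightarrow> ('a \<Rightarrow> 'b) \<Rightarrow> bool" where
  "partial_iso E E' C \<theta> \<longleftrightarrow> inj_on \<theta> C \<and> (\<forall>e. e \<subseteq> C \<longrightarrow> (e \<in> E \<longleftrightarrow> \<theta> ` e \<in> E'))"

text \<open>Truth of formulas is compared directly, without strategies. The assignments must
  correspond only on the free variables; for \<open>C = {}\<close> and a sentence they are
  unrelated, as \<open>agree_sentence\<close> needs.\<close>

definition agree ::
  "'a set \<Rightarrow> 'a set set \<Rightarrow> 'b set \<Rightarrow> 'b set set \<Rightarrow> nat \<Rightarrow> 'a set \<Rightarrow> ('a \<Rightarrow> 'b) \<Rightarrow> bool" where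
  "agree V E V' E' j C \<theta> \<longleftrightarrow>
     (\<forall>f v v'. quantifier_depth f \<le> j \<longrightarrow> v ` fo_free f \<subseteq> C \<longrightarrow>
        (\<forall>x\<in>fo_free f. v' x = \<theta> (v x)) \<longrightarrow> fo_sat V E v f = fo_sat V' E' v' f)"

lemma agreeD:
  assumes "agree V E V' E' j C \<theta>" "quantifier_depth f \<le> j" "v ` fo_free f \<subseteq> C"
    "\<And>x. x \<in> fo_free f \<Longrightarrow> v' x = \<theta> (v x)"
  shows "fo_sat V E v f = fo_sat V' E' v' f"
  using assms unfolding agree_def by blast

text \<open>Induction over the formula with \<open>j\<close> fixed: connectives use the induction
  hypothesis, while a quantifier is settled by agreement at depth \<open>i\<close> after one move.
  \<open>D\<close> may exceed \<open>insert u C\<close>, since Duplicator keeps whole closures and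
  not only the chosen vertices.\<close>

lemma agreeI:
  assumes iso: "partial_iso E E' C \<theta>"
    and forward: "\<And>i u. j = Suc i \<Longrightarrow> u \<in> V \<Longrightarrow>
      \<exists>D \<theta>'. insert u C \<subseteq> D \<and> \<theta>' u \<in> V' \<and> (\<forall>x\<in>C. \<theta>' x = \<theta> x) \<and> agree V E V' E' i D \<theta>'"
    and backward: "\<And>i u'. j = Suc i \<Longrightarrow> u' \<in> V' \<Longrightarrow>
      \<exists>D \<theta>' u. u \<in> V \<and> \<theta>' u = u' \<and> insert u C \<subseteq> D \<and> (\<forall>x\<in>C. \<theta>' x = \<theta> x) \<and> agree V E V' E' i D \<theta>'"
  shows "agree V E V' E' j C \<theta>"
  unfolding agree_def
proof (intro allI impI)
  have fwd: "\<exists>u'\<in>V'. fo_sat V E (v(x := u)) g = fo_sat V' E' (v'(x := u')) g"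
    if "Suc (quantifier_depth g) \<le> j" "v ` (fo_free g - {x}) \<subseteq> C"
      "\<forall>y\<in>fo_free g - {x}. v' y = \<theta> (v y)" "u \<in> V" for g v v' x u
  proof -
    from that(1) obtain i where i: "j = Suc i" "quantifier_depth g \<le> i" by (cases j) auto
    from forward[OF i(1) that(4)] obtain D \<theta>' where D: "insert u C \<subseteq> D" "\<theta>' u \<in> V'"
      "\<forall>x\<in>C. \<theta>' x = \<theta> x" "agree V E V' E' i D \<theta>'" by blast
    have "fo_sat V E (v(x := u)) g = fo_sat V' E' (v'(x := \<theta>' u)) g"
      by (rule agreeD[OF D(4) i(2)]) (use D that in auto)
    then show ?thesis using D by blast
  qed
  have bwd: "\<exists>u\<in>V. fo_sat V E (v(x := u)) g = fo_sat V' E' (v'(x := u')) g"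
    if "Suc (quantifier_depth g) \<le> j" "v ` (fo_free g - {x}) \<subseteq> C"
      "\<forall>y\<in>fo_free g - {x}. v' y = \<theta> (v y)" "u' \<in> V'" for g v v' x u'
  proof -
    from that(1) obtain i where i: "j = Suc i" "quantifier_depth g \<le> i" by (cases j) auto
    from backward[OF i(1) that(4)] obtain D \<theta>' u where D: "u \<in> V" "\<theta>' u = u'" "insert u C \<subseteq> D"
      "\<forall>x\<in>C. \<theta>' x = \<theta> x" "agree V E V' E' i D \<theta>'" by blast
    have "fo_sat V E (v(x := u)) g = fo_sat V' E' (v'(x := u')) g"
      by (rule agreeD[OF D(5) i(2)]) (use D that in auto)
    then show ?thesis using D by blast
  qed
  fix f v v'
  assume "quantifier_depth f \<le> j" "v ` fo_free f \<subseteq> C" "\<forall>x\<in>fo_free f. v' x = \<theta> (v x)"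
  then show "fo_sat V E v f = fo_sat V' E' v' f"
  proof (induction f)
    case (Equal x y)
    then show ?case using iso unfolding partial_iso_def inj_on_def by auto
  next
    \<comment> \<open>An assignment may identify variables of the atom, so its image can be smaller
      than \<open>s\<close>; this is why \<open>partial_iso\<close> tests all subsets of
      \<open>C\<close>.\<close>
    case (Edge xs)
    then have "v' ` set xs = \<theta> ` (v ` set xs)" by (force simp: image_iff)
    then show ?case using Edge iso unfolding partial_iso_def by auto
  next
    case (Exists x g)
    have "\<exists>u'\<in>V'. fo_sat V E (v(x := u)) g = fo_sat V' E' (v'(x := u')) g" if "u \<in> V" for u
      using Exists.prems that by (intro fwd) auto
    moreover have "\<exists>u\<in>V. fo_sat V E (v(x := u)) g = fo_sat V' E' (v'(x := u')) g" if "u' \<in> V'" for u'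
      using Exists.prems that by (intro bwd) auto
    ultimately show ?case by (simp, blast)
  next
    case (Forall x g)
    have "\<exists>u'\<in>V'. fo_sat V E (v(x := u)) g = fo_sat V' E' (v'(x := u')) g" if "u \<in> V" for u
      using Forall.prems that by (intro fwd) auto
    moreover have "\<exists>u\<in>V. fo_sat V E (v(x := u)) g = fo_sat V' E' (v'(x := u')) g" if "u' \<in> V'" for u'
      using Forall.prems that by (intro bwd) auto
    ultimately show ?case by (simp, blast)
  qed auto
qed

section \<open>Positions of the game and their symmetry\<close>

definition conf ::
  "('a set \<Rightarrow> 'a set set \<Rightarrow> 'a set \<Rightarrow> bool) \<Rightarrow>
    'a set \<Rightarrow> 'a set set \<Rightarrow> 'a set \<Rightarrow> 'a set set \<Rightarrow> 'a set \<Rightarrow> ('a \<Rightarrow> 'a) \<Rightarrow> bool" where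
  "conf X V E V' E' C \<theta> \<longleftrightarrow>
     partial_iso E E' C \<theta> \<and> C \<subseteq> V \<and> \<theta> ` C \<subseteq> V' \<and> X V E C \<and> X V' E' (\<theta> ` C)"

lemma conf_swap:
  assumes "conf X V E V' E' C \<theta>"
  shows "conf X V' E' V E (\<theta> ` C) (inv_into C \<theta>)"
proof -
  have inj: "inj_on \<theta> C" using assms by (simp add: conf_def partial_iso_def)
  have im: "inv_into C \<theta> ` \<theta> ` C = C" using inj by force
  have "e \<in> E' \<longleftrightarrow> inv_into C \<theta> ` e \<in> E" if "e \<subseteq> \<theta> ` C" for e
  proof -
    have "\<theta> ` inv_into C \<theta> ` e = e" using that by (rule image_inv_into_cancel[OF refl])
    moreover have "inv_into C \<theta> ` e \<subseteq> C" using that im by blast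
    ultimately show ?thesis using assms unfolding conf_def partial_iso_def by metis
  qed
  then show ?thesis
    using assms im unfolding conf_def partial_iso_def by (auto intro: inj_on_inv_into)
qed

text \<open>Answers are assumed only for moves in the first structure, but for every ordered pair of
  structures. A move in the second one is answered in the position reversed by
  \<open>conf_swap\<close>, and the answer is inverted; hence \<open>conf\<close> demands
  \<open>X\<close> on both sides and takes both structures over one type.\<close>

lemma agree_step:
  assumes forward: "\<And>V E V' E' C \<theta> u. gen V E \<Longrightarrow> gen V' E' \<Longrightarrow> conf X V E V' E' C \<theta> \<Longrightarrow> u \<in> V \<Longrightarrow>
      \<exists>D \<theta>'. conf Y V E V' E' D \<theta>' \<and> insert u C \<subseteq> D \<and> (\<forall>x\<in>C. \<theta>' x = \<theta> x)"
    and rest: "\<And>V E V' E' C \<theta>. gen V E \<Longrightarrow> gen V' E' \<Longrightarrow> conf Y V E V' E' C \<theta> \<Longrightarrow> agree V E V' E' j C \<theta>"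
    and g: "gen V E" "gen V' E'" and c: "conf X V E V' E' C \<theta>"
  shows "agree V E V' E' (Suc j) C \<theta>"
proof (rule agreeI)
  show "partial_iso E E' C \<theta>" using c by (simp add: conf_def)
next
  fix i u assume i: "Suc j = Suc i" "u \<in> V"
  from forward[OF g c i(2)] obtain D \<theta>' where D: "conf Y V E V' E' D \<theta>'" "insert u C \<subseteq> D"
    "\<forall>x\<in>C. \<theta>' x = \<theta> x" by blast
  have "\<theta>' u \<in> V'" using D(1,2) by (auto simp: conf_def)
  then show "\<exists>D \<theta>'. insert u C \<subseteq> D \<and> \<theta>' u \<in> V' \<and> (\<forall>x\<in>C. \<theta>' x = \<theta> x) \<and> agree V E V' E' i D \<theta>'"
    using D rest[OF g D(1)] i by blast
next
  fix i u' assume i: "Suc j = Suc i" "u' \<in> V'"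
  from forward[OF g(2,1) conf_swap[OF c] i(2)] obtain D \<phi> where
    D: "conf Y V' E' V E D \<phi>" "insert u' (\<theta> ` C) \<subseteq> D" "\<forall>x\<in>\<theta> ` C. \<phi> x = inv_into C \<theta> x" by blast
  have inj: "inj_on \<theta> C" using c by (simp add: conf_def partial_iso_def)
  have injp: "inj_on \<phi> D" using D by (simp add: conf_def partial_iso_def)
  let ?\<theta> = "inv_into D \<phi>"
  note D' = conf_swap[OF D(1)]
  \<comment> \<open>\<open>\<phi>\<close> undoes \<open>\<theta>\<close> on \<open>C\<close>, hence
    the inverse of \<open>\<phi>\<close> extends \<open>\<theta>\<close>.\<close>
  have cancel: "\<phi> (\<theta> x) = x" if "x \<in> C" for x using D(3) that inj by auto
  have "?\<theta> x = \<theta> x" if "x \<in> C" for x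
    using inv_into_f_f[OF injp, of "\<theta> x"] cancel[OF that] D(2) that by auto
  moreover have "insert (\<phi> u') C \<subseteq> \<phi> ` D" using D(2) cancel by force
  moreover have "?\<theta> (\<phi> u') = u'" using injp D(2) by auto
  moreover have "\<phi> u' \<in> V" using D(1,2) by (auto simp: conf_def)
  moreover have "agree V E V' E' i (\<phi> ` D) ?\<theta>" using rest[OF g D'] i by simp
  ultimately show "\<exists>D \<theta>' u. u \<in> V \<and> \<theta>' u = u' \<and> insert u C \<subseteq> D \<and> (\<forall>x\<in>C. \<theta>' x = \<theta> x) \<and> agree V E V' E' i D \<theta>'"
    by blast
qed

text \<open>With \<open>j\<close> rounds left: there are \<open>j\<close> vertices outside
  \<open>C\<close> to choose from, and an edge not inside \<open>C\<close> has more than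
  \<open>j\<close> of its \<open>s\<close> vertices outside, so the coming choices cannot complete
  it.\<close>

definition thinly_attached :: "nat \<Rightarrow> nat \<Rightarrow> 'a set \<Rightarrow> 'a set set \<Rightarrow> 'a set \<Rightarrow> bool" where
  "thinly_attached s j V E C \<longleftrightarrow> finite V \<and> card C + j \<le> card V \<and> (\<forall>e\<in>E. card e = s) \<and>
     (\<forall>e\<in>E. \<not> e \<subseteq> C \<longrightarrow> card (e \<inter> C) + j < s)"

lemma thinly_attached_forth:
  assumes c: "conf (thinly_attached s (Suc j)) V E V' E' C \<theta>" and u: "u \<in> V"
  shows "\<exists>D \<theta>'. conf (thinly_attached s j) V E V' E' D \<theta>' \<and> insert u C \<subseteq> D \<and> (\<forall>x\<in>C. \<theta>' x = \<theta> x)"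
proof (cases "u \<in> C")
  case True
  then have "conf (thinly_attached s j) V E V' E' C \<theta>"
    using c by (auto simp: conf_def thinly_attached_def)
  then show ?thesis using True by blast
next
  case False
  have t: "thinly_attached s (Suc j) V E C" "thinly_attached s (Suc j) V' E' (\<theta> ` C)"
    and CV: "C \<subseteq> V" "\<theta> ` C \<subseteq> V'" and iso: "partial_iso E E' C \<theta>"
    using c by (auto simp: conf_def)
  have fin: "finite C" "finite (\<theta> ` C)" using t CV by (auto simp: thinly_attached_def intro: finite_subset)
  have no_edge: "e \<notin> E" if "thinly_attached s (Suc j) V E C" "finite C" "e \<subseteq> insert x C" "\<not> e \<subseteq> C"
    for V :: "'a set" and E C e x
  proof
    assume "e \<in> E"
    then have "card (e \<inter> C) + Suc j < s" "card e = s" using that by (auto simp: thinly_attached_def)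
    moreover have "card e \<le> card (insert x (e \<inter> C))"
      using that by (intro card_mono) auto
    moreover have "\<dots> \<le> Suc (card (e \<inter> C))" using that by (simp add: card_insert_if)
    ultimately show False by simp
  qed
  have weak: "thinly_attached s j V E (insert x C)"
    if t: "thinly_attached s (Suc j) V E C" and "finite C" for V :: "'a set" and E C x
    unfolding thinly_attached_def
  proof (intro conjI ballI impI)
    fix e assume e: "e \<in> E" "\<not> e \<subseteq> insert x C"
    then have 1: "card (e \<inter> C) + Suc j < s" using t by (auto simp: thinly_attached_def)
    have "card (e \<inter> insert x C) \<le> card (insert x (e \<inter> C))"
      using that by (intro card_mono) auto
    also have "\<dots> \<le> Suc (card (e \<inter> C))" by (simp add: card_insert_le_m1 card_insert_if \<open>finite C\<close>)
    finally show "card (e \<inter> insert x C) + j < s" using 1 by simp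
  next
    have "card (insert x C) \<le> Suc (card C)" using that by (simp add: card_insert_if)
    then show "card (insert x C) + j \<le> card V" using t by (auto simp: thinly_attached_def)
  qed (use t in \<open>auto simp: thinly_attached_def\<close>)
  have "card (\<theta> ` C) < card V'" using t(2) by (simp add: thinly_attached_def)
  then have "\<not> V' \<subseteq> \<theta> ` C" using fin card_mono by (metis leD)
  then obtain u' where u': "u' \<in> V'" "u' \<notin> \<theta> ` C" by blast
  define \<theta>' where "\<theta>' = \<theta>(u := u')"
  have im: "\<theta>' ` e = \<theta> ` e" if "e \<subseteq> C" for e using that False by (auto simp: \<theta>'_def)
  have im_ins: "\<theta>' ` insert u C = insert u' (\<theta> ` C)" using False by (auto simp: \<theta>'_def)
  have "partial_iso E E' (insert u C) \<theta>'"
    unfolding partial_iso_def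
  proof (intro conjI allI impI)
    show "inj_on \<theta>' (insert u C)"
      using iso False u' unfolding partial_iso_def \<theta>'_def inj_on_def by auto
    fix e assume e: "e \<subseteq> insert u C"
    show "e \<in> E \<longleftrightarrow> \<theta>' ` e \<in> E'"
    proof (cases "e \<subseteq> C")
      case True
      then show ?thesis using iso im unfolding partial_iso_def by simp
    next
      case nsub: False
      then have "u \<in> e" using e by auto
      then have "u' \<in> \<theta>' ` e" by (auto simp: \<theta>'_def)
      then have "\<not> \<theta>' ` e \<subseteq> \<theta> ` C" using u' by auto
      moreover have "\<theta>' ` e \<subseteq> insert u' (\<theta> ` C)" using e im_ins by blast
      ultimately show ?thesis using no_edge[OF t(1) fin(1) e nsub] no_edge[OF t(2) fin(2)] by blast
    qed
  qed
  then have "conf (thinly_attached s j) V E V' E' (insert u C) \<theta>'"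
    unfolding conf_def im_ins using weak t fin CV u u' by auto
  moreover have "\<forall>x\<in>C. \<theta>' x = \<theta> x" using False by (auto simp: \<theta>'_def)
  ultimately show ?thesis by blast
qed

lemma thinly_attached_agree:
  "conf (thinly_attached s j) V E V' E' C \<theta> \<Longrightarrow> agree V E V' E' j C \<theta>"
proof (induction j arbitrary: V E V' E' C \<theta>)
  case 0
  show ?case by (rule agreeI) (use 0 in \<open>auto simp: conf_def\<close>)
next
  case (Suc j)
  show ?case
    by (rule agree_step[where gen = "\<lambda>_ _. True" and X = "thinly_attached s (Suc j)" and Y = "thinly_attached s j"])
      (use thinly_attached_forth Suc in auto)
qed

section \<open>Sparse hypergraphs\<close>

definition ne :: "'a set set \<Rightarrow> 'a set \<Rightarrow> nat" where
  "ne E S = card {e \<in> E. e \<subseteq> S}"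

lemma finite_edges_within: "finite S \<Longrightarrow> finite {e \<in> E. e \<subseteq> S}"
  by (rule finite_subset[of _ "Pow S"]) auto

lemma ne_mono: "finite B \<Longrightarrow> A \<subseteq> B \<Longrightarrow> ne E A \<le> ne E B"
  unfolding ne_def by (rule card_mono) (auto intro: finite_edges_within)

lemma ne_supermodular:
  assumes "finite A" "finite B"
  shows "ne E A + ne E B \<le> ne E (A \<union> B) + ne E (A \<inter> B)"
proof -
  let ?X = "\<lambda>S. {e \<in> E. e \<subseteq> S}"
  have "ne E A + ne E B = card (?X A \<union> ?X B) + card (?X A \<inter> ?X B)"
    unfolding ne_def using assms by (intro card_Un_Int finite_edges_within)
  also have "?X A \<inter> ?X B = ?X (A \<inter> B)" by auto
  also have "card (?X A \<union> ?X B) \<le> card (?X (A \<union> B))"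
    using assms by (intro card_mono finite_edges_within) auto
  finally show ?thesis by (simp add: ne_def)
qed

lemma ne_cong: "(\<And>e. e \<subseteq> S \<Longrightarrow> e \<in> E \<longleftrightarrow> e \<in> F) \<Longrightarrow> ne E S = ne F S"
  unfolding ne_def by (rule arg_cong[where f = card]) auto

lemma ne_image_le:
  assumes "inj_on \<theta> S" "finite S" "\<And>e. e \<subseteq> S \<Longrightarrow> e \<in> E \<Longrightarrow> \<theta> ` e \<in> E'"
  shows "ne E S \<le> ne E' (\<theta> ` S)"
proof -
  have "inj_on ((`) \<theta>) {e \<in> E. e \<subseteq> S}"
    using inj_on_image_Pow[OF assms(1)] by (rule inj_on_subset) auto
  then have "ne E S = card ((`) \<theta> ` {e \<in> E. e \<subseteq> S})" unfolding ne_def by (simp add: card_image)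
  also have "\<dots> \<le> ne E' (\<theta> ` S)"
    unfolding ne_def using assms by (intro card_mono finite_edges_within) auto
  finally show ?thesis .
qed

lemma ne_image_eq:
  assumes "inj_on \<theta> S" "finite S" "\<And>e. e \<subseteq> S \<Longrightarrow> e \<in> E \<longleftrightarrow> \<theta> ` e \<in> E'"
  shows "ne E' (\<theta> ` S) = ne E S"
proof -
  have "inj_on ((`) \<theta>) {e \<in> E. e \<subseteq> S}"
    using inj_on_image_Pow[OF assms(1)] by (rule inj_on_subset) auto
  then have "card ((`) \<theta> ` {e \<in> E. e \<subseteq> S}) = ne E S" unfolding ne_def by (rule card_image)
  moreover have "(`) \<theta> ` {e \<in> E. e \<subseteq> S} = {e \<in> E'. e \<subseteq> \<theta> ` S}"
  proof (intro equalityI subsetI)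
    fix x assume "x \<in> {e \<in> E'. e \<subseteq> \<theta> ` S}"
    then obtain e where "e \<subseteq> S" "x = \<theta> ` e" "x \<in> E'" by (auto simp: subset_image_iff)
    then show "x \<in> (`) \<theta> ` {e \<in> E. e \<subseteq> S}" using assms(3) by auto
  qed (use assms(3) in auto)
  ultimately show ?thesis by (simp add: ne_def)
qed

text \<open>Copies are built so as to preserve edges only. The induced map on edges is injective, so
  if the image spans no more edges than \<open>S\<close>, each of them comes from \<open>S\<close>
  and the copy is exact.\<close>

lemma edges_image_eq:
  assumes inj: "inj_on \<theta> S" and "finite S" "\<And>e. e \<subseteq> S \<Longrightarrow> e \<in> E \<Longrightarrow> \<theta> ` e \<in> E'"
    and "ne E' (\<theta> ` S) \<le> ne E S" and e: "e \<subseteq> S"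
  shows "e \<in> E \<longleftrightarrow> \<theta> ` e \<in> E'"
proof -
  let ?A = "{e \<in> E. e \<subseteq> S}"
  have inj': "inj_on ((`) \<theta>) (Pow S)" by (rule inj_on_image_Pow[OF inj])
  have "inj_on ((`) \<theta>) ?A" by (rule inj_on_subset[OF inj']) auto
  then have "card ((`) \<theta> ` ?A) = ne E S" unfolding ne_def by (rule card_image)
  then have "(`) \<theta> ` ?A = {e \<in> E'. e \<subseteq> \<theta> ` S}"
    using assms by (intro card_seteq finite_edges_within) (auto simp: ne_def)
  then have *: "\<theta> ` e \<in> (`) \<theta> ` ?A" if "\<theta> ` e \<in> E'" using that e by auto
  have "e \<in> E" if img: "\<theta> ` e \<in> E'"
  proof -
    from *[OF img] obtain e' where "e' \<in> ?A" "\<theta> ` e = \<theta> ` e'" by blast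
    then show ?thesis using inj_on_image_eq_iff[OF inj e, of e'] by auto
  qed
  then show ?thesis using assms(3)[OF e] by blast
qed

locale sparse_exponent =
  fixes s m :: nat and \<epsilon> :: real
  assumes s_ge: "2 \<le> s" and m_ge: "1 \<le> m" and eps_pos: "0 < \<epsilon>" and eps_less: "\<epsilon> * 2 ^ m < 1"
    and non_exceptional: "\<And>e c :: nat. 1 \<le> c \<Longrightarrow> \<epsilon> * real e = real c \<Longrightarrow> 2 ^ m * Suc c < e"
begin

text \<open>\<open>cyc\<close> is \<open>- 1\<close> for a hypertree and \<open>0\<close> for a connected unicyclic hypergraph. With edge
  probability \<open>n\<close> to the power \<open>- \<alpha>\<close>, where \<open>\<alpha> = s - 1 - \<epsilon>\<close>, the expected number of copies of a
  fixed hypergraph is of order \<open>n\<close> to the power \<open>wt\<close>.\<close>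

definition cyc :: "'a set set \<Rightarrow> 'a set \<Rightarrow> int" where
  "cyc E S = (int s - 1) * int (ne E S) - int (card S)"

definition wt :: "'a set set \<Rightarrow> 'a set \<Rightarrow> real" where
  "wt E S = \<epsilon> * real (ne E S) - real_of_int (cyc E S)"

text \<open>A set is strong for \<open>\<rho>\<close> if every bounded proper extension has more than \<open>\<rho>\<close> new edges per
  new independent cycle: for \<open>s = 2\<close>, no path with at most \<open>\<rho>\<close> edges connects two of its vertices
  from outside.\<close>

definition strong :: "nat \<Rightarrow> nat \<Rightarrow> 'a set \<Rightarrow> 'a set set \<Rightarrow> 'a set \<Rightarrow> bool" where
  "strong N \<rho> V E C \<longleftrightarrow> (\<forall>Y. C \<subset> Y \<longrightarrow> Y \<subseteq> V \<longrightarrow> card Y \<le> N \<longrightarrow>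
     int \<rho> * (cyc E Y - cyc E C) < int (ne E Y) - int (ne E C))"

text \<open>Positivity is demanded of every nonempty part because, in the second moment, pairs of
  copies overlapping in the part \<open>S\<close> contribute about n to the power
  \<open>- wt F S\<close> relative to the squared mean.\<close>

definition balanced :: "'a set \<Rightarrow> 'a set set \<Rightarrow> bool" where
  "balanced W F \<longleftrightarrow> finite W \<and> (\<forall>e\<in>F. e \<subseteq> W \<and> card e = s) \<and> (\<forall>S\<subseteq>W. S \<noteq> {} \<longrightarrow> 0 < wt F S)"

text \<open>\<open>gap\<close> is the least loss of weight in a non-strong extension, \<open>core_size\<close> bounds the closure of
  the first vertex, \<open>N1\<close> bounds all sets that matter for the game, and \<open>N2\<close> also covers the
  iteration in the proof of \<open>far_vertex\<close>.\<close>

definition gap :: real where "gap = 1 - \<epsilon> * 2 ^ m"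

definition core_size :: nat where "core_size = nat \<lceil>real s * 2 ^ m * (1 / gap + 1)\<rceil> + 1"

definition N1 :: nat where "N1 = core_size + s * 2 ^ m"

definition N2 :: nat where "N2 = N1 + 1 + nat \<lceil>real (N1 + 2) / gap\<rceil> * (s * 2 ^ m)"

text \<open>The copy clauses speak of hypergraphs on \<open>{..<h}\<close>, of which there are
  finitely many for bounded \<open>h\<close>, so each can be treated separately with high
  probability. The first clause only preserves edges but avoids any given bounded set; the second
  gives exact and strong copies, for the first round.\<close>

definition rich :: "'a set \<Rightarrow> 'a set set \<Rightarrow> bool" where
  "rich V E \<longleftrightarrow> finite V \<and> N2 \<le> card V \<and> (\<forall>e\<in>E. e \<subseteq> V \<and> card e = s) \<and>
     (\<forall>S\<subseteq>V. card S \<le> N2 \<longrightarrow> 0 \<le> wt E S) \<and>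
     (\<forall>B\<subseteq>V. card B \<le> N2 \<longrightarrow> (\<forall>v\<in>B. \<exists>e\<in>E. e \<inter> B = {v})) \<and>
     (\<forall>h\<le>N2. \<forall>F. balanced {..<h} F \<longrightarrow> (\<forall>A. finite A \<longrightarrow> card A \<le> N2 \<longrightarrow>
        (\<exists>\<phi>. inj_on \<phi> {..<h} \<and> \<phi> ` {..<h} \<subseteq> V - A \<and> (\<forall>e\<in>F. \<phi> ` e \<in> E)))) \<and>
     (\<forall>h\<le>N1. \<forall>F. balanced {..<h} F \<longrightarrow>
        (\<exists>\<phi>. inj_on \<phi> {..<h} \<and> \<phi> ` {..<h} \<subseteq> V \<and> (\<forall>e\<subseteq>{..<h}. e \<in> F \<longleftrightarrow> \<phi> ` e \<in> E) \<and>
          strong N1 (2 ^ m) V E (\<phi> ` {..<h})))"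

text \<open>\<open>r\<close> is the number of halvings left, and \<open>s * 2 ^ r\<close> vertices
  are held in reserve for them. For r > 0 the next round adds one vertex or at most
  \<open>(s - 1) * 2 ^ (r - 1)\<close>, and half of the reserve remains.\<close>

definition stage :: "nat \<Rightarrow> 'a set \<Rightarrow> 'a set set \<Rightarrow> 'a set \<Rightarrow> bool" where
  "stage r V E C \<longleftrightarrow> card C + s * 2 ^ r \<le> N1 \<and> strong N1 (2 ^ r) V E C"

lemma gap_pos: "0 < gap" using eps_less by (simp add: gap_def)

lemma N1_less_N2: "N1 < N2" by (simp add: N2_def)

lemma two_le_pow: "2 \<le> (2::'b::linordered_semidom) ^ m"
  using power_increasing[of 1 m "2::'b"] m_ge by simp

lemma two_eps: "2 * \<epsilon> \<le> \<epsilon> * 2 ^ m"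
  using two_le_pow[where ?'b = real] eps_pos by simp

lemma eps_half: "2 * \<epsilon> < 1"
  using two_eps eps_less by linarith

lemma wt_alt: "wt E S = real (card S) - (real s - 1 - \<epsilon>) * real (ne E S)"
  by (simp add: wt_def cyc_def algebra_simps)

lemma exponent_pos: "0 < real s - 1 - \<epsilon>"
  using s_ge eps_half eps_pos by linarith

lemma wt_le_card: "wt E S \<le> real (card S)"
  unfolding wt_alt using exponent_pos by simp

lemma wt_submodular:
  assumes "finite A" "finite B"
  shows "wt E (A \<union> B) + wt E (A \<inter> B) \<le> wt E A + wt E B"
proof -
  have "(real s - 1 - \<epsilon>) * real (ne E A + ne E B) \<le>
      (real s - 1 - \<epsilon>) * real (ne E (A \<union> B) + ne E (A \<inter> B))"
    using ne_supermodular[OF assms, of E] exponent_pos by (intro mult_left_mono) (auto simp only: of_nat_le_iff less_imp_le)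
  moreover have "real (card A) + real (card B) = real (card (A \<union> B)) + real (card (A \<inter> B))"
    using card_Un_Int[OF assms] by linarith
  ultimately show ?thesis by (simp add: wt_alt algebra_simps)
qed

lemma cyc_cong: "(\<And>e. e \<subseteq> S \<Longrightarrow> e \<in> E \<longleftrightarrow> e \<in> F) \<Longrightarrow> cyc E S = cyc F S"
  unfolding cyc_def using ne_cong[of S E F] by simp

lemma wt_cong: "(\<And>e. e \<subseteq> S \<Longrightarrow> e \<in> E \<longleftrightarrow> e \<in> F) \<Longrightarrow> wt E S = wt F S"
  unfolding wt_def using ne_cong[of S E F] cyc_cong[of S E F] by simp

section \<open>Strong sets and their light extensions\<close>

lemma strongD:
  "strong N \<rho> V E C \<Longrightarrow> C \<subset> Y \<Longrightarrow> Y \<subseteq> V \<Longrightarrow> card Y \<le> N \<Longrightarrow>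
     int \<rho> * (cyc E Y - cyc E C) < int (ne E Y) - int (ne E C)"
  unfolding strong_def by blast

text \<open>If \<open>cyc E Y < cyc E C\<close>, a smaller factor raises the left side; it stays
  negative by \<open>1 \<le> \<rho>'\<close>, while the number of edges does not drop.\<close>

lemma strong_mono:
  assumes "strong N \<rho> V E C" "1 \<le> \<rho>'" "\<rho>' \<le> \<rho>" "finite V"
  shows "strong N \<rho>' V E C"
  unfolding strong_def
proof (intro allI impI)
  fix Y assume Y: "C \<subset> Y" "Y \<subseteq> V" "card Y \<le> N"
  show "int \<rho>' * (cyc E Y - cyc E C) < int (ne E Y) - int (ne E C)"
  proof (cases "cyc E Y - cyc E C \<ge> 0")
    case True
    then have "int \<rho>' * (cyc E Y - cyc E C) \<le> int \<rho> * (cyc E Y - cyc E C)"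
      using assms by (intro mult_right_mono) auto
    then show ?thesis using strongD[OF assms(1) Y] by linarith
  next
    case False
    then have "int \<rho>' * (cyc E Y - cyc E C) < 0" using assms by (intro mult_pos_neg) auto
    moreover have "ne E C \<le> ne E Y" using Y assms by (intro ne_mono) (auto intro: finite_subset)
    ultimately show ?thesis by linarith
  qed
qed

text \<open>Halving \<open>\<rho>\<close> compensates for the one additional vertex chosen in a round.\<close>

lemma light_cases:
  assumes V: "finite V" and st: "strong N (2 * R) V E C" and Y: "C \<subset> Y" "Y \<subseteq> V" "card Y \<le> N"
    and R: "1 \<le> R" and light: "int (ne E Y) - int (ne E C) \<le> int R * (cyc E Y - cyc E C + 1)"
  shows "(cyc E Y = cyc E C - 1 \<and> ne E Y = ne E C \<and> card Y = card C + 1) \<or>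
    (cyc E Y = cyc E C \<and> ne E Y \<le> ne E C + R \<and> card Y = card C + (s - 1) * (ne E Y - ne E C))"
proof -
  define d where "d = cyc E Y - cyc E C"
  have le: "ne E C \<le> ne E Y" using Y V by (intro ne_mono) (auto intro: finite_subset)
  have 1: "2 * (int R * d) < int (ne E Y) - int (ne E C)" using strongD[OF st Y] by (simp add: d_def)
  have 2: "int (ne E Y) - int (ne E C) \<le> int R * d + int R" using light by (simp add: d_def algebra_simps)
  \<comment> \<open>For the q new edges, strength gives 2 R d < q and lightness gives q \<le> R d +
    R, hence d < 1; q \<ge> 0 gives d \<ge> -1.\<close>
  have "int R * d < int R" using 1 2 by linarith
  then have "d < 1" using R by (simp add: mult_less_cancel_left1)
  have "0 \<le> int R * (d + 1)" using 2 le by (simp add: algebra_simps)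
  then have "0 \<le> d + 1" using R by (simp add: zero_le_mult_iff)
  have c: "int (card Y) = int (card C) + (int s - 1) * (int (ne E Y) - int (ne E C)) - d"
    by (simp add: d_def cyc_def algebra_simps)
  consider "d = -1" | "d = 0" using \<open>d < 1\<close> \<open>0 \<le> d + 1\<close> by linarith
  then show ?thesis
  proof cases
    case 1
    then have "ne E Y = ne E C" using 2 le by simp
    then show ?thesis using c 1 by (simp add: d_def)
  next
    case d0: 2
    have "int (card Y) = int (card C + (s - 1) * (ne E Y - ne E C))"
      using c d0 le s_ge by (simp add: of_nat_diff)
    then have "card Y = card C + (s - 1) * (ne E Y - ne E C)" by (simp only: of_nat_eq_iff)
    then show ?thesis using 2 d0 by (simp add: d_def)
  qed
qed

text \<open>x surplus edges would close (s - 1) x cycles at a cost of less than x + q \<le> x + R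
  edges, too few for \<open>2 * R\<close>. A set violating strength over \<open>D\<close> would be
  light over \<open>C\<close>; by \<open>light_cases\<close> it then has \<open>cyc\<close> at most
  that of \<open>C\<close>, so no more than q new edges and no more vertices than
  \<open>D\<close>.\<close>

lemma strong_zero_extension:
  assumes V: "finite V" and st: "strong N (2 * R) V E C" and D: "C \<subseteq> D" "D \<subseteq> V" "card D \<le> N"
    and q: "card D = card C + (s - 1) * q" "q \<le> R" "ne E C + q \<le> ne E D" and R: "1 \<le> R"
  shows "ne E D = ne E C + q" "strong N R V E D"
proof -
  have fin: "finite D" "finite C" using V D by (auto intro: finite_subset)
  have "int (card D) = int (card C) + (int s - 1) * int q" using q(1) s_ge by (simp add: of_nat_diff)
  then have cyc_eq: "cyc E D - cyc E C = (int s - 1) * (int (ne E D) - int (ne E C) - int q)"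
    by (simp add: cyc_def algebra_simps)
  show ne_eq: "ne E D = ne E C + q"
  proof (rule ccontr)
    assume neq: "ne E D \<noteq> ne E C + q"
    define x where "x = int (ne E D) - int (ne E C) - int q"
    have x: "1 \<le> x" using q(3) neq by (simp add: x_def)
    have "C \<noteq> D" using neq q(3) by auto
    then have "2 * int R * ((int s - 1) * x) < x + int q"
      using strongD[OF st _ D(2,3)] D(1) cyc_eq by (simp add: x_def psubset_eq)
    moreover have "2 * int R * x \<le> 2 * int R * ((int s - 1) * x)"
      using x s_ge by (intro mult_left_mono) (auto simp: mult_le_cancel_right1)
    moreover have "int R * 1 \<le> int R * x" using x by (intro mult_left_mono) auto
    moreover have "1 * x \<le> int R * x" using x R by (intro mult_right_mono) auto
    ultimately show False using q(2) by linarith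
  qed
  have cyc0: "cyc E D = cyc E C" using cyc_eq ne_eq by simp
  show "strong N R V E D"
    unfolding strong_def
  proof (intro allI impI, rule ccontr)
    fix Y assume Y: "D \<subset> Y" "Y \<subseteq> V" "card Y \<le> N"
      and "\<not> int R * (cyc E Y - cyc E D) < int (ne E Y) - int (ne E D)"
    then have le: "int (ne E Y) - int (ne E D) \<le> int R * (cyc E Y - cyc E C)" by (simp add: cyc0)
    have fY: "finite Y" using Y V by (auto intro: finite_subset)
    have "int (ne E Y) - int (ne E C) \<le> int R * (cyc E Y - cyc E C + 1)"
      using le ne_eq q(2) by (simp add: algebra_simps)
    note light_cases[OF V st subset_psubset_trans[OF D(1) Y(1)] Y(2,3) R this]
    then consider "cyc E Y < cyc E C" | "cyc E Y = cyc E C" "card Y = card C + (s - 1) * (ne E Y - ne E C)"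
      by linarith
    then show False
    proof cases
      case 1
      then have "int R * (cyc E Y - cyc E C) < 0" using R by (intro mult_pos_neg) auto
      then show False using le ne_mono[OF fY psubset_imp_subset[OF Y(1)], of E] by linarith
    next
      case 2
      then have "ne E Y \<le> ne E D" using le by simp
      then have "ne E Y - ne E C \<le> q" using ne_eq by simp
      then have "card Y \<le> card D" using 2 q(1) by simp
      then show False using psubset_card_mono[OF fY Y(1)] by simp
    qed
  qed
qed

lemma rich_simps:
  assumes "rich V E"
  shows "finite V" "N2 \<le> card V" "\<And>e. e \<in> E \<Longrightarrow> e \<subseteq> V" "\<And>e. e \<in> E \<Longrightarrow> card e = s"
    "\<And>S. S \<subseteq> V \<Longrightarrow> card S \<le> N2 \<Longrightarrow> 0 \<le> wt E S"
    "\<And>B v. B \<subseteq> V \<Longrightarrow> card B \<le> N2 \<Longrightarrow> v \<in> B \<Longrightarrow> \<exists>e\<in>E. e \<inter> B = {v}"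
proof -
  note r = assms[unfolded rich_def]
  show "finite V" by (rule r[THEN conjunct1])
  show "N2 \<le> card V" by (rule r[THEN conjunct2, THEN conjunct1])
  show "\<And>e. e \<in> E \<Longrightarrow> e \<subseteq> V" "\<And>e. e \<in> E \<Longrightarrow> card e = s"
    using r[THEN conjunct2, THEN conjunct2, THEN conjunct1] by auto
  show "\<And>S. S \<subseteq> V \<Longrightarrow> card S \<le> N2 \<Longrightarrow> 0 \<le> wt E S"
    using r[THEN conjunct2, THEN conjunct2, THEN conjunct2, THEN conjunct1] by blast
  show "\<And>B v. B \<subseteq> V \<Longrightarrow> card B \<le> N2 \<Longrightarrow> v \<in> B \<Longrightarrow> \<exists>e\<in>E. e \<inter> B = {v}"
    using r[THEN conjunct2, THEN conjunct2, THEN conjunct2, THEN conjunct2, THEN conjunct1] by blast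
qed

lemma rich_copies:
  assumes "rich V E" "balanced {..<h} F"
  shows "h \<le> N2 \<Longrightarrow> finite A \<Longrightarrow> card A \<le> N2 \<Longrightarrow>
      \<exists>\<phi>. inj_on \<phi> {..<h} \<and> \<phi> ` {..<h} \<subseteq> V - A \<and> (\<forall>e\<in>F. \<phi> ` e \<in> E)"
    and "h \<le> N1 \<Longrightarrow> \<exists>\<phi>. inj_on \<phi> {..<h} \<and> \<phi> ` {..<h} \<subseteq> V \<and> (\<forall>e\<subseteq>{..<h}. e \<in> F \<longleftrightarrow> \<phi> ` e \<in> E) \<and>
          strong N1 (2 ^ m) V E (\<phi> ` {..<h})"
proof -
  note r = assms(1)[unfolded rich_def, THEN conjunct2, THEN conjunct2, THEN conjunct2, THEN conjunct2, THEN conjunct2]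
  show "h \<le> N2 \<Longrightarrow> finite A \<Longrightarrow> card A \<le> N2 \<Longrightarrow>
      \<exists>\<phi>. inj_on \<phi> {..<h} \<and> \<phi> ` {..<h} \<subseteq> V - A \<and> (\<forall>e\<in>F. \<phi> ` e \<in> E)"
    by (rule r[THEN conjunct1, rule_format, OF _ assms(2)])
  show "h \<le> N1 \<Longrightarrow> \<exists>\<phi>. inj_on \<phi> {..<h} \<and> \<phi> ` {..<h} \<subseteq> V \<and> (\<forall>e\<subseteq>{..<h}. e \<in> F \<longleftrightarrow> \<phi> ` e \<in> E) \<and>
          strong N1 (2 ^ m) V E (\<phi> ` {..<h})"
    using r[THEN conjunct2] assms(2) by presburger
qed

text \<open>A new cycle over \<open>C\<close> costs more than 2 R edges, and \<open>Y\<close> offers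
  only R. The bound is needed for all intermediate sets, since copies are built edge by edge and
  overlaps with \<open>Y\<close> are arbitrary.\<close>

lemma strong_cyc_le:
  assumes st: "strong N (2 * R) V E C" and R: "1 \<le> R"
    and Y: "Y \<subseteq> V" "finite Y" "card Y \<le> N" "ne E Y \<le> ne E C + R" and J: "C \<subseteq> J" "J \<subseteq> Y"
  shows "cyc E J \<le> cyc E C"
proof (cases "J = C")
  case False
  have "card J \<le> N" using card_mono[OF Y(2) J(2)] Y(3) by linarith
  then have "int (2 * R) * (cyc E J - cyc E C) < int (ne E J) - int (ne E C)"
    using J False Y by (intro strongD[OF st]) auto
  moreover have "int (ne E J) - int (ne E C) \<le> int R" using ne_mono[OF Y(2) J(2), of E] Y(4) by linarith
  ultimately have "int (2 * R) * (cyc E J - cyc E C) < int (2 * R) * 1" by simp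
  moreover have "0 < int (2 * R)" using R by simp
  ultimately have "cyc E J - cyc E C < 1" by (rule mult_less_cancel_left_pos[THEN iffD1, rotated])
  then show ?thesis by simp
qed simp

text \<open>Suppose every vertex has such a \<open>Y\<close>, and choose \<open>w\<close> outside \<open>C\<close> for which the least number of
  edges of \<open>Y\<close> is maximal. Attach a fresh edge at \<open>w\<close> and adjoin the set \<open>Y\<close> belonging to another
  vertex of that edge. By the choice of \<open>w\<close> this closes a new cycle, hence lowers the weight by at
  least \<open>gap\<close>. Iterating gives a bounded set of negative weight.\<close>

lemma far_vertex:
  assumes rich: "rich V E" and st: "strong N1 (2 * R) V E C" and C: "C \<subseteq> V" "card C + s * R \<le> N1"
    and R: "1 \<le> R" "R + 1 \<le> 2 ^ m"
  shows "\<exists>y\<in>V - C. \<forall>Y. C \<subseteq> Y \<longrightarrow> y \<in> Y \<longrightarrow> Y \<subseteq> V \<longrightarrow> cyc E Y = cyc E C \<longrightarrow> ne E Y \<le> ne E C + R \<longrightarrow> False"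
proof (rule ccontr)
  assume "\<not> ?thesis"
  then have bad: "\<exists>Y. C \<subseteq> Y \<and> y \<in> Y \<and> Y \<subseteq> V \<and> cyc E Y = cyc E C \<and> ne E Y \<le> ne E C + R" if "y \<in> V - C" for y
    using that by blast
  have V: "finite V" by (rule rich_simps[OF rich])
  have finV: "finite S" if "S \<subseteq> V" for S using V that by (rule rev_finite_subset)
  \<comment> \<open>\<open>lam y\<close> plays the role of a distance from \<open>C\<close>: the
    least number of edges in a set that joins \<open>y\<close> to \<open>C\<close> without changing
    \<open>cyc\<close>.\<close>
  define link where "link y q \<longleftrightarrow> (\<exists>Y. C \<subseteq> Y \<and> y \<in> Y \<and> Y \<subseteq> V \<and> cyc E Y = cyc E C \<and> ne E Y = ne E C + q)" for y q
  define lam where "lam y = (LEAST q. link y q)" for y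
  have link_ex: "\<exists>q\<le>R. link y q" if y: "y \<in> V - C" for y
  proof -
    obtain Y where Y: "C \<subseteq> Y" "y \<in> Y" "Y \<subseteq> V" "cyc E Y = cyc E C" "ne E Y \<le> ne E C + R"
      using bad[OF y] by blast
    moreover have "ne E C \<le> ne E Y" using Y finV by (intro ne_mono) auto
    ultimately have "ne E Y = ne E C + (ne E Y - ne E C)" "ne E Y - ne E C \<le> R" by auto
    then show ?thesis using Y unfolding link_def by blast
  qed
  have lam: "link y (lam y)" "lam y \<le> R" if "y \<in> V - C" for y
    using link_ex[OF that] unfolding lam_def by (auto intro: LeastI Least_le order_trans)
  have lam_le: "lam y \<le> q" if "link y q" for y q using that unfolding lam_def by (rule Least_le)
  have "card C < card V" using C rich_simps(2)[OF rich] N1_less_N2 by linarith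
  then have "V - C \<noteq> {}" using C by auto
  moreover have "finite (V - C)" using V by simp
  ultimately have "Max (lam ` (V - C)) \<in> lam ` (V - C)" by (intro Max_in) auto
  then obtain w where w: "w \<in> V - C" "lam w = Max (lam ` (V - C))" by auto
  have w_max: "lam y \<le> lam w" if "y \<in> V - C" for y unfolding w(2) using V that by simp

  have step: "\<exists>W'. W' \<subseteq> V \<and> C \<subseteq> W' \<and> w \<in> W' \<and> card W' \<le> card W + s * 2 ^ m \<and> wt E W' \<le> wt E W - gap"
    if W: "W \<subseteq> V" "C \<subseteq> W" "w \<in> W" "card W \<le> N2" for W
  proof -
    obtain b where b: "b \<in> E" "b \<inter> W = {w}" using rich_simps(6)[OF rich W(1,4,3)] by blast
    have bV: "b \<subseteq> V" "card b = s" using rich_simps(3,4)[OF rich] b by auto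
    define W1 where "W1 = W \<union> b"
    have fin: "finite W" "finite b" "finite W1" using W bV finV by (auto simp: W1_def)
    have W1_V: "W1 \<subseteq> V" using W bV by (auto simp: W1_def)
    have "card W1 + 1 = card W + s"
      using card_Un_Int[OF fin(1,2)] b bV by (simp add: W1_def Int_commute)
    then have cardW1: "real (card W1) = real (card W) + real s - 1" "card W1 \<le> card W + s" by linarith+
    have "\<not> b \<subseteq> W"
    proof
      assume "b \<subseteq> W"
      then have "b = {w}" using b by auto
      then show False using bV s_ge by simp
    qed
    have ins: "insert b {e \<in> E. e \<subseteq> W} \<subseteq> {e \<in> E. e \<subseteq> W1}" using b by (auto simp: W1_def)
    have card_ins: "card (insert b {e \<in> E. e \<subseteq> W}) = ne E W + 1"
      using \<open>\<not> b \<subseteq> W\<close> finite_edges_within[OF fin(1)] by (simp add: ne_def)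
    have neW1: "ne E W + 1 \<le> ne E W1"
      using card_mono[OF finite_edges_within[OF fin(3)] ins] card_ins by (simp add: ne_def)
    show ?thesis
    proof (cases "ne E W1 = ne E W + 1")
      case False
      \<comment> \<open>Two edges on s - 1 new vertices already change the weight by at most 2
        \<epsilon> - (s - 1) \<le> 2 \<epsilon> - 1 \<le> - \<open>gap\<close>.\<close>
      then have "2 \<le> real (ne E W1) - real (ne E W)" using neW1 by linarith
      then have "(real s - 1 - \<epsilon>) * 2 \<le> (real s - 1 - \<epsilon>) * (real (ne E W1) - real (ne E W))"
        using exponent_pos by (intro mult_left_mono) auto
      then have "wt E W1 \<le> wt E W + (real s - 1) - (real s - 1 - \<epsilon>) * 2"
        using cardW1 by (simp add: wt_alt algebra_simps)
      moreover have "2 \<le> real s" using s_ge by simp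
      ultimately have "wt E W1 \<le> wt E W - gap" using two_eps unfolding gap_def by argo
      moreover have "s * 1 \<le> s * 2 ^ m" by (intro mult_left_mono) auto
      then have "card W1 \<le> card W + s * 2 ^ m" using cardW1 by linarith
      moreover have "C \<subseteq> W1" "w \<in> W1" using W by (auto simp: W1_def)
      ultimately show ?thesis using W1_V by blast
    next
      case True
      have edges_W1: "{e \<in> E. e \<subseteq> W1} = insert b {e \<in> E. e \<subseteq> W}"
        using True card_ins ins
        by (intro card_seteq[symmetric] finite_edges_within fin) (auto simp: ne_def)
      have "\<not> b \<subseteq> {w}" using \<open>\<not> b \<subseteq> W\<close> W by auto
      then obtain z where z: "z \<in> b" "z \<noteq> w" by auto
      then have zW: "z \<notin> W" using b by auto
      have zV: "z \<in> V - C" using z zW bV W by auto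
      obtain Y where Y: "C \<subseteq> Y" "z \<in> Y" "Y \<subseteq> V" "cyc E Y = cyc E C" "ne E Y = ne E C + lam z"
        using lam(1)[OF zV] unfolding link_def by blast
      have fY: "finite Y" using finV Y by blast
      have neY: "ne E Y \<le> ne E C + R" using Y lam(2)[OF zV] by simp
      have "int (card Y) - int (card C) = (int s - 1) * int (lam z)"
        using Y(4,5) by (simp add: cyc_def algebra_simps)
      also have "\<dots> \<le> (int s - 1) * int R" using lam(2)[OF zV] s_ge by (intro mult_left_mono) auto
      also have "\<dots> = int (s * R) - int R" by (simp add: algebra_simps)
      finally have cardY: "card Y + R \<le> card C + s * R" by linarith
      have "card Y \<le> N1" using cardY C by linarith
      note cyc_le = strong_cyc_le[OF st R(1) Y(3) fY this neY]
      define I I0 where "I = Y \<inter> W1" and "I0 = Y \<inter> W"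
      have sub: "C \<subseteq> I" "C \<subseteq> I0" "I \<subseteq> Y" "I0 \<subseteq> Y" "I0 \<subseteq> I" using Y W by (auto simp: I_def I0_def W1_def)
      have fI: "finite I" "finite I0" using sub fY by (auto intro: finite_subset)
      have edges_I: "{e \<in> E. e \<subseteq> I} \<subseteq> insert b {e \<in> E. e \<subseteq> I0}"
        using edges_W1 by (auto simp: I_def I0_def)
      \<comment> \<open>If \<open>b\<close> lies in the overlap \<open>I\<close>, then
        \<open>cyc E I0 = cyc E C\<close> would let \<open>I0\<close> join \<open>w\<close> to
        \<open>C\<close> with fewer than \<open>lam z \<le> lam w\<close> edges. If not,
        \<open>z\<close> enters \<open>I\<close> without any edge beyond those of \<open>I0\<close>,
        which lowers \<open>cyc\<close>. Either way \<open>Y\<close> closes a cycle over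
        \<open>I\<close>.\<close>
      have cycI: "cyc E I \<le> cyc E C - 1"
      proof (cases "b \<subseteq> I")
        case True
        have "card {e \<in> E. e \<subseteq> I} \<le> card (insert b {e \<in> E. e \<subseteq> I0})"
          using edges_I finite_edges_within[OF fI(2)] by (intro card_mono) auto
        then have neI: "ne E I \<le> ne E I0 + 1"
          using finite_edges_within[OF fI(2)] by (auto simp: ne_def card_insert_if split: if_splits)
        have "b \<in> {e \<in> E. e \<subseteq> I} - {e \<in> E. e \<subseteq> I0}" using True b \<open>\<not> b \<subseteq> W\<close> by (auto simp: I0_def)
        then have "{e \<in> E. e \<subseteq> I0} \<subset> {e \<in> E. e \<subseteq> I}" using sub by auto
        then have neI': "ne E I0 < ne E I" unfolding ne_def by (intro psubset_card_mono finite_edges_within fI)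
        have "I = I0 \<union> (b - {w})" "I0 \<inter> (b - {w}) = {}" using True b by (auto simp: I_def I0_def W1_def)
        then have "card I = card I0 + card (b - {w})" using fI fin by (simp add: card_Un_disjoint)
        moreover have "card (b - {w}) = s - 1" using b bV fin by (subst card_Diff_singleton) auto
        ultimately have "int (card I) = int (card I0) + (int s - 1)" using s_ge by simp
        moreover have "(int s - 1) * int (ne E I) \<le> (int s - 1) * (int (ne E I0) + 1)"
          using neI s_ge by (intro mult_left_mono) auto
        ultimately have "cyc E I \<le> cyc E I0" unfolding cyc_def by (simp add: algebra_simps)
        moreover have "cyc E I0 \<noteq> cyc E C"
        proof
          assume eq: "cyc E I0 = cyc E C"
          have "ne E C \<le> ne E I0" using fI sub by (intro ne_mono)
          then have "link w (ne E I0 - ne E C)"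
            unfolding link_def using sub Y eq True b W by (intro exI[of _ I0]) (auto simp: I0_def I_def)
          then have "lam w \<le> ne E I0 - ne E C" by (rule lam_le)
          moreover have "ne E I \<le> ne E Y" using fY sub by (intro ne_mono)
          ultimately show False using neI' w_max[OF zV] Y(5) \<open>ne E C \<le> ne E I0\<close> by linarith
        qed
        ultimately show ?thesis using cyc_le[of I0] sub by simp
      next
        case False
        then have "{e \<in> E. e \<subseteq> I} \<subseteq> {e \<in> E. e \<subseteq> I0}" using edges_I by auto
        then have "ne E I \<le> ne E I0" unfolding ne_def by (intro card_mono finite_edges_within fI)
        then have "(int s - 1) * int (ne E I) \<le> (int s - 1) * int (ne E I0)"
          using s_ge by (intro mult_left_mono) auto
        moreover have "z \<in> I - I0" using z Y zW by (auto simp: I_def I0_def W1_def)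
        then have "I0 \<subset> I" using sub by auto
        then have "card I0 < card I" by (rule psubset_card_mono[OF fI(1)])
        ultimately have "cyc E I < cyc E I0" unfolding cyc_def by linarith
        then show ?thesis using cyc_le[of I0] sub by simp
      qed
      have "ne E C \<le> ne E I" using fI sub by (intro ne_mono)
      then have "\<epsilon> * (real (ne E Y) - real (ne E I)) \<le> \<epsilon> * real R"
        using neY eps_pos by (intro mult_left_mono) linarith+
      moreover have "real_of_int (cyc E I) \<le> real_of_int (cyc E Y) - 1" using cycI Y(4) by linarith
      ultimately have wtY: "wt E Y - wt E I \<le> \<epsilon> * real R - 1"
        unfolding wt_def by (simp add: algebra_simps)
      \<comment> \<open>Attaching \<open>b\<close> gains \<epsilon>; adjoining \<open>Y\<close>
        gains at most \<epsilon> R and loses 1 for the cycle. The total is at most \<epsilon> (R +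
        1) - 1 \<le> - \<open>gap\<close>, by \<open>R + 1 \<le> 2 ^ m\<close>.\<close>
      have wtW1: "wt E W1 = wt E W + \<epsilon>" using cardW1 True by (simp add: wt_alt algebra_simps)
      have "wt E (Y \<union> W1) + wt E I \<le> wt E Y + wt E W1"
        unfolding I_def using fY fin by (intro wt_submodular)
      then have "wt E (Y \<union> W1) \<le> wt E W + \<epsilon> * (real R + 1) - 1"
        using wtY wtW1 by (simp add: algebra_simps)
      moreover have "real (R + 1) \<le> real (2 ^ m)" using R(2) by (simp only: of_nat_le_iff)
      then have "\<epsilon> * (real R + 1) \<le> \<epsilon> * 2 ^ m" using eps_pos by (intro mult_left_mono) auto
      ultimately have "wt E (Y \<union> W1) \<le> wt E W - gap" unfolding gap_def by linarith
      moreover have "card (Y \<union> W1) \<le> card W + s * 2 ^ m"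
      proof -
        have "card (Y \<union> W1) \<le> card ((Y - C) \<union> W1)" using fY fin W by (intro card_mono) (auto simp: W1_def)
        also have "\<dots> \<le> card (Y - C) + card W1" by (rule card_Un_le)
        also have "card (Y - C) = card Y - card C" using Y finV[OF C(1)] by (simp add: card_Diff_subset)
        also have "card Y - card C + card W1 \<le> s * R + (card W + s)" using cardY cardW1 by linarith
        also have "\<dots> = card W + s * (R + 1)" by simp
        also have "\<dots> \<le> card W + s * 2 ^ m" using R(2) by (intro add_left_mono mult_left_mono) auto
        finally show ?thesis .
      qed
      moreover have "C \<subseteq> Y \<union> W1" "w \<in> Y \<union> W1" "Y \<union> W1 \<subseteq> V" using W W1_V Y by (auto simp: W1_def)
      ultimately show ?thesis by blast
    qed
  qed
  \<comment> \<open>The initial set has weight at most \<open>N1 + 1\<close>, so \<open>M\<close>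
    losses of \<open>gap\<close> make the weight negative. The vertices added meanwhile are the last
    summand of \<open>N2\<close>.\<close>
  define M where "M = nat \<lceil>real (N1 + 2) / gap\<rceil>"
  have "\<exists>W. W \<subseteq> V \<and> C \<subseteq> W \<and> w \<in> W \<and> card W \<le> N1 + 1 + i * (s * 2 ^ m) \<and> wt E W \<le> real (N1 + 1) - real i * gap"
    if "i \<le> M" for i
    using that
  proof (induction i)
    case 0
    have "card (insert w C) \<le> N1 + 1" using C finV[OF C(1)] by (simp add: card_insert_if)
    moreover have "wt E (insert w C) \<le> real (card (insert w C))" by (rule wt_le_card)
    ultimately show ?case using w C by (intro exI[of _ "insert w C"]) auto
  next
    case (Suc i)
    then obtain W where W: "W \<subseteq> V" "C \<subseteq> W" "w \<in> W" "card W \<le> N1 + 1 + i * (s * 2 ^ m)"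
      "wt E W \<le> real (N1 + 1) - real i * gap" by auto
    have "i * (s * 2 ^ m) \<le> M * (s * 2 ^ m)" using Suc by (intro mult_right_mono) auto
    then have "card W \<le> N2" using W unfolding N2_def M_def by linarith
    from step[OF W(1-3) this] obtain W' where "W' \<subseteq> V" "C \<subseteq> W'" "w \<in> W'"
      "card W' \<le> card W + s * 2 ^ m" "wt E W' \<le> wt E W - gap" by blast
    then show ?case using W by (intro exI[of _ W']) (auto simp: algebra_simps)
  qed
  from this[of M] obtain W where W: "W \<subseteq> V" "card W \<le> N2" "wt E W \<le> real (N1 + 1) - real M * gap"
    unfolding N2_def M_def by auto
  have "real (N1 + 2) / gap \<le> real M" unfolding M_def by linarith
  then have "real (N1 + 2) \<le> real M * gap" using gap_pos by (simp add: divide_le_eq)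
  then have "wt E W < 0" using W by simp
  then show False using rich_simps(5)[OF rich W(1,2)] by simp
qed

section \<open>Transport along injections and embedding of sparse extensions\<close>

lemma cyc_image:
  assumes "inj_on \<theta> S" "finite S" "\<And>e. e \<subseteq> S \<Longrightarrow> e \<in> E \<longleftrightarrow> \<theta> ` e \<in> E'"
  shows "cyc E' (\<theta> ` S) = cyc E S"
  unfolding cyc_def using ne_image_eq[OF assms] card_image[OF assms(1)] by simp

lemma wt_image:
  assumes "inj_on \<theta> S" "finite S" "\<And>e. e \<subseteq> S \<Longrightarrow> e \<in> E \<longleftrightarrow> \<theta> ` e \<in> E'"
  shows "wt E' (\<theta> ` S) = wt E S"
  unfolding wt_def using ne_image_eq[OF assms] cyc_image[OF assms] by simp

lemma balanced_pos: "balanced W F \<Longrightarrow> S \<subseteq> W \<Longrightarrow> S \<noteq> {} \<Longrightarrow> 0 < wt F S"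
  by (simp add: balanced_def)

lemma balanced_transfer:
  assumes bal: "balanced U F" and b: "bij_betw b W U"
  shows "balanced W {e. e \<subseteq> W \<and> b ` e \<in> F}" (is "balanced W ?F")
  unfolding balanced_def
proof (intro conjI ballI allI impI)
  have inj: "inj_on b W" and im: "b ` W = U" using b by (auto simp: bij_betw_def)
  show fin: "finite W" using bal b bij_betw_finite by (auto simp: balanced_def)
  fix e assume e: "e \<in> ?F"
  then show "e \<subseteq> W" by simp
  have "card (b ` e) = card e" using inj_on_subset[OF inj] e by (intro card_image) auto
  then show "card e = s" using e bal by (auto simp: balanced_def)
next
  have inj: "inj_on b W" and im: "b ` W = U" using b by (auto simp: bij_betw_def)
  fix S assume S: "S \<subseteq> W" "S \<noteq> {}"
  have "finite W" using bal b bij_betw_finite by (auto simp: balanced_def)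
  then have fin: "finite S" using S(1) by (rule rev_finite_subset)
  have "wt F (b ` S) = wt ?F S"
    by (rule wt_image[OF inj_on_subset[OF inj S(1)] fin]) (use S in auto)
  moreover have "b ` S \<subseteq> U" "b ` S \<noteq> {}" using S im by auto
  then have "0 < wt F (b ` S)" by (rule balanced_pos[OF bal])
  ultimately show "0 < wt ?F S" by simp
qed

lemma copy_avoiding:
  fixes F :: "'b set set"
  assumes rich: "rich V E" and bal: "balanced U F" and "card U \<le> N2" "finite A" "card A \<le> N2"
  shows "\<exists>\<psi>. inj_on \<psi> U \<and> \<psi> ` U \<subseteq> V - A \<and> (\<forall>e\<in>F. \<psi> ` e \<in> E)"
proof -
  have "finite U" using bal by (simp add: balanced_def)
  then obtain b where b: "bij_betw b {..<card U} U"
    by (metis atLeast0LessThan ex_bij_betw_nat_finite)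
  from rich_copies(1)[OF rich balanced_transfer[OF bal b] assms(3-5)] obtain \<phi> where
    \<phi>: "inj_on \<phi> {..<card U}" "\<phi> ` {..<card U} \<subseteq> V - A"
      "\<And>e. e \<subseteq> {..<card U} \<Longrightarrow> b ` e \<in> F \<Longrightarrow> \<phi> ` e \<in> E" by auto
  let ?c = "inv_into {..<card U} b"
  have c: "bij_betw ?c U {..<card U}" by (rule bij_betw_inv_into[OF b])
  have "(\<phi> \<circ> ?c) ` e \<in> E" if e: "e \<in> F" for e
  proof -
    have eU: "e \<subseteq> U" using e bal by (auto simp: balanced_def)
    then have "?c ` e \<subseteq> {..<card U}" using c by (auto simp: bij_betw_def)
    moreover have "b ` ?c ` e = e" using b eU by (intro image_inv_into_cancel) (auto simp: bij_betw_def)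
    ultimately show ?thesis using \<phi>(3)[of "?c ` e"] e by (simp add: image_comp)
  qed
  moreover have "inj_on (\<phi> \<circ> ?c) U" using c \<phi>(1) by (auto simp: bij_betw_def intro: comp_inj_on)
  moreover have "(\<phi> \<circ> ?c) ` U \<subseteq> V - A" using c \<phi>(2) by (auto simp: bij_betw_def)
  ultimately show ?thesis by blast
qed

lemma copy_strong:
  fixes F :: "'b set set"
  assumes rich: "rich V E" and bal: "balanced U F" and "card U \<le> N1"
  shows "\<exists>\<psi>. inj_on \<psi> U \<and> \<psi> ` U \<subseteq> V \<and> (\<forall>e\<subseteq>U. e \<in> F \<longleftrightarrow> \<psi> ` e \<in> E) \<and> strong N1 (2 ^ m) V E (\<psi> ` U)"
proof -
  have "finite U" using bal by (simp add: balanced_def)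
  then obtain b where b: "bij_betw b {..<card U} U"
    by (metis atLeast0LessThan ex_bij_betw_nat_finite)
  from rich_copies(2)[OF rich balanced_transfer[OF bal b] assms(3)] obtain \<phi> where
    \<phi>: "inj_on \<phi> {..<card U}" "\<phi> ` {..<card U} \<subseteq> V"
      "\<And>e. e \<subseteq> {..<card U} \<Longrightarrow> b ` e \<in> F \<longleftrightarrow> \<phi> ` e \<in> E" "strong N1 (2 ^ m) V E (\<phi> ` {..<card U})"
    by auto
  let ?c = "inv_into {..<card U} b"
  have c: "bij_betw ?c U {..<card U}" by (rule bij_betw_inv_into[OF b])
  have "e \<in> F \<longleftrightarrow> (\<phi> \<circ> ?c) ` e \<in> E" if eU: "e \<subseteq> U" for e
  proof -
    have "?c ` e \<subseteq> {..<card U}" using c eU by (auto simp: bij_betw_def)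
    moreover have "b ` ?c ` e = e" using b eU by (intro image_inv_into_cancel) (auto simp: bij_betw_def)
    ultimately show ?thesis using \<phi>(3)[of "?c ` e"] by (simp add: image_comp)
  qed
  moreover have "inj_on (\<phi> \<circ> ?c) U" using c \<phi>(1) by (auto simp: bij_betw_def intro: comp_inj_on)
  moreover have "(\<phi> \<circ> ?c) ` U = \<phi> ` {..<card U}" by (simp only: image_comp[symmetric] bij_betw_imp_surj_on[OF c])
  ultimately show ?thesis using \<phi>(2,4) by (intro exI[of _ "\<phi> \<circ> ?c"]) simp
qed

text \<open>An extension all of whose intermediate steps have nonpositive cycle excess is obtained by
  successively attaching pendant edges and then adding a disjoint hypergraph that is sparse on
  its own.\<close>

lemma extend_embedding:
  assumes rich: "rich V' E'" and D: "finite D" "C \<subseteq> D" "card D \<le> N2"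
    and E: "\<And>e. e \<in> E \<Longrightarrow> card e = s"
    and sparse: "\<And>Y. C \<subseteq> Y \<Longrightarrow> Y \<subseteq> D \<Longrightarrow> cyc E Y \<le> cyc E C"
    and \<theta>: "inj_on \<theta> C" "\<theta> ` C \<subseteq> V'" "\<And>e. e \<in> E \<Longrightarrow> e \<subseteq> C \<Longrightarrow> \<theta> ` e \<in> E'"
  shows "\<exists>\<theta>'. inj_on \<theta>' D \<and> \<theta>' ` D \<subseteq> V' \<and> (\<forall>x\<in>C. \<theta>' x = \<theta> x) \<and> (\<forall>e\<in>E. e \<subseteq> D \<longrightarrow> \<theta>' ` e \<in> E')"
proof -
  define emb where "emb T \<theta>' \<longleftrightarrow> inj_on \<theta>' T \<and> \<theta>' ` T \<subseteq> V' \<and> (\<forall>x\<in>C. \<theta>' x = \<theta> x) \<and>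
    (\<forall>e\<in>E. e \<subseteq> T \<longrightarrow> \<theta>' ` e \<in> E')" for T \<theta>'
  \<comment> \<open>A largest set that can be embedded without changing \<open>cyc\<close> has
    absorbed all pendant edges inside \<open>D\<close>.\<close>
  define P where "P T \<longleftrightarrow> C \<subseteq> T \<and> T \<subseteq> D \<and> cyc E T = cyc E C \<and> (\<exists>\<theta>'. emb T \<theta>')" for T
  have "emb C \<theta>" using \<theta> by (simp add: emb_def)
  then have "P C" using D(2) by (auto simp: P_def)
  moreover have "\<forall>T. P T \<longrightarrow> card T < Suc (card D)" using D by (auto simp: P_def less_Suc_eq_le intro: card_mono)
  ultimately have "\<exists>T. P T \<and> (\<forall>T'. P T' \<longrightarrow> card T' \<le> card T)" by (rule ex_has_greatest_nat)
  then obtain T where T: "P T" "\<And>T'. P T' \<Longrightarrow> card T' \<le> card T" by (elim exE conjE) metis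
  then obtain \<phi> where \<phi>: "emb T \<phi>" and CT: "C \<subseteq> T" "T \<subseteq> D" "cyc E T = cyc E C" by (auto simp: P_def)
  have finT: "finite T" using CT D by (auto intro: finite_subset)
  have img: "card (\<phi> ` T) \<le> N2" "\<phi> ` T \<subseteq> V'"
    using card_image_le[OF finT, of \<phi>] card_mono[OF D(1) CT(2)] D(3) \<phi> by (auto simp: emb_def)
  \<comment> \<open>When an edge that meets \<open>T\<close> without lying in it is adjoined,
    \<open>cyc\<close> changes by (s - 1) q for q surplus edges plus
    \<open>card (e \<inter> T) - 1\<close>. Sparsity makes both nonnegative terms vanish, so the
    edge is pendant and \<open>T\<close> was not largest.\<close>
  have split: "e \<subseteq> T \<or> e \<inter> T = {}" if e: "e \<in> E" "e \<subseteq> D" for e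
  proof (rule ccontr)
    assume "\<not> (e \<subseteq> T \<or> e \<inter> T = {})"
    then have ne: "\<not> e \<subseteq> T" "e \<inter> T \<noteq> {}" by auto
    have fe: "finite e" "card e = s" using e E D by (auto intro: finite_subset)
    define T1 where "T1 = T \<union> e"
    have T1: "C \<subseteq> T1" "T1 \<subseteq> D" "finite T1" using CT e finT fe by (auto simp: T1_def)
    have "{x \<in> E. x \<subseteq> T} \<subset> {x \<in> E. x \<subseteq> T1}" using e ne by (auto simp: T1_def)
    then have neT1: "ne E T < ne E T1" unfolding ne_def by (intro psubset_card_mono finite_edges_within T1)
    have card1: "card T1 + card (e \<inter> T) = card T + s"
      using card_Un_Int[OF finT fe(1)] fe by (simp add: T1_def Int_commute)
    have cpos: "1 \<le> card (e \<inter> T)" using ne fe by (simp add: Suc_le_eq card_gt_0_iff)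
    define q where "q = int (ne E T1) - int (ne E T) - 1"
    have "q \<ge> 0" using neT1 by (simp add: q_def)
    have "cyc E T1 - cyc E T = (int s - 1) * (int (ne E T1) - int (ne E T)) - (int (card T1) - int (card T))"
      by (simp add: cyc_def algebra_simps)
    also have "\<dots> = (int s - 1) * q + (int (card (e \<inter> T)) - 1)"
      using card1 by (simp add: q_def algebra_simps)
    finally have cyc1: "cyc E T1 - cyc E T = (int s - 1) * q + (int (card (e \<inter> T)) - 1)" .
    have "cyc E T1 \<le> cyc E T" using sparse[OF T1(1,2)] CT by simp
    moreover have "0 \<le> (int s - 1) * q" using s_ge \<open>q \<ge> 0\<close> by simp
    ultimately have z: "(int s - 1) * q = 0" "card (e \<inter> T) = 1" "cyc E T1 = cyc E T" using cyc1 cpos by linarith+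
    then have "q = 0" using s_ge by simp
    obtain w where w: "e \<inter> T = {w}" using z(2) by (auto simp: card_1_singleton_iff)
    have cardi: "card (insert e {x \<in> E. x \<subseteq> T}) = ne E T + 1"
      using ne finite_edges_within[OF finT] by (simp add: ne_def)
    have edges1: "insert e {x \<in> E. x \<subseteq> T} = {x \<in> E. x \<subseteq> T1}"
      using cardi \<open>q = 0\<close> e
      by (intro card_seteq finite_edges_within T1) (auto simp: q_def ne_def T1_def)
    have "\<phi> w \<in> \<phi> ` T" using w by auto
    then obtain e' where e': "e' \<in> E'" "e' \<inter> \<phi> ` T = {\<phi> w}"
      using rich_simps(6)[OF rich img(2,1)] by blast
    have fe': "e' \<subseteq> V'" "card e' = s" using rich_simps(3,4)[OF rich] e' by auto
    then have fine': "finite e'" using rich_simps(1)[OF rich] by (auto intro: finite_subset)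
    have "card (e - T) = card (e' - \<phi> ` T)"
      using fe fe' fine' w e' by (simp add: card_Diff_subset_Int)
    then obtain g where g: "bij_betw g (e - T) (e' - \<phi> ` T)"
      using finite_same_card_bij[of "e - T" "e' - \<phi> ` T"] fe fine' by auto
    define \<psi> where "\<psi> x = (if x \<in> T then \<phi> x else g x)" for x
    have "inj_on \<psi> (T \<union> (e - T))" unfolding \<psi>_def
      using \<phi> g by (intro inj_on_disjoint_Un) (auto simp: emb_def bij_betw_def)
    then have "inj_on \<psi> T1" by (simp add: T1_def)
    moreover have "\<psi> ` T1 \<subseteq> V'" using img(2) g fe'(1) by (auto simp: \<psi>_def T1_def bij_betw_def)
    moreover have "\<forall>x\<in>C. \<psi> x = \<theta> x" using \<phi> CT by (auto simp: \<psi>_def emb_def)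
    moreover have "\<psi> ` x \<in> E'" if x: "x \<in> E" "x \<subseteq> T1" for x
    proof -
      have "x = e \<or> x \<subseteq> T" using edges1 x by auto
      moreover have "\<psi> ` x = \<phi> ` x" if "x \<subseteq> T" using that by (force simp: \<psi>_def)
      moreover have "\<psi> ` e = e'"
      proof -
        have "e = insert w (e - T)" using w by auto
        then have "\<psi> ` e = insert (\<psi> w) (\<psi> ` (e - T))" by (metis image_insert)
        also have "\<psi> w = \<phi> w" using w by (auto simp: \<psi>_def)
        also have "\<psi> ` (e - T) = g ` (e - T)" by (auto simp: \<psi>_def)
        also have "\<dots> = e' - \<phi> ` T" using g by (simp add: bij_betw_def)
        also have "insert (\<phi> w) (e' - \<phi> ` T) = e'" using e' by auto
        finally show ?thesis .
      qed
      ultimately show ?thesis using \<phi> x e' by (auto simp: emb_def)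
    qed
    ultimately have "emb T1 \<psi>" by (simp add: emb_def)
    then have "P T1" using T1(1,2) z(3) CT(3) by (auto simp: P_def)
    then have "card T1 \<le> card T" by (rule T(2))
    moreover have "T \<subset> T1" using ne by (auto simp: T1_def)
    then have "card T < card T1" by (rule psubset_card_mono[OF T1(3)])
    ultimately show False by simp
  qed
  define U where "U = D - T"
  define F where "F = {e \<in> E. e \<subseteq> U}"
  have finU: "finite U" using D by (simp add: U_def)
  \<comment> \<open>No edge inside \<open>D\<close> joins \<open>T\<close> to \<open>U\<close>, so
    \<open>cyc\<close> is additive and a part \<open>S\<close> of \<open>U\<close> has
    \<open>cyc E S \<le> 0\<close>. Its weight is positive because of its edges or, if it has none,
    because of its vertices.\<close>
  have "balanced U F"
    unfolding balanced_def
  proof (intro conjI ballI allI impI)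
    fix S assume S: "S \<subseteq> U" "S \<noteq> {}"
    have finS: "finite S" using S finU by (auto intro: finite_subset)
    have disj: "T \<inter> S = {}" using S by (auto simp: U_def)
    have TS: "T \<union> S \<subseteq> D" using S CT by (auto simp: U_def)
    have "{e \<in> E. e \<subseteq> T \<union> S} = {e \<in> E. e \<subseteq> T} \<union> {e \<in> E. e \<subseteq> S}"
    proof (intro equalityI subsetI)
      fix e assume "e \<in> {e \<in> E. e \<subseteq> T \<union> S}"
      then have e: "e \<in> E" "e \<subseteq> T \<union> S" by auto
      then show "e \<in> {e \<in> E. e \<subseteq> T} \<union> {e \<in> E. e \<subseteq> S}" using split[of e] TS by auto
    qed auto
    moreover have "{e \<in> E. e \<subseteq> T} \<inter> {e \<in> E. e \<subseteq> S} = {}"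
    proof -
      have "e \<noteq> {}" if "e \<in> E" for e using E[OF that] s_ge by auto
      then show ?thesis using disj by blast
    qed
    ultimately have "ne E (T \<union> S) = ne E T + ne E S"
      unfolding ne_def using finT finS by (simp add: card_Un_disjoint finite_edges_within)
    then have "cyc E (T \<union> S) = cyc E T + cyc E S"
      using card_Un_disjoint[OF finT finS disj] by (simp add: cyc_def algebra_simps)
    then have cS: "cyc E S \<le> 0" using sparse[of "T \<union> S"] TS CT by auto
    have "wt F S = wt E S" by (rule wt_cong) (use S in \<open>auto simp: F_def\<close>)
    moreover have "0 < wt E S"
    proof (cases "ne E S = 0")
      case True
      then show ?thesis using S finS by (simp add: wt_alt card_gt_0_iff)
    next
      case False
      then have "0 < \<epsilon> * real (ne E S)" using eps_pos by simp
      then show ?thesis using cS unfolding wt_def by linarith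
    qed
    ultimately show "0 < wt F S" by simp
  qed (use finU E in \<open>auto simp: F_def\<close>)
  moreover have "card U \<le> N2" using card_mono[OF D(1), of U] D(3) by (auto simp: U_def)
  ultimately obtain \<psi> where \<psi>: "inj_on \<psi> U" "\<psi> ` U \<subseteq> V' - \<phi> ` T" "\<forall>e\<in>F. \<psi> ` e \<in> E'"
    using copy_avoiding[OF rich, of U F "\<phi> ` T"] finT img by blast
  define \<xi> where "\<xi> x = (if x \<in> T then \<phi> x else \<psi> x)" for x
  have "inj_on \<xi> (T \<union> U)" unfolding \<xi>_def
    using \<phi> \<psi> by (intro inj_on_disjoint_Un) (auto simp: emb_def)
  moreover have "T \<union> U = D" using CT by (auto simp: U_def)
  ultimately have "inj_on \<xi> D" by simp
  moreover have "\<xi> ` D \<subseteq> V'" using \<phi> \<psi> by (auto simp: \<xi>_def emb_def U_def)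
  moreover have "\<forall>x\<in>C. \<xi> x = \<theta> x" using \<phi> CT by (auto simp: \<xi>_def emb_def)
  moreover have "\<xi> ` e \<in> E'" if e: "e \<in> E" "e \<subseteq> D" for e
    using split[OF e]
  proof
    assume "e \<subseteq> T"
    then have "\<xi> ` e = \<phi> ` e" by (force simp: \<xi>_def)
    then show ?thesis using \<phi> e \<open>e \<subseteq> T\<close> by (simp add: emb_def)
  next
    assume "e \<inter> T = {}"
    then have "\<xi> ` e = \<psi> ` e" by (force simp: \<xi>_def)
    moreover have "e \<in> F" using e \<open>e \<inter> T = {}\<close> by (auto simp: F_def U_def)
    ultimately show ?thesis using \<psi> by simp
  qed
  ultimately show ?thesis by blast
qed


section \<open>Answering the moves\<close>

lemma cyc_insert:
  assumes "finite C" "x \<notin> C"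
  shows "cyc E (insert x C) - cyc E C = (int s - 1) * (int (ne E (insert x C)) - int (ne E C)) - 1"
  using assms by (simp add: cyc_def algebra_simps)

text \<open>q new edges at one new vertex give (s - 1) q - 1 new cycles. The added 1 absorbs the
  vertex and leaves q \<le> R (s - 1) q.\<close>

lemma insert_light:
  assumes "finite C" "x \<notin> C" "1 \<le> R"
  shows "int (ne E (insert x C)) - int (ne E C) \<le> int R * (cyc E (insert x C) - cyc E C + 1)"
proof -
  define q where "q = int (ne E (insert x C)) - int (ne E C)"
  have "ne E C \<le> ne E (insert x C)" using assms by (intro ne_mono) auto
  then have "0 \<le> q" by (simp add: q_def)
  then have "1 * q \<le> (int R * (int s - 1)) * q"
    using assms(3) s_ge by (intro mult_right_mono) (auto simp: mult_le_cancel_left1 intro: order_trans[OF _ mult_mono[of 1 "int R" 1 "int s - 1"]])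
  then show ?thesis unfolding cyc_insert[OF assms(1,2)] by (simp add: q_def algebra_simps)
qed

lemma stage_forth:
  assumes rich: "rich V E" "rich V' E'" and c: "conf (stage (Suc r)) V E V' E' C \<theta>" and u: "u \<in> V"
    and r: "Suc r \<le> m"
  shows "\<exists>D \<theta>'. conf (stage r) V E V' E' D \<theta>' \<and> insert u C \<subseteq> D \<and> (\<forall>x\<in>C. \<theta>' x = \<theta> x)"
proof -
  define R :: nat where "R = 2 ^ r"
  have R: "1 \<le> R" "2 ^ Suc r = 2 * R" by (auto simp: R_def)
  have "2 * R \<le> 2 ^ m" unfolding R(2)[symmetric] using r by (intro power_increasing) auto
  then have Rm: "R + 1 \<le> 2 ^ m" using R(1) by linarith
  have V: "finite V" "finite V'" using rich_simps(1) rich by auto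
  have iso: "partial_iso E E' C \<theta>" and CV: "C \<subseteq> V" "\<theta> ` C \<subseteq> V'"
    and st: "strong N1 (2 * R) V E C" and st': "strong N1 (2 * R) V' E' (\<theta> ` C)"
    and sz: "card C + s * (2 * R) \<le> N1"
    using c unfolding conf_def stage_def R(2) by auto
  have inj: "inj_on \<theta> C" using iso by (simp add: partial_iso_def)
  have finC: "finite C" "finite (\<theta> ` C)" using CV V by (auto intro: finite_subset)
  have cardC: "card (\<theta> ` C) = card C" by (rule card_image[OF inj])
  have edgeC: "e \<in> E \<longleftrightarrow> \<theta> ` e \<in> E'" if "e \<subseteq> C" for e using iso that by (simp add: partial_iso_def)
  have neC: "ne E' (\<theta> ` C) = ne E C" by (rule ne_image_eq[OF inj finC(1) edgeC])
  have sR: "1 + s * R \<le> s * (2 * R)" "(s - 1) * R + s * R \<le> s * (2 * R)"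
  proof -
    have "1 * 1 \<le> s * R" using R(1) s_ge by (intro mult_mono) auto
    then show "1 + s * R \<le> s * (2 * R)" by simp
    have "(s - 1) * R \<le> s * R" by (intro mult_right_mono) auto
    then show "(s - 1) * R + s * R \<le> s * (2 * R)" by simp
  qed
  show ?thesis
  proof (cases "u \<in> C")
    case True
    have "strong N1 R V E C" "strong N1 R V' E' (\<theta> ` C)"
      using strong_mono[OF st] strong_mono[OF st'] V R(1) by auto
    moreover have "card C + s * R \<le> N1" using sz sR(1) by linarith
    ultimately have "conf (stage r) V E V' E' C \<theta>"
      using iso CV cardC unfolding conf_def stage_def R_def[symmetric] by simp
    then show ?thesis using True by blast
  next
    case False
    \<comment> \<open>The \<open>+ 1\<close> allows for the vertex \<open>u\<close>, which by itself
      lowers \<open>cyc\<close> by 1. A light set of largest size serves as the closure.\<close>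
    define light where "light Y \<longleftrightarrow> insert u C \<subseteq> Y \<and> Y \<subseteq> V \<and> card Y \<le> N1 \<and>
      int (ne E Y) - int (ne E C) \<le> int R * (cyc E Y - cyc E C + 1)" for Y
    have "card C + 1 \<le> N1" using sz sR(1) by linarith
    then have "card (insert u C) \<le> N1" using finC(1) False by simp
    then have "light (insert u C)"
      unfolding light_def using insert_light[OF finC(1) False R(1), of E] u CV by auto
    moreover have "\<forall>Y. light Y \<longrightarrow> card Y < Suc N1" by (simp add: light_def)
    ultimately have "\<exists>D. light D \<and> (\<forall>Y. light Y \<longrightarrow> card Y \<le> card D)" by (rule ex_has_greatest_nat)
    then obtain D where D: "light D" and D_max: "\<forall>Y. light Y \<longrightarrow> card Y \<le> card D" by (elim exE conjE)
    have DC: "insert u C \<subseteq> D" "C \<subset> D" "D \<subseteq> V" "card D \<le> N1"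
      "int (ne E D) - int (ne E C) \<le> int R * (cyc E D - cyc E C + 1)"
      using D False by (auto simp: light_def)
    have finD: "finite D" using DC V by (auto intro: finite_subset)
    \<comment> \<open>Lightness of \<open>D\<close> over \<open>C\<close> and a failure of strength
      for \<open>Y\<close> over \<open>D\<close> add up to lightness of \<open>Y\<close> over
      \<open>C\<close>, against the choice of \<open>D\<close>.\<close>
    have stD: "strong N1 R V E D"
      unfolding strong_def
    proof (intro allI impI, rule ccontr)
      fix Y assume Y: "D \<subset> Y" "Y \<subseteq> V" "card Y \<le> N1"
        and "\<not> int R * (cyc E Y - cyc E D) < int (ne E Y) - int (ne E D)"
      then have "int (ne E Y) - int (ne E C) \<le> int R * (cyc E Y - cyc E C + 1)"
        using DC(5) by (simp add: algebra_simps)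
      then have "light Y" unfolding light_def using Y DC by auto
      then have "card Y \<le> card D" using D_max by simp
      moreover have "finite Y" using Y V by (auto intro: finite_subset)
      ultimately show False using psubset_card_mono[OF _ Y(1)] by simp
    qed
    consider (isolated) "cyc E D = cyc E C - 1" "ne E D = ne E C" "card D = card C + 1"
      | (attached) "cyc E D = cyc E C" "ne E D \<le> ne E C + R" "card D = card C + (s - 1) * (ne E D - ne E C)"
      using light_cases[OF V(1) st DC(2-4) R(1) DC(5)] by linarith
    then show ?thesis
    proof cases
      case attached
      have neCD: "ne E C \<le> ne E D" using DC finD by (intro ne_mono) auto
      have "(s - 1) * (ne E D - ne E C) \<le> (s - 1) * R" using attached(2) by (intro mult_left_mono) auto
      then have szD: "card D + s * R \<le> N1" using attached(3) sz sR(2) by linarith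
      have "\<exists>\<theta>'. inj_on \<theta>' D \<and> \<theta>' ` D \<subseteq> V' \<and> (\<forall>x\<in>C. \<theta>' x = \<theta> x) \<and> (\<forall>e\<in>E. e \<subseteq> D \<longrightarrow> \<theta>' ` e \<in> E')"
      proof (rule extend_embedding[OF rich(2) finD])
        show "card D \<le> N2" using DC(4) N1_less_N2 by simp
        show "card e = s" if "e \<in> E" for e using rich_simps(4)[OF rich(1) that] .
        show "cyc E Y \<le> cyc E C" if "C \<subseteq> Y" "Y \<subseteq> D" for Y
          using strong_cyc_le[OF st R(1) DC(3) finD DC(4) attached(2) that] .
      qed (use DC inj CV edgeC in auto)
      then obtain \<theta>' where \<theta>': "inj_on \<theta>' D" "\<theta>' ` D \<subseteq> V'" "\<forall>x\<in>C. \<theta>' x = \<theta> x"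
        "\<And>e. e \<subseteq> D \<Longrightarrow> e \<in> E \<Longrightarrow> \<theta>' ` e \<in> E'" by (elim exE conjE) simp
      have imC: "\<theta>' ` C = \<theta> ` C" using \<theta>'(3) by (intro image_cong) auto
      have sub: "\<theta> ` C \<subseteq> \<theta>' ` D" unfolding imC[symmetric] using DC(2) by (intro image_mono) auto
      have cardD: "card (\<theta>' ` D) = card D" by (rule card_image[OF \<theta>'(1)])
      have le: "ne E D \<le> ne E' (\<theta>' ` D)" by (rule ne_image_le[OF \<theta>'(1) finD \<theta>'(4)])
      have q: "card (\<theta>' ` D) \<le> N1" "card (\<theta>' ` D) = card (\<theta> ` C) + (s - 1) * (ne E D - ne E C)"
        "ne E D - ne E C \<le> R" "ne E' (\<theta> ` C) + (ne E D - ne E C) \<le> ne E' (\<theta>' ` D)"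
        using cardD cardC attached DC(4) neC le neCD by auto
      \<comment> \<open>The embedding is only known to preserve edges; counting in the strong set on
        the other side rules out additional ones.\<close>
      note ext = strong_zero_extension[OF V(2) st' sub \<theta>'(2) q R(1)]
      have "ne E' (\<theta>' ` D) \<le> ne E D" using ext(1) neC neCD by simp
      then have "e \<in> E \<longleftrightarrow> \<theta>' ` e \<in> E'" if "e \<subseteq> D" for e
        using edges_image_eq[OF \<theta>'(1) finD \<theta>'(4) _ that] by simp
      then have "partial_iso E E' D \<theta>'" using \<theta>'(1) by (simp add: partial_iso_def)
      then have "conf (stage r) V E V' E' D \<theta>'"
        unfolding conf_def stage_def R_def[symmetric] using DC(3) \<theta>'(2) szD cardD stD ext(2) by simp
      then show ?thesis using DC(1) \<theta>'(3) by blast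
    next
      case isolated
      have "insert u C = D" using isolated(3) finC(1) False by (intro card_seteq[OF finD DC(1)]) simp
      note Deq = this[symmetric]
      have "{e \<in> E. e \<subseteq> C} = {e \<in> E. e \<subseteq> D}"
        using isolated(2) DC by (intro card_seteq finite_edges_within[OF finD]) (auto simp: ne_def)
      then have edges_D: "e \<subseteq> C" if "e \<in> E" "e \<subseteq> D" for e using that by auto
      have "card (\<theta> ` C) + s * R \<le> N1" using cardC sz sR(1) by linarith
      from far_vertex[OF rich(2) st' CV(2) this R(1) Rm] obtain y where y: "y \<in> V' - \<theta> ` C"
        and far: "\<forall>Y. \<theta> ` C \<subseteq> Y \<longrightarrow> y \<in> Y \<longrightarrow> Y \<subseteq> V' \<longrightarrow> cyc E' Y = cyc E' (\<theta> ` C) \<longrightarrow>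
          ne E' Y \<le> ne E' (\<theta> ` C) + R \<longrightarrow> False" by (elim bexE)
      define C' where "C' = \<theta> ` C"
      define D' where "D' = insert y C'"
      have fin': "finite C'" "finite D'" using finC by (auto simp: C'_def D'_def)
      have yC: "y \<notin> C'" using y by (simp add: C'_def)
      have D'V: "D' \<subseteq> V'" "C' \<subset> D'" using y CV by (auto simp: D'_def C'_def)
      have cardD': "card D' = card C + 1" using fin' yC cardC by (simp add: D'_def C'_def)
      have szD: "card C + 1 + s * R \<le> N1" using sz sR(1) by linarith
      then have cardD'_le: "card D' \<le> N1" using cardD' by simp
      have strongC': "strong N1 (2 * R) V' E' C'" using st' by (simp add: C'_def)
      have neD': "ne E' D' = ne E' C'"
      proof -
        have "int (ne E' D') - int (ne E' C') \<le> int R * (cyc E' D' - cyc E' C' + 1)"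
          unfolding D'_def by (rule insert_light[OF fin'(1) yC R(1)])
        from light_cases[OF V(2) strongC' D'V(2,1) cardD'_le R(1) this]
        show ?thesis using far[rule_format, of D'] D'V by (auto simp: C'_def D'_def)
      qed
      have cycD': "cyc E' D' = cyc E' C' - 1"
        using cyc_insert[OF fin'(1) yC, of E'] neD' by (simp add: D'_def)
      \<comment> \<open>A \<open>Y\<close> violating strength is light over \<open>C'\<close> and
        too large for the first case of \<open>light_cases\<close>; so it joins \<open>y\<close> to
        \<open>C'\<close> without a new cycle, which the choice of \<open>y\<close>
        excludes.\<close>
      have stD': "strong N1 R V' E' D'"
        unfolding strong_def
      proof (intro allI impI, rule ccontr)
        fix Y assume Y: "D' \<subset> Y" "Y \<subseteq> V'" "card Y \<le> N1"
          and "\<not> int R * (cyc E' Y - cyc E' D') < int (ne E' Y) - int (ne E' D')"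
        then have le: "int (ne E' Y) - int (ne E' C') \<le> int R * (cyc E' Y - cyc E' C' + 1)"
          using neD' cycD' by (simp add: algebra_simps)
        have "finite Y" using Y V by (auto intro: finite_subset)
        then have "card D' < card Y" by (rule psubset_card_mono[OF _ Y(1)])
        moreover have "card C' = card C" by (simp add: C'_def cardC)
        moreover have "C' \<subset> Y" using Y(1) D'V by auto
        ultimately have "cyc E' Y = cyc E' C'" "ne E' Y \<le> ne E' C' + R"
          using light_cases[OF V(2) strongC' _ Y(2,3) R(1) le] cardD' by auto
        moreover have "C' \<subseteq> Y" "y \<in> Y" using Y by (auto simp: D'_def)
        ultimately show False using far[rule_format, of Y] Y by (simp add: C'_def)
      qed
      define \<theta>' where "\<theta>' = \<theta>(u := y)"
      have same: "\<theta>' x = \<theta> x" if "x \<in> C" for x using that False by (auto simp: \<theta>'_def)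
      have imC: "\<theta>' ` e = \<theta> ` e" if "e \<subseteq> C" for e using that same by (intro image_cong) auto
      have imD: "\<theta>' ` D = D'" using imC[of C] by (auto simp: Deq D'_def C'_def \<theta>'_def)
      have injD: "inj_on \<theta>' D"
        unfolding Deq
      proof (subst inj_on_insert, intro conjI)
        show "inj_on \<theta>' C" using inj same by (simp add: inj_on_def)
        have "C - {u} = C" using False by auto
        then show "\<theta>' u \<notin> \<theta>' ` (C - {u})" using imC[of C] y by (simp add: \<theta>'_def)
      qed
      have pres: "\<theta>' ` e \<in> E'" if "e \<subseteq> D" "e \<in> E" for e
        using edges_D[OF that(2,1)] imC edgeC that by simp
      have "ne E' (\<theta>' ` D) \<le> ne E D" using imD neD' neC isolated(2) by (simp add: C'_def)
      then have "e \<in> E \<longleftrightarrow> \<theta>' ` e \<in> E'" if "e \<subseteq> D" for e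
        using edges_image_eq[OF injD finD pres _ that] by simp
      then have "partial_iso E E' D \<theta>'" using injD by (simp add: partial_iso_def)
      then have "conf (stage r) V E V' E' D \<theta>'"
        unfolding conf_def stage_def R_def[symmetric] imD
        using DC(3) D'V szD cardD' isolated(3) stD stD' by simp
      then show ?thesis using DC(1) same by blast
    qed
  qed
qed

text \<open>Nonnegative weight gives c \<le> \<epsilon> e, and with e \<le> 2^m (c + 1) this becomes
  c (1 - \<epsilon> 2^m) \<le> \<epsilon> 2^m < 1. So c \<le> 1 / \<open>gap\<close>, which bounds e
  and then the number (s - 1) e - c of vertices: the origin of \<open>core_size\<close>.\<close>

lemma core_size_bound:
  assumes "0 \<le> wt E Y" "int (ne E Y) \<le> 2 ^ m * (cyc E Y + 1)"
  shows "card Y \<le> core_size"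
proof -
  define e c where "e = real (ne E Y)" and "c = real_of_int (cyc E Y)"
  have "real_of_int (int (ne E Y)) \<le> real_of_int (2 ^ m * (cyc E Y + 1))" using assms(2) by (simp only: of_int_le_iff)
  then have e: "e \<le> 2 ^ m * (c + 1)" by (simp add: e_def c_def)
  have "0 \<le> (2::int) ^ m * (cyc E Y + 1)" using assms(2) by linarith
  then have "0 \<le> cyc E Y + 1" by (simp add: zero_le_mult_iff)
  then have c: "-1 \<le> c" by (simp add: c_def)
  have "c \<le> \<epsilon> * e" using assms(1) by (simp add: wt_def e_def c_def)
  also have "\<dots> \<le> \<epsilon> * (2 ^ m * (c + 1))" using e eps_pos by (intro mult_left_mono) auto
  finally have "c * gap \<le> \<epsilon> * 2 ^ m" by (simp add: gap_def algebra_simps)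
  then have "c * gap \<le> 1" using eps_less by linarith
  then have "c \<le> 1 / gap" using gap_pos by (simp add: field_simps)
  then have "2 ^ m * (c + 1) \<le> 2 ^ m * (1 / gap + 1)" by (intro mult_left_mono) auto
  then have e2: "e \<le> 2 ^ m * (1 / gap + 1)" using e by linarith
  have "real (card Y) = (real s - 1) * e - c"
    by (simp add: e_def c_def cyc_def)
  also have "\<dots> \<le> real s * e + 1" using c by (simp add: e_def algebra_simps)
  also have "\<dots> \<le> real s * (2 ^ m * (1 / gap + 1)) + 1" using e2 by (intro add_right_mono mult_left_mono) auto
  finally show ?thesis unfolding core_size_def by (simp add: mult.assoc) linarith
qed

text \<open>A subset of zero weight would have so many edges, since the exponent is not exceptional,
  that the whole set would have negative weight.\<close>

lemma core_balanced:
  assumes rich: "rich V E" and D: "D \<subseteq> V" "card D \<le> N2" "int (ne E D) \<le> 2 ^ m * (cyc E D + 1)"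
  shows "balanced D {e \<in> E. e \<subseteq> D}" (is "balanced D ?F")
  unfolding balanced_def
proof (intro conjI ballI allI impI)
  show finD: "finite D" using rich_simps(1)[OF rich] D(1) by (rule rev_finite_subset)
  fix S assume S: "S \<subseteq> D" "S \<noteq> {}"
  have finS: "finite S" using S finD by (auto intro: finite_subset)
  have "wt ?F S = wt E S" by (rule wt_cong) (use S in auto)
  moreover have "0 \<le> wt E S"
    using S D card_mono[OF finD S(1)] by (intro rich_simps(5)[OF rich]) auto
  moreover have "wt E S \<noteq> 0"
  proof
    assume zero: "wt E S = 0"
    \<comment> \<open>Otherwise \<epsilon> e = \<open>cyc E S\<close> \<le> 0 leaves no edge, and a
      nonempty set without edges has positive weight. This provides the c \<ge> 1 required by
      \<open>non_exceptional\<close>.\<close>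
    have "0 < cyc E S"
    proof (rule ccontr)
      assume "\<not> 0 < cyc E S"
      moreover have "real_of_int (cyc E S) = \<epsilon> * real (ne E S)" using zero by (simp add: wt_def)
      ultimately have "\<epsilon> * real (ne E S) \<le> 0" by linarith
      then have "ne E S = 0" using eps_pos by (simp add: mult_le_0_iff)
      then have "wt E S = real (card S)" by (simp add: wt_alt)
      then show False using zero S finS by simp
    qed
    define c where "c = nat (cyc E S)"
    have c: "int c = cyc E S" "1 \<le> c" using \<open>0 < cyc E S\<close> by (auto simp: c_def)
    have "\<epsilon> * real (ne E S) = real_of_int (int c)" using zero unfolding c(1) by (simp add: wt_def)
    then have "2 ^ m * Suc c < ne E S" using non_exceptional[OF c(2), of "ne E S"] by simp
    then have "int (2 ^ m * Suc c) < int (ne E S)" by (simp only: of_nat_less_iff)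
    then have big: "2 ^ m * (cyc E S + 1) < int (ne E S)" using c(1) by (simp add: algebra_simps)
    define d where "d = cyc E D - cyc E S"
    \<comment> \<open>Over \<open>S\<close> the d new cycles come with fewer than 2^m d edges, so
      the weight drops from zero by more than d (1 - \<epsilon> 2^m).\<close>
    have less: "int (ne E D) - int (ne E S) < 2 ^ m * d" using big D(3) by (simp add: d_def algebra_simps)
    have "ne E S \<le> ne E D" using ne_mono[OF finD S(1)] .
    then have "0 < (2::int) ^ m * d" using less by linarith
    then have "0 < d" by (simp add: zero_less_mult_iff)
    have "real_of_int (int (ne E D) - int (ne E S)) < real_of_int (2 ^ m * d)" using less by (simp only: of_int_less_iff)
    then have "\<epsilon> * (real (ne E D) - real (ne E S)) < \<epsilon> * (2 ^ m * real_of_int d)"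
      using eps_pos by (intro mult_strict_left_mono) auto
    moreover have "wt E D - wt E S = \<epsilon> * (real (ne E D) - real (ne E S)) - real_of_int d"
      by (simp add: wt_def d_def algebra_simps)
    moreover have "\<epsilon> * 2 ^ m * real_of_int d < 1 * real_of_int d"
      using eps_less \<open>0 < d\<close> by (intro mult_strict_right_mono) auto
    ultimately have "wt E D < 0" using zero by (simp add: mult.assoc)
    then show False using rich_simps(5)[OF rich D(1,2)] by simp
  qed
  ultimately show "0 < wt ?F S" by simp
qed (use rich_simps(4)[OF rich] in auto)

lemma first_forth:
  assumes rich: "rich V E" "rich V' E'" and u: "u \<in> V"
  shows "\<exists>D \<theta>. conf (stage m) V E V' E' D \<theta> \<and> u \<in> D"
proof -
  define dense where "dense Y \<longleftrightarrow> u \<in> Y \<and> Y \<subseteq> V \<and> card Y \<le> N1 \<and>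
    int (ne E Y) \<le> 2 ^ m * (cyc E Y + 1)" for Y
  have V: "finite V" by (rule rich_simps(1)[OF rich(1)])
  have bound: "card Y \<le> core_size" if "dense Y" for Y
  proof -
    have Y: "Y \<subseteq> V" "card Y \<le> N2" "int (ne E Y) \<le> 2 ^ m * (cyc E Y + 1)"
      using that N1_less_N2 by (auto simp: dense_def)
    show ?thesis by (rule core_size_bound[OF rich_simps(5)[OF rich(1) Y(1,2)] Y(3)])
  qed
  have "e \<notin> E" if "e \<subseteq> {u}" for e
    using rich_simps(4)[OF rich(1), of e] s_ge card_mono[OF _ that] by auto
  then have "{e \<in> E. e \<subseteq> {u}} = {}" by auto
  then have "ne E {u} = 0" unfolding ne_def by simp
  then have "dense {u}" using u by (simp add: dense_def cyc_def N1_def core_size_def)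
  moreover have "\<forall>Y. dense Y \<longrightarrow> card Y < Suc N1" by (simp add: dense_def)
  ultimately have "\<exists>D. dense D \<and> (\<forall>Y. dense Y \<longrightarrow> card Y \<le> card D)" by (rule ex_has_greatest_nat)
  then obtain D where dD: "dense D" and D_max: "\<forall>Y. dense Y \<longrightarrow> card Y \<le> card D" by (elim exE conjE)
  then have D: "u \<in> D" "D \<subseteq> V" "card D \<le> N1" "int (ne E D) \<le> 2 ^ m * (cyc E D + 1)"
    by (auto simp: dense_def)
  have stD: "strong N1 (2 ^ m) V E D"
    unfolding strong_def
  proof (intro allI impI, rule ccontr)
    fix Y assume Y: "D \<subset> Y" "Y \<subseteq> V" "card Y \<le> N1"
      and "\<not> int (2 ^ m) * (cyc E Y - cyc E D) < int (ne E Y) - int (ne E D)"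
    then have "int (ne E Y) \<le> 2 ^ m * (cyc E Y + 1)" using D(4) by (simp add: algebra_simps)
    then have "dense Y" unfolding dense_def using Y D by auto
    then have "card Y \<le> card D" using D_max by simp
    moreover have "finite Y" using Y V by (auto intro: finite_subset)
    ultimately show False using psubset_card_mono[OF _ Y(1)] by simp
  qed
  have "card D \<le> N2" using D(3) N1_less_N2 by simp
  from copy_strong[OF rich(2) core_balanced[OF rich(1) D(2) this D(4)] D(3)] obtain \<psi> where
    \<psi>: "inj_on \<psi> D" "\<psi> ` D \<subseteq> V'" "\<forall>e\<subseteq>D. e \<in> {e \<in> E. e \<subseteq> D} \<longleftrightarrow> \<psi> ` e \<in> E'"
      "strong N1 (2 ^ m) V' E' (\<psi> ` D)" by (elim exE conjE)
  have "partial_iso E E' D \<psi>" using \<psi>(1,3) by (simp add: partial_iso_def)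
  moreover have "card D + s * 2 ^ m \<le> N1" using bound[OF dD] by (simp add: N1_def)
  ultimately have "conf (stage m) V E V' E' D \<psi>"
    unfolding conf_def stage_def using D \<psi> stD card_image[OF \<psi>(1)] by simp
  then show ?thesis using D by blast
qed

text \<open>An edge outside \<open>C\<close> with two vertices in \<open>C\<close> would bring q
  \<ge> 1 new edges and at most s - 2 new vertices, hence at least (s - 1) q - (s - 2) \<ge> q new
  cycles, against strength for \<rho> = 1.\<close>

lemma stage_0_thinly_attached:
  assumes rich: "rich V E" and C: "C \<subseteq> V" and st: "stage 0 V E C"
  shows "thinly_attached s (s - 2) V E C"
  unfolding thinly_attached_def
proof (intro conjI ballI impI)
  have sz: "card C + s \<le> N1" and str: "strong N1 1 V E C" using st by (auto simp: stage_def)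
  have V: "finite V" "N2 \<le> card V" by (rule rich_simps[OF rich])+
  show "finite V" by fact
  show "card C + (s - 2) \<le> card V" using sz V N1_less_N2 by linarith
  fix e assume e: "e \<in> E"
  show ce: "card e = s" by (rule rich_simps(4)[OF rich e])
  assume nsub: "\<not> e \<subseteq> C"
  show "card (e \<inter> C) + (s - 2) < s"
  proof (rule ccontr)
    assume "\<not> card (e \<inter> C) + (s - 2) < s"
    then have two: "2 \<le> card (e \<inter> C)" using s_ge by linarith
    have eV: "e \<subseteq> V" by (rule rich_simps(3)[OF rich e])
    have fin: "finite e" "finite C" using eV C V by (auto intro: finite_subset)
    have card_eq: "card (C \<union> e) + card (e \<inter> C) = card C + s"
      using card_Un_Int[OF fin(2,1)] ce by (simp add: Int_commute)
    have "{x \<in> E. x \<subseteq> C} \<subset> {x \<in> E. x \<subseteq> C \<union> e}" using e nsub by auto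
    then have "ne E C < ne E (C \<union> e)"
      unfolding ne_def using fin by (intro psubset_card_mono finite_edges_within) auto
    define q where "q = int (ne E (C \<union> e)) - int (ne E C)"
    have q: "1 \<le> q" using \<open>ne E C < ne E (C \<union> e)\<close> by (simp add: q_def)
    have "C \<subset> C \<union> e" "C \<union> e \<subseteq> V" "card (C \<union> e) \<le> N1" using nsub C eV card_eq sz by auto
    then have "int 1 * (cyc E (C \<union> e) - cyc E C) < int (ne E (C \<union> e)) - int (ne E C)"
      by (rule strongD[OF str])
    then have "(int s - 1) * q - (int (card (C \<union> e)) - int (card C)) < q"
      by (simp add: cyc_def q_def algebra_simps)
    moreover have "int (card (C \<union> e)) - int (card C) \<le> int s - 2" using card_eq two by linarith
    ultimately have "(int s - 2) * q < (int s - 2)" by (simp add: algebra_simps)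
    moreover have "(int s - 2) * 1 \<le> (int s - 2) * q" using q s_ge by (intro mult_left_mono) auto
    ultimately show False by simp
  qed
qed

lemma stage_agree:
  assumes "r \<le> m" "rich V E" "rich V' E'" "conf (stage r) V E V' E' C \<theta>"
  shows "agree V E V' E' (r + (s - 2)) C \<theta>"
  using assms
proof (induction r arbitrary: V E V' E' C \<theta>)
  case 0
  then have c: "C \<subseteq> V" "\<theta> ` C \<subseteq> V'" "stage 0 V E C" "stage 0 V' E' (\<theta> ` C)" "partial_iso E E' C \<theta>"
    by (auto simp: conf_def)
  have "conf (thinly_attached s (s - 2)) V E V' E' C \<theta>"
    unfolding conf_def
    using c stage_0_thinly_attached[OF 0(2) c(1,3)] stage_0_thinly_attached[OF 0(3) c(2,4)] by simp
  then show ?case using thinly_attached_agree by simp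
next
  case (Suc r)
  have "agree V E V' E' (Suc (r + (s - 2))) C \<theta>"
  proof (rule agree_step[where gen = rich and X = "stage (Suc r)" and Y = "stage r"])
    fix V E V' E' C \<theta> and u :: 'a
    assume "rich V E" "rich V' E'" "conf (stage (Suc r)) V E V' E' C \<theta>" "u \<in> V"
    then show "\<exists>D \<theta>'. conf (stage r) V E V' E' D \<theta>' \<and> insert u C \<subseteq> D \<and> (\<forall>x\<in>C. \<theta>' x = \<theta> x)"
      using Suc.prems(1) by (rule stage_forth)
  next
    fix V V' :: "'a set" and E E' C \<theta>
    assume "rich V E" "rich V' E'" "conf (stage r) V E V' E' C \<theta>"
    then show "agree V E V' E' (r + (s - 2)) C \<theta>" using Suc.prems(1) by (intro Suc.IH) auto
  qed (fact Suc.prems)+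
  then show ?case by simp
qed

lemma rich_agree:
  fixes V V' :: "'a set"
  assumes "rich V E" "rich V' E'"
  shows "agree V E V' E' (m + s - 1) {} \<theta>"
proof -
  have "{} \<notin> E" "{} \<notin> E'" using rich_simps(4)[OF assms(1)] rich_simps(4)[OF assms(2)] s_ge by fastforce+
  \<comment> \<open>Even at the empty position \<open>partial_iso\<close> tests the empty set as an
    edge, hence the clause \<open>{} \<notin> E\<close>.\<close>
  then have "conf (\<lambda>V E C. C = {} \<and> {} \<notin> E) V E V' E' {} \<theta>"
    by (simp add: conf_def partial_iso_def)
  then have "agree V E V' E' (Suc (m + (s - 2))) {} \<theta>"
  proof (rule agree_step[where gen = rich and Y = "stage m", rotated 4])
    fix V E V' E' C \<theta> and u :: 'a
    assume a: "rich V E" "rich V' E'" "conf (\<lambda>V E C. C = {} \<and> {} \<notin> E) V E V' E' C \<theta>" "u \<in> V"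
    then have "C = {}" by (simp add: conf_def)
    then show "\<exists>D \<theta>'. conf (stage m) V E V' E' D \<theta>' \<and> insert u C \<subseteq> D \<and> (\<forall>x\<in>C. \<theta>' x = \<theta> x)"
      using first_forth[OF a(1,2,4)] by simp
  next
    fix V V' :: "'a set" and E E' C \<theta>
    assume "rich V E" "rich V' E'" "conf (stage m) V E V' E' C \<theta>"
    then show "agree V E V' E' (m + (s - 2)) C \<theta>" by (rule stage_agree[OF order_refl])
  qed (fact assms)+
  moreover have "Suc (m + (s - 2)) = m + s - 1" using s_ge by simp
  ultimately show ?thesis by metis
qed

end

section \<open>Counting copies in a random hypergraph\<close>

lemma finite_all_edges: "finite {e. e \<subseteq> {1..n::nat} \<and> card e = s}"
  by (rule finite_subset[of _ "Pow {1..n}"]) auto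

lemma set_random_hypergraph:
  "E \<in> set_pmf (random_hypergraph s n p) \<Longrightarrow> e \<in> E \<Longrightarrow> e \<subseteq> {1..n} \<and> card e = s"
  using set_Pi_pmf_subset[OF finite_all_edges[of n s], of False "\<lambda>_. bernoulli_pmf p"]
  unfolding random_hypergraph_def by auto

lemma finite_set_random_hypergraph: "finite (set_pmf (random_hypergraph s n p))"
  by (rule finite_subset[of _ "Pow (Pow {1..n})"]) (use set_random_hypergraph in blast, simp)

lemma prob_edges_const:
  assumes F: "F \<subseteq> {e. e \<subseteq> {1..n} \<and> card e = s}"
  shows "measure_pmf.prob (random_hypergraph s n p) {E. \<forall>e\<in>F. (e \<in> E) = b} =
    pmf (bernoulli_pmf p) b ^ card F"
proof -
  let ?K = "{e. e \<subseteq> {1..n} \<and> card e = s}"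
  let ?B = "\<lambda>e. if e \<in> F then {b} else UNIV"
  have "measure_pmf.prob (random_hypergraph s n p) {E. \<forall>e\<in>F. (e \<in> E) = b} =
      measure_pmf.prob (Pi_pmf ?K False (\<lambda>_. bernoulli_pmf p)) (Pi ?K ?B)"
  proof -
    have "{c. \<forall>e\<in>F. c e = b} = Pi ?K ?B" using F by (fastforce simp: Pi_def split: if_splits)
    then have "(\<lambda>c. {e. c e}) -` {E. \<forall>e\<in>F. (e \<in> E) = b} = Pi ?K ?B" by simp
    then show ?thesis unfolding random_hypergraph_def measure_map_pmf by (rule arg_cong)
  qed
  also have "\<dots> = (\<Prod>e\<in>?K. measure_pmf.prob (bernoulli_pmf p) (?B e))"
    by (rule measure_Pi_pmf_Pi[OF finite_all_edges])
  also have "\<dots> = (\<Prod>e\<in>?K. if e \<in> F then pmf (bernoulli_pmf p) b else 1)"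
    by (intro prod.cong) (auto simp: measure_pmf_single)
  also have "\<dots> = (\<Prod>e\<in>F. pmf (bernoulli_pmf p) b)"
  proof -
    have "?K \<inter> F = F" using F by auto
    then show ?thesis using prod.inter_restrict[OF finite_all_edges[of n s], of "\<lambda>_. pmf (bernoulli_pmf p) b" F]
      by simp
  qed
  finally show ?thesis by simp
qed

lemma prob_edges_present:
  assumes "F \<subseteq> {e. e \<subseteq> {1..n} \<and> card e = s}" "0 \<le> p" "p \<le> 1"
  shows "measure_pmf.prob (random_hypergraph s n p) {E. F \<subseteq> E} = p ^ card F"
proof -
  have "{E. F \<subseteq> E} = {E. \<forall>e\<in>F. (e \<in> E) = True}" by auto
  then show ?thesis using prob_edges_const[OF assms(1), of p True] assms by simp
qed

lemma prob_edges_absent: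
  assumes "F \<subseteq> {e. e \<subseteq> {1..n} \<and> card e = s}" "0 \<le> p" "p \<le> 1"
  shows "measure_pmf.prob (random_hypergraph s n p) {E. F \<inter> E = {}} = (1 - p) ^ card F"
proof -
  have "{E. F \<inter> E = {}} = {E. \<forall>e\<in>F. (e \<in> E) = False}" by auto
  then show ?thesis using prob_edges_const[OF assms(1), of p False] assms by simp
qed

text \<open>Extensional functions make labelled copies elements of a finite set. The copies counted
  below need not be induced.\<close>

definition injections :: "nat \<Rightarrow> 'a set \<Rightarrow> ('a \<Rightarrow> nat) set" where
  "injections n W = {\<phi> \<in> W \<rightarrow>\<^sub>E {1..n}. inj_on \<phi> W}"

definition copies :: "nat \<Rightarrow> 'a set \<Rightarrow> 'a set set \<Rightarrow> nat set set \<Rightarrow> ('a \<Rightarrow> nat) set" where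
  "copies n W F E = {\<phi> \<in> injections n W. (`) \<phi> ` F \<subseteq> E}"

lemma finite_injections: "finite W \<Longrightarrow> finite (injections n W)"
  unfolding injections_def by (rule finite_subset[of _ "W \<rightarrow>\<^sub>E {1..n}"]) (auto intro: finite_PiE)

lemma finite_copies: "finite W \<Longrightarrow> finite (copies n W F E)"
  by (rule finite_subset[OF _ finite_injections[of W n]]) (auto simp: copies_def)

lemma card_injections_le: "finite W \<Longrightarrow> card (injections n W) \<le> n ^ card W"
  using card_mono[of "W \<rightarrow>\<^sub>E {1..n}" "injections n W"]
  by (auto simp: injections_def card_funcsetE finite_PiE)

lemma card_injections_ge:
  assumes "finite W"
  shows "(n - card W) ^ card W \<le> card (injections n W)"
proof -
  have "(n - card W) ^ card W = (\<Prod>i\<in>{0..<card W}. n - card W)" by simp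
  also have "\<dots> \<le> (\<Prod>i\<in>{0..<card W}. n - i)" by (rule prod_mono) auto
  also have "\<dots> = card (injections n W)"
    unfolding injections_def using card_inj_on_subset_funcset[OF assms, of "{1..n}" W] by simp
  finally show ?thesis .
qed

lemma expectation_card_copies:
  assumes "finite W" and F: "\<And>e. e \<in> F \<Longrightarrow> e \<subseteq> W \<and> card e = s" and p: "0 \<le> p" "p \<le> 1"
  shows "measure_pmf.expectation (random_hypergraph s n p) (\<lambda>E. real (card (copies n W F E))) =
    real (card (injections n W)) * p ^ card F"
    and "measure_pmf.expectation (random_hypergraph s n p) (\<lambda>E. (real (card (copies n W F E)))\<^sup>2) =
    (\<Sum>\<phi>\<in>injections n W. \<Sum>\<psi>\<in>injections n W. p ^ card ((`) \<phi> ` F \<union> (`) \<psi> ` F))"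
proof -
  let ?M = "random_hypergraph s n p"
  have fin: "finite (injections n W)" by (rule finite_injections[OF assms(1)])
  have cnt: "real (card (copies n W F E)) = (\<Sum>\<phi>\<in>injections n W. indicator {E. (`) \<phi> ` F \<subseteq> E} E)" for E
  proof -
    have "(\<Sum>\<phi>\<in>injections n W. indicator {E. (`) \<phi> ` F \<subseteq> E} E :: real) =
        (\<Sum>\<phi>\<in>injections n W. if (`) \<phi> ` F \<subseteq> E then 1 else 0)"
      by (intro sum.cong) (auto simp: indicator_def)
    also have "\<dots> = (\<Sum>\<phi>\<in>copies n W F E. 1)"
      unfolding copies_def by (rule sum.inter_filter[OF fin, symmetric])
    finally show ?thesis by simp
  qed
  have img: "(`) \<phi> ` F \<subseteq> {e. e \<subseteq> {1..n} \<and> card e = s}" if \<phi>: "\<phi> \<in> injections n W" for \<phi>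
  proof (intro subsetI, elim imageE)
    fix x e assume e: "e \<in> F" "x = \<phi> ` e"
    have "inj_on \<phi> e" using F[OF e(1)] \<phi> unfolding injections_def by (auto intro: inj_on_subset)
    then have "card x = s" using F[OF e(1)] e by (simp add: card_image)
    moreover have "x \<subseteq> {1..n}" using F[OF e(1)] \<phi> e unfolding injections_def by auto
    ultimately show "x \<in> {e. e \<subseteq> {1..n} \<and> card e = s}" by simp
  qed
  have card_img: "card ((`) \<phi> ` F) = card F" if \<phi>: "\<phi> \<in> injections n W" for \<phi>
  proof (rule card_image, rule inj_on_subset[OF inj_on_image_Pow])
    show "inj_on \<phi> W" using \<phi> by (simp add: injections_def)
    show "F \<subseteq> Pow W" using F by auto
  qed
  have int: "integrable ?M f" for f :: "nat set set \<Rightarrow> real"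
    by (rule integrable_measure_pmf_finite[OF finite_set_random_hypergraph])
  have "measure_pmf.expectation ?M (\<lambda>E. real (card (copies n W F E))) =
      (\<Sum>\<phi>\<in>injections n W. measure_pmf.prob ?M {E. (`) \<phi> ` F \<subseteq> E})"
    unfolding cnt by (subst Bochner_Integration.integral_sum) (auto intro: int)
  also have "\<dots> = (\<Sum>\<phi>\<in>injections n W. p ^ card F)"
    using prob_edges_present[OF img p] card_img by (intro sum.cong) auto
  finally show "measure_pmf.expectation ?M (\<lambda>E. real (card (copies n W F E))) =
    real (card (injections n W)) * p ^ card F" by simp
  have sq: "(real (card (copies n W F E)))\<^sup>2 =
      (\<Sum>\<phi>\<in>injections n W. \<Sum>\<psi>\<in>injections n W. indicator {E. (`) \<phi> ` F \<union> (`) \<psi> ` F \<subseteq> E} E)" for E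
    unfolding cnt power2_eq_square sum_product
    by (intro sum.cong refl) (auto simp: indicator_def)
  have "measure_pmf.expectation ?M (\<lambda>E. (real (card (copies n W F E)))\<^sup>2) =
      (\<Sum>\<phi>\<in>injections n W. \<Sum>\<psi>\<in>injections n W. measure_pmf.prob ?M {E. (`) \<phi> ` F \<union> (`) \<psi> ` F \<subseteq> E})"
    unfolding sq by (subst Bochner_Integration.integral_sum, rule int)+ auto
  also have "\<dots> = (\<Sum>\<phi>\<in>injections n W. \<Sum>\<psi>\<in>injections n W. p ^ card ((`) \<phi> ` F \<union> (`) \<psi> ` F))"
    using img by (intro sum.cong refl prob_edges_present p) blast
  finally show "measure_pmf.expectation ?M (\<lambda>E. (real (card (copies n W F E)))\<^sup>2) =
    (\<Sum>\<phi>\<in>injections n W. \<Sum>\<psi>\<in>injections n W. p ^ card ((`) \<phi> ` F \<union> (`) \<psi> ` F))" .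
qed

lemma copies_markov:
  assumes "finite W" and F: "\<And>e. e \<in> F \<Longrightarrow> e \<subseteq> W \<and> card e = s" and p: "0 \<le> p" "p \<le> 1" and t: "0 < t"
  shows "measure_pmf.prob (random_hypergraph s n p) {E. t \<le> real (card (copies n W F E))} \<le>
    real n ^ card W * p ^ card F / t"
proof -
  let ?M = "random_hypergraph s n p"
  have "integrable ?M (\<lambda>E. real (card (copies n W F E)))"
    by (rule integrable_measure_pmf_finite[OF finite_set_random_hypergraph])
  then have "measure_pmf.prob ?M {E \<in> space (measure_pmf ?M). t \<le> real (card (copies n W F E))} \<le>
      measure_pmf.expectation ?M (\<lambda>E. real (card (copies n W F E))) / t"
    using t by (intro integral_Markov_inequality_measure[where A = UNIV]) auto
  also have "\<dots> = real (card (injections n W)) * p ^ card F / t"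
    using expectation_card_copies(1)[OF assms(1) F p] by simp
  also have "\<dots> \<le> real n ^ card W * p ^ card F / t"
  proof -
    have "real (card (injections n W)) \<le> real (n ^ card W)" using card_injections_le[OF assms(1), of n] by (simp only: of_nat_le_iff)
    then show ?thesis using t p by (intro divide_right_mono mult_right_mono) auto
  qed
  finally show ?thesis by simp
qed

text \<open>For fixed \<phi>, sort the \<psi> by the set T of points that they map into the image of
  \<phi>. Common edges come from edges inside T, so the exponent of p is at least 2 |F| -
  \<open>ne F T\<close>, and at most w^|T| n^(w - |T|) maps \<psi> belong to T, where w = |W|. T =
  {} yields at most the squared mean.\<close>

lemma pair_sum_bound:
  assumes W: "finite W" and F: "\<And>e. e \<in> F \<Longrightarrow> e \<subseteq> W \<and> card e = s" and s: "1 \<le> s"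
    and p: "0 < p" "p \<le> 1" and n: "1 \<le> n"
  shows "(\<Sum>\<phi>\<in>injections n W. \<Sum>\<psi>\<in>injections n W. p ^ card ((`) \<phi> ` F \<union> (`) \<psi> ` F)) \<le>
    (real (card (injections n W)) * p ^ card F)\<^sup>2 +
    (real n ^ card W * p ^ card F)\<^sup>2 *
      (\<Sum>T\<in>Pow W - {{}}. real (card W) ^ card T / (real n ^ card T * p ^ ne F T))"
proof -
  let ?I = "injections n W" and ?w = "card W"
  define g where "g T = (p ^ card F)\<^sup>2 / p ^ ne F T" for T
  define S where "S = (\<Sum>T\<in>Pow W - {{}}. real ?w ^ card T / (real n ^ card T * p ^ ne F T))"
  have finF: "finite F" using F W by (intro finite_subset[of F "Pow W"]) auto
  have finI: "finite ?I" by (rule finite_injections[OF W])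
  have ne0: "ne F {} = 0"
  proof -
    have "{} \<notin> F" using F s by fastforce
    then have "{e \<in> F. e \<subseteq> {}} = {}" by auto
    then show ?thesis by (simp add: ne_def)
  qed
  have inner: "(\<Sum>\<psi>\<in>?I. p ^ card ((`) \<phi> ` F \<union> (`) \<psi> ` F)) \<le>
      real (card ?I) * (p ^ card F)\<^sup>2 + real n ^ ?w * (p ^ card F)\<^sup>2 * S" if \<phi>: "\<phi> \<in> ?I" for \<phi>
  proof -
    define \<tau> where "\<tau> \<psi> = {x \<in> W. \<psi> x \<in> \<phi> ` W}" for \<psi> :: "'a \<Rightarrow> nat"
    have inj: "inj_on \<psi> W" if "\<psi> \<in> ?I" for \<psi> using that by (simp add: injections_def)
    have cardF: "card ((`) \<psi> ` F) = card F" if "\<psi> \<in> ?I" for \<psi>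
      by (rule card_image, rule inj_on_subset[OF inj_on_image_Pow[OF inj[OF that]]]) (use F in auto)
    have term_le: "p ^ card ((`) \<phi> ` F \<union> (`) \<psi> ` F) \<le> g (\<tau> \<psi>)" if \<psi>: "\<psi> \<in> ?I" for \<psi>
    proof -
      let ?A = "(`) \<phi> ` F" and ?B = "(`) \<psi> ` F"
      have sum: "card (?A \<union> ?B) + card (?A \<inter> ?B) = card F + card F"
        using card_Un_Int[of ?A ?B] finF cardF[OF \<phi>] cardF[OF \<psi>] by simp
      have "?A \<inter> ?B \<subseteq> (`) \<psi> ` {e \<in> F. e \<subseteq> \<tau> \<psi>}"
      proof
        fix x assume "x \<in> ?A \<inter> ?B"
        then obtain d e where d: "d \<in> F" "x = \<phi> ` d" and e: "e \<in> F" "x = \<psi> ` e" by auto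
        have "e \<subseteq> \<tau> \<psi>"
        proof
          fix y assume y: "y \<in> e"
          then have "\<psi> y \<in> \<phi> ` d" using d e by auto
          then show "y \<in> \<tau> \<psi>" using F[OF d(1)] F[OF e(1)] y by (auto simp: \<tau>_def)
        qed
        then show "x \<in> (`) \<psi> ` {e \<in> F. e \<subseteq> \<tau> \<psi>}" using e by auto
      qed
      then have "card (?A \<inter> ?B) \<le> card ((`) \<psi> ` {e \<in> F. e \<subseteq> \<tau> \<psi>})"
        using finF by (intro card_mono) auto
      also have "\<dots> \<le> ne F (\<tau> \<psi>)" unfolding ne_def using finF by (intro card_image_le) auto
      finally have "p ^ ne F (\<tau> \<psi>) \<le> p ^ card (?A \<inter> ?B)" using p by (intro power_decreasing) auto
      then have "p ^ card (?A \<union> ?B) * p ^ ne F (\<tau> \<psi>) \<le> p ^ card (?A \<union> ?B) * p ^ card (?A \<inter> ?B)"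
        using p by (intro mult_left_mono) auto
      also have "\<dots> = (p ^ card F)\<^sup>2" unfolding power_add[symmetric] sum by (simp add: power_add power2_eq_square)
      finally show ?thesis unfolding g_def using p by (simp add: pos_le_divide_eq)
    qed
    have g0: "0 \<le> g T" for T unfolding g_def using p by simp
    have cnt: "real (card {\<psi> \<in> ?I. \<tau> \<psi> = T}) * g T \<le>
        real n ^ ?w * (p ^ card F)\<^sup>2 * (real ?w ^ card T / (real n ^ card T * p ^ ne F T))"
      if T: "T \<in> Pow W - {{}}" for T
    proof -
      have TW: "T \<subseteq> W" "finite T" using T W by (auto intro: finite_subset)
      let ?B = "\<lambda>x. if x \<in> T then \<phi> ` W else {1..n}"
      have "{\<psi> \<in> ?I. \<tau> \<psi> = T} \<subseteq> Pi\<^sub>E W ?B" by (auto simp: injections_def \<tau>_def PiE_iff extensional_def)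
      then have "card {\<psi> \<in> ?I. \<tau> \<psi> = T} \<le> card (Pi\<^sub>E W ?B)"
        using W by (intro card_mono finite_PiE) auto
      also have "\<dots> = (\<Prod>x\<in>W. card (?B x))" by (rule card_PiE[OF W])
      also have "\<dots> = (\<Prod>x\<in>T. card (?B x)) * (\<Prod>x\<in>W - T. card (?B x))"
        by (subst prod.subset_diff[OF TW(1) W]) (rule mult.commute)
      also have "(\<Prod>x\<in>T. card (?B x)) = ?w ^ card T"
        using card_image[OF inj[OF \<phi>]] by simp
      also have "(\<Prod>x\<in>W - T. card (?B x)) = n ^ card (W - T)" by simp
      also have "card (W - T) = ?w - card T" using TW by (simp add: card_Diff_subset)
      finally have "real (card {\<psi> \<in> ?I. \<tau> \<psi> = T}) \<le> real (?w ^ card T * n ^ (?w - card T))"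
        by (simp only: of_nat_le_iff)
      also have "\<dots> = real ?w ^ card T * real n ^ ?w / real n ^ card T"
        using n card_mono[OF W TW(1)] power_diff[of "real n" "card T" ?w] by (simp del: power_diff)
      finally have "real (card {\<psi> \<in> ?I. \<tau> \<psi> = T}) * g T \<le>
          real ?w ^ card T * real n ^ ?w / real n ^ card T * g T" using g0 by (intro mult_right_mono)
      then show ?thesis by (simp add: g_def mult_ac)
    qed
    have "(\<Sum>\<psi>\<in>?I. p ^ card ((`) \<phi> ` F \<union> (`) \<psi> ` F)) \<le> (\<Sum>\<psi>\<in>?I. g (\<tau> \<psi>))"
      by (intro sum_mono term_le)
    also have "\<dots> = (\<Sum>T\<in>Pow W. \<Sum>\<psi>\<in>{\<psi> \<in> ?I. \<tau> \<psi> = T}. g (\<tau> \<psi>))"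
      by (rule sum.group[symmetric, OF finI]) (use W in \<open>auto simp: \<tau>_def\<close>)
    also have "\<dots> = (\<Sum>T\<in>Pow W. real (card {\<psi> \<in> ?I. \<tau> \<psi> = T}) * g T)"
      by (intro sum.cong) auto
    also have "\<dots> = real (card {\<psi> \<in> ?I. \<tau> \<psi> = {}}) * g {} +
        (\<Sum>T\<in>Pow W - {{}}. real (card {\<psi> \<in> ?I. \<tau> \<psi> = T}) * g T)"
      using W by (intro sum.remove) auto
    also have "\<dots> \<le> real (card ?I) * (p ^ card F)\<^sup>2 +
        (\<Sum>T\<in>Pow W - {{}}. real n ^ ?w * (p ^ card F)\<^sup>2 * (real ?w ^ card T / (real n ^ card T * p ^ ne F T)))"
    proof (rule add_mono)
      have "card {\<psi> \<in> ?I. \<tau> \<psi> = {}} \<le> card ?I" using finI by (intro card_mono) auto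
      then show "real (card {\<psi> \<in> ?I. \<tau> \<psi> = {}}) * g {} \<le> real (card ?I) * (p ^ card F)\<^sup>2"
        using ne0 by (simp add: g_def mult_right_mono)
    qed (intro sum_mono cnt)
    finally show ?thesis by (simp add: S_def sum_distrib_left)
  qed
  have S0: "0 \<le> S" unfolding S_def using p by (intro sum_nonneg) auto
  have "real (card ?I) \<le> real (n ^ ?w)" using card_injections_le[OF W, of n] by (simp only: of_nat_le_iff)
  then have Iw: "real (card ?I) \<le> real n ^ ?w" by simp
  have "(\<Sum>\<phi>\<in>?I. \<Sum>\<psi>\<in>?I. p ^ card ((`) \<phi> ` F \<union> (`) \<psi> ` F)) \<le>
      (\<Sum>\<phi>\<in>?I. real (card ?I) * (p ^ card F)\<^sup>2 + real n ^ ?w * (p ^ card F)\<^sup>2 * S)"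
    by (intro sum_mono inner)
  also have "\<dots> = (real (card ?I) * p ^ card F)\<^sup>2 + real (card ?I) * (real n ^ ?w * (p ^ card F)\<^sup>2 * S)"
    by (simp add: algebra_simps power2_eq_square)
  also have "\<dots> \<le> (real (card ?I) * p ^ card F)\<^sup>2 + real n ^ ?w * (real n ^ ?w * (p ^ card F)\<^sup>2 * S)"
    using Iw S0 by (intro add_left_mono mult_right_mono) auto
  finally show ?thesis by (simp add: S_def power2_eq_square mult_ac)
qed

text \<open>By \<open>half\<close> the mean \<mu> is at least L / 2, so a value below L / 4 deviates
  from it by at least \<mu> / 2 \<ge> L / 4. With variance at most L^2 S this gives the factor
  16.\<close>

lemma copies_chebyshev:
  assumes W: "finite W" and F: "\<And>e. e \<in> F \<Longrightarrow> e \<subseteq> W \<and> card e = s" and s: "1 \<le> s"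
    and p: "0 < p" "p \<le> 1" and n: "1 \<le> n"
    and half: "real n ^ card W / 2 \<le> real (card (injections n W))"
  shows "measure_pmf.prob (random_hypergraph s n p)
      {E. real (card (copies n W F E)) < real n ^ card W * p ^ card F / 4} \<le>
    16 * (\<Sum>T\<in>Pow W - {{}}. real (card W) ^ card T / (real n ^ card T * p ^ ne F T))"
proof -
  let ?M = "random_hypergraph s n p" and ?X = "\<lambda>E. real (card (copies n W F E))"
  define L where "L = real n ^ card W * p ^ card F"
  define S where "S = (\<Sum>T\<in>Pow W - {{}}. real (card W) ^ card T / (real n ^ card T * p ^ ne F T))"
  define \<mu> where "\<mu> = measure_pmf.expectation ?M ?X"
  have mu: "\<mu> = real (card (injections n W)) * p ^ card F"
    unfolding \<mu>_def using expectation_card_copies(1)[OF W F] p by simp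
  have L0: "0 < L" unfolding L_def using n p by simp
  have "real n ^ card W / 2 * p ^ card F \<le> \<mu>" unfolding mu using half p by (intro mult_right_mono) auto
  then have muL: "L / 2 \<le> \<mu>" by (simp add: L_def)
  have S0: "0 \<le> S" unfolding S_def using p by (intro sum_nonneg) auto
  have int: "integrable ?M f" for f :: "nat set set \<Rightarrow> real"
    by (rule integrable_measure_pmf_finite[OF finite_set_random_hypergraph])
  have var: "measure_pmf.variance ?M ?X \<le> L\<^sup>2 * S"
  proof -
    have "measure_pmf.variance ?M ?X = measure_pmf.expectation ?M (\<lambda>E. (?X E)\<^sup>2) - \<mu>\<^sup>2"
      unfolding \<mu>_def by (rule measure_pmf.variance_eq[OF int int])
    also have "measure_pmf.expectation ?M (\<lambda>E. (?X E)\<^sup>2) =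
        (\<Sum>\<phi>\<in>injections n W. \<Sum>\<psi>\<in>injections n W. p ^ card ((`) \<phi> ` F \<union> (`) \<psi> ` F))"
      by (rule expectation_card_copies(2)[OF W F]) (use p in auto)
    also have "\<dots> \<le> \<mu>\<^sup>2 + L\<^sup>2 * S"
      unfolding mu L_def S_def by (rule pair_sum_bound[OF W F s p n])
    finally show ?thesis by simp
  qed
  have "measure_pmf.prob ?M {E. ?X E < L / 4} \<le>
      measure_pmf.prob ?M {E \<in> space (measure_pmf ?M). \<mu> / 2 \<le> \<bar>?X E - measure_pmf.expectation ?M ?X\<bar>}"
    unfolding \<mu>_def[symmetric] using muL by (intro measure_pmf.finite_measure_mono) auto
  also have "\<dots> \<le> measure_pmf.variance ?M ?X / (\<mu> / 2)\<^sup>2"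
    using muL L0 by (intro measure_pmf.Chebyshev_inequality int) auto
  also have "\<dots> \<le> L\<^sup>2 * S / (\<mu> / 2)\<^sup>2" using var by (intro divide_right_mono) auto
  also have "\<dots> \<le> L\<^sup>2 * S / (L / 4)\<^sup>2"
    using muL L0 S0 by (intro divide_left_mono power_mono mult_nonneg_nonneg) auto
  also have "\<dots> = 16 * S" using L0 by (simp add: power_divide)
  finally show ?thesis by (simp add: L_def S_def)
qed

lemma powr_neg_tendsto_0: "a < 0 \<Longrightarrow> (\<lambda>n. real n powr a) \<longlonglongrightarrow> 0"
  by (rule tendsto_neg_powr[OF _ filterlim_real_sequentially])

section \<open>Properties holding with high probability\<close>

context sparse_exponent
begin

definition G :: "nat \<Rightarrow> nat set set pmf" where
  "G n = random_hypergraph s n (real n powr - (real s - 1 - \<epsilon>))"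

definition whp :: "(nat \<Rightarrow> nat set set \<Rightarrow> bool) \<Rightarrow> bool" where
  "whp P \<longleftrightarrow> (\<lambda>n. measure_pmf.prob (G n) {E. \<not> P n E}) \<longlonglongrightarrow> 0"

lemma whpI:
  assumes "\<forall>\<^sub>F n in sequentially. measure_pmf.prob (G n) {E. \<not> P n E} \<le> g n" "g \<longlonglongrightarrow> 0"
  shows "whp P"
  unfolding whp_def
  by (rule tendsto_sandwich[OF _ assms(1) tendsto_const assms(2)]) auto

lemma whp_mono:
  assumes "whp P" "\<forall>\<^sub>F n in sequentially. \<forall>E\<in>set_pmf (G n). P n E \<longrightarrow> Q n E"
  shows "whp Q"
proof (rule whpI)
  show "(\<lambda>n. measure_pmf.prob (G n) {E. \<not> P n E}) \<longlonglongrightarrow> 0" using assms(1) by (simp add: whp_def)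
  show "\<forall>\<^sub>F n in sequentially. measure_pmf.prob (G n) {E. \<not> Q n E} \<le> measure_pmf.prob (G n) {E. \<not> P n E}"
    using assms(2) by eventually_elim (auto intro!: measure_pmf.finite_measure_mono_AE simp: AE_measure_pmf_iff)
qed

lemma whp_conj:
  assumes "whp P" "whp Q"
  shows "whp (\<lambda>n E. P n E \<and> Q n E)"
proof (rule whpI)
  show "\<forall>\<^sub>F n in sequentially. measure_pmf.prob (G n) {E. \<not> (P n E \<and> Q n E)} \<le>
      measure_pmf.prob (G n) {E. \<not> P n E} + measure_pmf.prob (G n) {E. \<not> Q n E}"
  proof (intro always_eventually allI)
    fix n
    have "{E. \<not> (P n E \<and> Q n E)} = {E. \<not> P n E} \<union> {E. \<not> Q n E}" by auto
    then show "measure_pmf.prob (G n) {E. \<not> (P n E \<and> Q n E)} \<le>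
      measure_pmf.prob (G n) {E. \<not> P n E} + measure_pmf.prob (G n) {E. \<not> Q n E}"
      by (simp add: measure_Un_le)
  qed
  show "(\<lambda>n. measure_pmf.prob (G n) {E. \<not> P n E} + measure_pmf.prob (G n) {E. \<not> Q n E}) \<longlonglongrightarrow> 0"
    using tendsto_add[of _ 0 _ _ 0] assms unfolding whp_def by auto
qed

lemma whp_ball:
  assumes "finite I" "\<And>i. i \<in> I \<Longrightarrow> whp (P i)"
  shows "whp (\<lambda>n E. \<forall>i\<in>I. P i n E)"
  using assms
proof (induction I rule: finite_induct)
  case empty
  then show ?case by (simp add: whp_def)
next
  case (insert i I)
  then have "whp (\<lambda>n E. P i n E \<and> (\<forall>i\<in>I. P i n E))" by (intro whp_conj) auto
  then show ?case by simp
qed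

section \<open>Orders of magnitude of the numbers of copies\<close>

lemma edge_prob_bounds:
  assumes "1 \<le> n"
  shows "0 < real n powr - (real s - 1 - \<epsilon>)" "real n powr - (real s - 1 - \<epsilon>) \<le> 1"
proof -
  show "0 < real n powr - (real s - 1 - \<epsilon>)" using assms by simp
  have "real n powr - (real s - 1 - \<epsilon>) \<le> real n powr 0" using assms exponent_pos by (intro powr_mono) auto
  then show "real n powr - (real s - 1 - \<epsilon>) \<le> 1" using assms by simp
qed

lemma expected_copies_powr:
  assumes "1 \<le> n"
  shows "real n ^ a * (real n powr - (real s - 1 - \<epsilon>)) ^ b = real n powr (real a - (real s - 1 - \<epsilon>) * real b)"
proof -
  have "real n ^ a = real n powr real a" using assms by (simp add: powr_realpow)
  moreover have "(real n powr - (real s - 1 - \<epsilon>)) ^ b = real n powr (- (real s - 1 - \<epsilon>) * real b)"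
    using assms by (simp add: powr_realpow[symmetric] powr_powr)
  ultimately show ?thesis by (simp add: powr_add[symmetric] algebra_simps)
qed

text \<open>Markov's inequality: the expected number of copies is of smaller order than n to the
  power a.\<close>

lemma whp_few_copies:
  assumes W: "finite W" and F: "\<And>e. e \<in> F \<Longrightarrow> e \<subseteq> W \<and> card e = s"
    and less: "real (card W) - (real s - 1 - \<epsilon>) * real (card F) < a" and c: "0 < c"
  shows "whp (\<lambda>n E. real (card (copies n W F E)) < c * real n powr a)"
proof (rule whpI)
  let ?b = "real (card W) - (real s - 1 - \<epsilon>) * real (card F)"
  show "\<forall>\<^sub>F n in sequentially. measure_pmf.prob (G n) {E. \<not> real (card (copies n W F E)) < c * real n powr a}
      \<le> 1 / c * real n powr (?b - a)"
    using eventually_ge_at_top[of 1]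
  proof eventually_elim
    case (elim n)
    have "measure_pmf.prob (G n) {E. c * real n powr a \<le> real (card (copies n W F E))} \<le>
        real n ^ card W * (real n powr - (real s - 1 - \<epsilon>)) ^ card F / (c * real n powr a)"
      unfolding G_def using edge_prob_bounds[OF elim] c elim by (intro copies_markov W F) auto
    also have "\<dots> = 1 / c * real n powr (?b - a)"
      unfolding expected_copies_powr[OF elim] by (simp add: powr_diff)
    finally show ?case by (simp add: not_less)
  qed
  have "(\<lambda>n. real n powr (?b - a)) \<longlonglongrightarrow> 0" using less by (intro powr_neg_tendsto_0) simp
  then show "(\<lambda>n. 1 / c * real n powr (?b - a)) \<longlonglongrightarrow> 0"
    using tendsto_mult_right_zero by blast
qed

text \<open>Chebyshev's inequality: each nonempty part T contributes a multiple of n to the power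
  \<open>- wt F T\<close> to the error, which vanishes since \<open>F\<close> is balanced. For large
  n at least half of all functions are injections.\<close>

lemma whp_many_copies:
  assumes bal: "balanced W F"
  shows "whp (\<lambda>n E. real n powr wt F W / 4 \<le> real (card (copies n W F E)))"
proof (rule whpI)
  let ?w = "card W"
  have W: "finite W" and F: "\<And>e. e \<in> F \<Longrightarrow> e \<subseteq> W \<and> card e = s"
    using bal by (auto simp: balanced_def)
  have neF: "ne F W = card F" unfolding ne_def using F by (intro arg_cong[where f = card]) auto
  have "(\<lambda>n. (real n - real ?w) / real n) \<longlonglongrightarrow> 1" by real_asymp
  then have "(\<lambda>n. ((real n - real ?w) / real n) ^ ?w) \<longlonglongrightarrow> 1 ^ ?w" by (rule tendsto_power)
  then have "\<forall>\<^sub>F n in sequentially. 1 / 2 < ((real n - real ?w) / real n) ^ ?w"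
    by (intro order_tendstoD) auto
  then show "\<forall>\<^sub>F n in sequentially.
      measure_pmf.prob (G n) {E. \<not> real n powr wt F W / 4 \<le> real (card (copies n W F E))} \<le>
      16 * (\<Sum>T\<in>Pow W - {{}}. real ?w ^ card T / real n powr wt F T)"
    using eventually_ge_at_top[of "?w + 1"]
  proof eventually_elim
    case (elim n)
    let ?p = "real n powr - (real s - 1 - \<epsilon>)"
    have n: "1 \<le> n" using elim by simp
    have "real n ^ ?w / 2 \<le> (real n - real ?w) ^ ?w"
      using elim n by (simp add: power_divide field_simps)
    also have "\<dots> = real ((n - ?w) ^ ?w)" using elim by (simp add: of_nat_diff)
    also have "\<dots> \<le> real (card (injections n W))" using card_injections_ge[OF W, of n] by (simp only: of_nat_le_iff)
    finally have half: "real n ^ ?w / 2 \<le> real (card (injections n W))" .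
    have "measure_pmf.prob (G n) {E. real (card (copies n W F E)) < real n ^ ?w * ?p ^ card F / 4} \<le>
        16 * (\<Sum>T\<in>Pow W - {{}}. real ?w ^ card T / (real n ^ card T * ?p ^ ne F T))"
      unfolding G_def using edge_prob_bounds[OF n] s_ge n half by (intro copies_chebyshev W F) auto
    then show ?case
      unfolding expected_copies_powr[OF n] not_le wt_alt neF by simp
  qed
  have "(\<lambda>n. \<Sum>T\<in>Pow W - {{}}. real ?w ^ card T / real n powr wt F T) \<longlonglongrightarrow> (\<Sum>T\<in>Pow W - {{}}. 0)"
  proof (rule tendsto_sum)
    fix T assume "T \<in> Pow W - {{}}"
    then have "0 < wt F T" using balanced_pos[OF bal] by auto
    then have "(\<lambda>n. real n powr - wt F T) \<longlonglongrightarrow> 0" by (intro powr_neg_tendsto_0) simp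
    then have "(\<lambda>n. real ?w ^ card T * real n powr - wt F T) \<longlonglongrightarrow> 0" using tendsto_mult_right_zero by blast
    then show "(\<lambda>n. real ?w ^ card T / real n powr wt F T) \<longlonglongrightarrow> 0" by (simp add: powr_minus_divide)
  qed
  then have "(\<lambda>n. \<Sum>T\<in>Pow W - {{}}. real ?w ^ card T / real n powr wt F T) \<longlonglongrightarrow> 0" by simp
  then show "(\<lambda>n. 16 * (\<Sum>T\<in>Pow W - {{}}. real ?w ^ card T / real n powr wt F T)) \<longlonglongrightarrow> 0"
    using tendsto_mult_right_zero by blast
qed

section \<open>The clauses of richness hold with high probability\<close>

lemma edge_G:
  assumes "E \<in> set_pmf (G n)" "e \<in> E"
  shows "e \<subseteq> {1..n}" "card e = s"
  using set_random_hypergraph[of E s n] assms unfolding G_def by auto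

text \<open>Only finitely many labelled hypergraphs on at most \<open>N\<close> vertices have
  negative exponent. With high probability each has fewer than n to the power 0 copies, that is,
  none.\<close>

lemma whp_wt_nonneg: "whp (\<lambda>n E. \<forall>S\<subseteq>{1..n}. card S \<le> N \<longrightarrow> 0 \<le> wt E S)"
proof -
  define I where "I = {(v, F). v \<le> N \<and> F \<subseteq> {e. e \<subseteq> {..<v} \<and> card e = s} \<and>
    real v - (real s - 1 - \<epsilon>) * real (card F) < 0}"
  have "I \<subseteq> Sigma {..N} (\<lambda>v. Pow (Pow {..<v}))" by (auto simp: I_def)
  then have finI: "finite I" by (rule finite_subset) auto
  have "whp (\<lambda>n E. \<forall>i\<in>I. real (card (copies n {..<fst i} (snd i) E)) < 1 * real n powr 0)"
  proof (rule whp_ball[OF finI], rule whp_few_copies)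
    fix i e assume i: "i \<in> I"
    then show "real (card {..<fst i}) - (real s - 1 - \<epsilon>) * real (card (snd i)) < 0" by (auto simp: I_def)
    have "snd i \<subseteq> {e. e \<subseteq> {..<fst i} \<and> card e = s}" using i by (simp add: I_def case_prod_beta)
    moreover assume "e \<in> snd i"
    ultimately show "e \<subseteq> {..<fst i} \<and> card e = s" by blast
  qed auto
  then show ?thesis
  proof (rule whp_mono)
    show "\<forall>\<^sub>F n in sequentially. \<forall>E\<in>set_pmf (G n).
        (\<forall>i\<in>I. real (card (copies n {..<fst i} (snd i) E)) < 1 * real n powr 0) \<longrightarrow>
        (\<forall>S\<subseteq>{1..n}. card S \<le> N \<longrightarrow> 0 \<le> wt E S)"
    proof (rule eventually_mono[OF eventually_ge_at_top[of "1::nat"]], intro ballI impI allI, rule ccontr)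
      fix n E S
      assume n: "1 \<le> n" and E: "E \<in> set_pmf (G n)"
        and none: "\<forall>i\<in>I. real (card (copies n {..<fst i} (snd i) E)) < 1 * real n powr 0"
        and S: "S \<subseteq> {1..n}" "card S \<le> N" and neg: "\<not> 0 \<le> wt E S"
      have finS: "finite S" using S(1) by (rule finite_subset) simp
      define v where "v = card S"
      obtain b where b: "bij_betw b {..<v} S"
        using ex_bij_betw_nat_finite[OF finS] by (auto simp: v_def atLeast0LessThan)
      have inj: "inj_on b {..<v}" and im: "b ` {..<v} = S" using b by (auto simp: bij_betw_def)
      define F where "F = {e. e \<subseteq> {..<v} \<and> b ` e \<in> E}"
      have "ne E (b ` {..<v}) = ne F {..<v}" by (rule ne_image_eq[OF inj]) (auto simp: F_def)
      moreover have "{e \<in> F. e \<subseteq> {..<v}} = F" by (auto simp: F_def)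
      ultimately have cardF: "card F = ne E S" unfolding im by (simp add: ne_def)
      have "card e = s" if "e \<in> F" for e
      proof -
        have "card (b ` e) = card e" using that by (intro card_image inj_on_subset[OF inj]) (auto simp: F_def)
        then show ?thesis using that edge_G(2)[OF E, of "b ` e"] by (simp add: F_def)
      qed
      then have "F \<subseteq> {e. e \<subseteq> {..<v} \<and> card e = s}" by (auto simp: F_def)
      then have "(v, F) \<in> I" using neg S(2) cardF by (simp add: I_def wt_alt v_def)
      then have "real (card (copies n {..<v} F E)) < 1" using none n by fastforce
      then have "copies n {..<v} F E = {}" using finite_copies[of "{..<v}" n F E] by simp
      moreover have "restrict b {..<v} \<in> copies n {..<v} F E"
      proof -
        have "restrict b {..<v} ` e = b ` e" if "e \<in> F" for e using that by (auto simp: F_def)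
        then have "(`) (restrict b {..<v}) ` F \<subseteq> E" by (auto simp: F_def)
        moreover have "b \<in> {..<v} \<rightarrow> {1..n}" using im S(1) by auto
        ultimately show ?thesis using inj by (auto simp: copies_def injections_def inj_on_restrict_eq)
      qed
      ultimately show False by simp
    qed
  qed
qed

text \<open>The number of possible edges at v that avoid the rest of B is of order n^(s - 1), so
  none is present with probability at most exp (- \<kappa> n^\<epsilon>). This beats the n^N choices
  of B and v.\<close>

lemma whp_pendant_edge:
  "whp (\<lambda>n E. \<forall>B\<subseteq>{1..n}. card B \<le> N \<longrightarrow> (\<forall>v\<in>B. \<exists>e\<in>E. e \<inter> B = {v}))"
proof (rule whpI)
  define r where "r = s - 1"
  have r: "1 \<le> r" using s_ge by (simp add: r_def)
  \<comment> \<open>At least n / 2 vertices lie outside \<open>B\<close>, and x choose r is at least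
    (x / r)^r.\<close>
  define \<kappa> where "\<kappa> = (1 / (2 * real r)) ^ r"
  have kpos: "0 < \<kappa>" using r by (simp add: \<kappa>_def)
  show "\<forall>\<^sub>F n in sequentially.
      measure_pmf.prob (G n) {E. \<not> (\<forall>B\<subseteq>{1..n}. card B \<le> N \<longrightarrow> (\<forall>v\<in>B. \<exists>e\<in>E. e \<inter> B = {v}))} \<le>
      real n powr real N * exp (- \<kappa> * real n powr \<epsilon>)"
    using eventually_ge_at_top[of "2 * N + 2 * r + 1"]
  proof eventually_elim
    case (elim n)
    then have n: "1 \<le> n" by simp
    define p where "p = real n powr - (real s - 1 - \<epsilon>)"
    have p: "0 \<le> p" "p \<le> 1" using edge_prob_bounds[OF n] by (auto simp: p_def)
    \<comment> \<open>A pair of \<open>B\<close> and \<open>v\<close> is coded as a list of length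
      \<open>N\<close> with set \<open>B\<close> and head \<open>v\<close>, smaller sets being
      padded with \<open>v\<close>.\<close>
    define XS where "XS = {xs. set xs \<subseteq> {1..n} \<and> length xs = N}"
    have finXS: "finite XS" unfolding XS_def by (rule finite_lists_length_eq) simp
    define K where "K xs = {e. e \<subseteq> {1..n} \<and> card e = s \<and> e \<inter> set xs = {hd xs}}" for xs :: "nat list"
    have one: "measure_pmf.prob (G n) {E. K xs \<inter> E = {}} \<le> exp (- \<kappa> * real n powr \<epsilon>)"
      if xs: "xs \<in> XS" "xs \<noteq> []" for xs
    proof -
      let ?R = "{1..n} - set xs"
      have hd: "hd xs \<in> set xs" using xs by simp
      have "card (set xs) \<le> N" using xs card_length[of xs] by (simp add: XS_def)
      moreover have "card ?R = n - card (set xs)" using xs by (simp add: XS_def card_Diff_subset)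
      ultimately have R: "n \<le> 2 * card ?R" "r \<le> card ?R" using elim by linarith+
      let ?A = "{A. A \<subseteq> ?R \<and> card A = r}"
      have "inj_on (insert (hd xs)) ?A"
      proof (rule inj_onI)
        fix A B assume "A \<in> ?A" "B \<in> ?A" and eq: "insert (hd xs) A = insert (hd xs) B"
        then have "hd xs \<notin> A" "hd xs \<notin> B" using hd by auto
        then show "A = B" using eq by (simp add: insert_ident)
      qed
      moreover have "insert (hd xs) ` ?A \<subseteq> K xs"
      proof (rule image_subsetI)
        fix A assume A: "A \<in> ?A"
        then have "finite A" "hd xs \<notin> A" using hd by (auto intro: finite_subset)
        then have "card (insert (hd xs) A) = s" using A s_ge by (simp add: r_def)
        moreover have "hd xs \<in> {1..n}" using hd xs(1) unfolding XS_def by blast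
        then have "insert (hd xs) A \<subseteq> {1..n}" using A by auto
        moreover have "insert (hd xs) A \<inter> set xs = {hd xs}" using A hd by auto
        ultimately show "insert (hd xs) A \<in> K xs" by (simp add: K_def)
      qed
      moreover have "finite (K xs)" by (rule finite_subset[OF _ finite_all_edges[of n s]]) (auto simp: K_def)
      ultimately have "card ?A \<le> card (K xs)" by (rule card_inj_on_le)
      then have "card ?R choose r \<le> card (K xs)" using n_subsets[of ?R r] by simp
      moreover have "(real (card ?R) / real r) ^ r \<le> real (card ?R choose r)"
        by (rule binomial_ge_n_over_k_pow_k[OF R(2)])
      ultimately have "(real (card ?R) / real r) ^ r \<le> real (card (K xs))" by linarith
      moreover have "(real n / (2 * real r)) ^ r \<le> (real (card ?R) / real r) ^ r"
      proof (rule power_mono)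
        have "real n \<le> 2 * real (card ?R)" using R(1) by linarith
        then show "real n / (2 * real r) \<le> real (card ?R) / real r" using r by (simp add: field_simps)
      qed auto
      ultimately have cardK: "\<kappa> * real n ^ r \<le> real (card (K xs))"
        by (simp add: \<kappa>_def power_divide)
      have "real n powr \<epsilon> = real n ^ r * p"
        using expected_copies_powr[OF n, of r 1] s_ge by (simp add: p_def r_def of_nat_diff)
      then have expo: "\<kappa> * real n powr \<epsilon> \<le> p * real (card (K xs))"
        using mult_right_mono[OF cardK p(1)] by (simp add: mult_ac)
      have "measure_pmf.prob (G n) {E. K xs \<inter> E = {}} = (1 - p) ^ card (K xs)"
        unfolding G_def p_def[symmetric] by (rule prob_edges_absent[OF _ p]) (auto simp: K_def)
      also have "\<dots> \<le> exp (- p) ^ card (K xs)"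
        using p exp_ge_add_one_self[of "- p"] by (intro power_mono) auto
      also have "\<dots> = exp (- (p * real (card (K xs))))" by (simp add: exp_of_nat_mult[symmetric] mult_ac)
      also have "\<dots> \<le> exp (- \<kappa> * real n powr \<epsilon>)" using expo by simp
      finally show ?thesis .
    qed
    have "{E. \<not> (\<forall>B\<subseteq>{1..n}. card B \<le> N \<longrightarrow> (\<forall>v\<in>B. \<exists>e\<in>E. e \<inter> B = {v}))} \<subseteq>
        (\<Union>xs\<in>XS - {[]}. {E. K xs \<inter> E = {}})"
    proof
      fix E assume "E \<in> {E. \<not> (\<forall>B\<subseteq>{1..n}. card B \<le> N \<longrightarrow> (\<forall>v\<in>B. \<exists>e\<in>E. e \<inter> B = {v}))}"
      then obtain B v where B: "B \<subseteq> {1..n}" "card B \<le> N" "v \<in> B" "\<And>e. e \<in> E \<Longrightarrow> e \<inter> B \<noteq> {v}" by auto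
      have finB: "finite B" using B(1) by (rule finite_subset) simp
      obtain ys where ys: "set ys = B - {v}" "distinct ys" using finite_distinct_list[of "B - {v}"] finB by auto
      have len: "length ys = card B - 1" using distinct_card[OF ys(2)] ys(1) B(3) finB by simp
      have pos: "1 \<le> card B" using B(3) finB by (auto simp: Suc_le_eq card_gt_0_iff)
      define xs where "xs = v # ys @ replicate (N - card B) v"
      have "set xs = insert v (set ys)" by (auto simp: xs_def)
      then have xs: "set xs = B" unfolding ys(1) using B(3) by auto
      have "length xs = N" using len pos B(2) by (simp add: xs_def)
      then have "xs \<in> XS" using xs B(1) by (simp add: XS_def)
      then have "xs \<in> XS - {[]}" by (simp add: xs_def)
      moreover have "hd xs = v" by (simp add: xs_def)
      then have "K xs \<inter> E = {}" unfolding K_def xs using B(4) by auto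
      ultimately show "E \<in> (\<Union>xs\<in>XS - {[]}. {E. K xs \<inter> E = {}})" by blast
    qed
    then have "measure_pmf.prob (G n) {E. \<not> (\<forall>B\<subseteq>{1..n}. card B \<le> N \<longrightarrow> (\<forall>v\<in>B. \<exists>e\<in>E. e \<inter> B = {v}))} \<le>
        measure_pmf.prob (G n) (\<Union>xs\<in>XS - {[]}. {E. K xs \<inter> E = {}})"
      by (intro measure_pmf.finite_measure_mono) auto
    also have "\<dots> \<le> (\<Sum>xs\<in>XS - {[]}. measure_pmf.prob (G n) {E. K xs \<inter> E = {}})"
      using finXS by (intro measure_pmf.finite_measure_subadditive_finite) auto
    also have "\<dots> \<le> (\<Sum>xs\<in>XS - {[]}. exp (- \<kappa> * real n powr \<epsilon>))" by (intro sum_mono one) auto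
    also have "\<dots> = real (card (XS - {[]})) * exp (- \<kappa> * real n powr \<epsilon>)" by simp
    also have "\<dots> \<le> real (n ^ N) * exp (- \<kappa> * real n powr \<epsilon>)"
    proof (rule mult_right_mono)
      have "card (XS - {[]}) \<le> card XS" using finXS by (intro card_mono) auto
      also have "\<dots> = n ^ N" unfolding XS_def using card_lists_length_eq[of "{1..n}" N] by simp
      finally show "real (card (XS - {[]})) \<le> real (n ^ N)" by (simp only: of_nat_le_iff)
    qed simp
    also have "real (n ^ N) = real n powr real N" using n by (simp add: powr_realpow)
    finally show ?case .
  qed
  show "(\<lambda>n. real n powr real N * exp (- \<kappa> * real n powr \<epsilon>)) \<longlonglongrightarrow> 0"
    using kpos eps_pos by real_asymp
qed

text \<open>Every edge lies in one copy, so weight is additive over the copies; no term is negative,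
  and one belonging to a copy that meets \<open>S\<close> is positive.\<close>

lemma balanced_disjoint_copies:
  assumes bal: "balanced W F"
  shows "balanced ({..<k::nat} \<times> W) (\<Union>i<k. (`) (Pair i) ` F)" (is "balanced ?W ?F")
  unfolding balanced_def
proof (intro conjI ballI allI impI)
  have W: "finite W" and F: "\<And>e. e \<in> F \<Longrightarrow> e \<subseteq> W \<and> card e = s" using bal by (auto simp: balanced_def)
  show "finite ?W" using W by simp
  fix e assume "e \<in> ?F"
  then obtain i d where d: "i < k" "d \<in> F" "e = Pair i ` d" by auto
  show "e \<subseteq> ?W" using d F by auto
  show "card e = s" using F[OF d(2)] d(3) by (simp add: card_image inj_on_def)
next
  have W: "finite W" and F: "\<And>e. e \<in> F \<Longrightarrow> e \<subseteq> W \<and> card e = s" using bal by (auto simp: balanced_def)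
  fix S assume S: "S \<subseteq> ?W" "S \<noteq> {}"
  define T where "T i = {x. (i, x) \<in> S}" for i
  have TW: "T i \<subseteq> W" for i using S by (auto simp: T_def)
  have finT: "finite (T i)" for i using finite_subset[OF TW W] .
  have "S = Sigma {..<k} T" using S by (auto simp: T_def)
  then have cardS: "card S = (\<Sum>i<k. card (T i))" using finT by simp
  have ne_empty: "d \<noteq> {}" if "d \<in> F" for d using F[OF that] s_ge by auto
  have "{e \<in> ?F. e \<subseteq> S} = (\<Union>i<k. (`) (Pair i) ` {e \<in> F. e \<subseteq> T i})" by (auto simp: T_def)
  then have "ne ?F S = card (\<Union>i<k. (`) (Pair i) ` {e \<in> F. e \<subseteq> T i})" by (simp add: ne_def)
  also have "\<dots> = (\<Sum>i<k. card ((`) (Pair i) ` {e \<in> F. e \<subseteq> T i}))"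
  proof (rule card_UN_disjoint)
    show "\<forall>i\<in>{..<k}. finite ((`) (Pair i) ` {e \<in> F. e \<subseteq> T i})" using finT finite_edges_within by blast
    show "\<forall>i\<in>{..<k}. \<forall>j\<in>{..<k}. i \<noteq> j \<longrightarrow>
        (`) (Pair i) ` {e \<in> F. e \<subseteq> T i} \<inter> (`) (Pair j) ` {e \<in> F. e \<subseteq> T j} = {}"
    proof (intro ballI impI equals0I)
      fix i j x assume "i \<noteq> j" "x \<in> (`) (Pair i) ` {e \<in> F. e \<subseteq> T i} \<inter> (`) (Pair j) ` {e \<in> F. e \<subseteq> T j}"
      then obtain d d' where d: "d \<in> F" "Pair i ` d = Pair j ` d'" by auto
      obtain y where "y \<in> d" using ne_empty[OF d(1)] by auto
      then have "(i, y) \<in> Pair j ` d'" using d(2) by auto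
      then show False using \<open>i \<noteq> j\<close> by auto
    qed
  qed simp
  also have "\<dots> = (\<Sum>i<k. ne F (T i))"
  proof (intro sum.cong refl)
    fix i
    have "inj_on ((`) (Pair i)) {e \<in> F. e \<subseteq> T i}"
      by (rule inj_on_subset[OF inj_on_image_Pow[of "Pair i" UNIV]]) (auto simp: inj_on_def)
    then show "card ((`) (Pair i) ` {e \<in> F. e \<subseteq> T i}) = ne F (T i)" unfolding ne_def by (rule card_image)
  qed
  finally have wtS: "wt ?F S = (\<Sum>i<k. wt F (T i))"
    by (simp add: wt_alt cardS sum_subtractf sum_distrib_left)
  have nonneg: "0 \<le> wt F (T i)" for i
  proof (cases "T i = {}")
    case True
    have "{e \<in> F. e \<subseteq> {}} = {}" using ne_empty by auto
    then have "ne F {} = 0" unfolding ne_def by (simp only: card.empty)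
    then show ?thesis using True by (simp add: wt_alt)
  next
    case False
    then show ?thesis using balanced_pos[OF bal TW] by (simp add: less_imp_le)
  qed
  obtain i x where ix: "(i, x) \<in> S" using S by auto
  then have "i < k" "T i \<noteq> {}" using S by (auto simp: T_def)
  then have "0 < (\<Sum>i<k. wt F (T i))"
    using balanced_pos[OF bal TW] nonneg by (intro sum_pos2[of _ i]) auto
  then show "0 < wt ?F S" by (simp add: wtS)
qed

text \<open>\<open>A\<close> may depend on the hypergraph. Instead of a union bound over
  \<open>A\<close>, one embeds \<open>Suc N\<close> disjoint copies at once; \<open>N\<close>
  vertices cannot meet all of them.\<close>

lemma whp_copy_avoiding:
  assumes bal: "balanced W F"
  shows "whp (\<lambda>n E. \<forall>A. finite A \<longrightarrow> card A \<le> N \<longrightarrow>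
    (\<exists>\<phi>. inj_on \<phi> W \<and> \<phi> ` W \<subseteq> {1..n} - A \<and> (\<forall>e\<in>F. \<phi> ` e \<in> E)))"
proof -
  let ?W = "{..<Suc N} \<times> W" and ?F = "\<Union>i<Suc N. (`) (Pair i) ` F"
  show ?thesis
  proof (rule whp_mono[OF whp_many_copies[OF balanced_disjoint_copies[OF bal]]])
    show "\<forall>\<^sub>F n in sequentially. \<forall>E\<in>set_pmf (G n).
      real n powr wt ?F ?W / 4 \<le> real (card (copies n ?W ?F E)) \<longrightarrow>
      (\<forall>A. finite A \<longrightarrow> card A \<le> N \<longrightarrow>
        (\<exists>\<phi>. inj_on \<phi> W \<and> \<phi> ` W \<subseteq> {1..n} - A \<and> (\<forall>e\<in>F. \<phi> ` e \<in> E)))"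
    proof (rule eventually_mono[OF eventually_ge_at_top[of "1::nat"]], intro ballI impI allI)
      fix n E and A :: "nat set"
      assume n: "1 \<le> n" and many: "real n powr wt ?F ?W / 4 \<le> real (card (copies n ?W ?F E))"
        and A: "finite A" "card A \<le> N"
      have "0 < real n powr wt ?F ?W / 4" using n by simp
      then have "copies n ?W ?F E \<noteq> {}" using many by auto
      then obtain \<phi> where \<phi>: "\<phi> \<in> copies n ?W ?F E" by blast
      then have inj: "inj_on \<phi> ?W" and img: "\<phi> ` ?W \<subseteq> {1..n}" and sub: "(`) \<phi> ` ?F \<subseteq> E"
        by (auto simp: copies_def injections_def)
      have edges: "\<phi> ` e \<in> E" if "e \<in> ?F" for e using sub imageI[OF that] by (rule subsetD)
      have "\<exists>i<Suc N. \<phi> ` ({i} \<times> W) \<inter> A = {}"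
      proof (rule ccontr)
        assume "\<not> ?thesis"
        then have "\<forall>i\<in>{..<Suc N}. \<exists>x. x \<in> W \<and> \<phi> (i, x) \<in> A" by blast
        then obtain x where x: "\<And>i. i < Suc N \<Longrightarrow> x i \<in> W \<and> \<phi> (i, x i) \<in> A" by (metis lessThan_iff)
        have "inj_on (\<lambda>i. \<phi> (i, x i)) {..<Suc N}"
        proof (rule inj_onI)
          fix i j assume "i \<in> {..<Suc N}" "j \<in> {..<Suc N}" "\<phi> (i, x i) = \<phi> (j, x j)"
          then have "(i, x i) = (j, x j)" using x by (intro inj_onD[OF inj]) auto
          then show "i = j" by simp
        qed
        moreover have "(\<lambda>i. \<phi> (i, x i)) ` {..<Suc N} \<subseteq> A" using x by auto
        ultimately have "card {..<Suc N} \<le> card A" using A(1) by (rule card_inj_on_le)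
        then show False using A(2) by simp
      qed
      then obtain i where i: "i < Suc N" "\<phi> ` ({i} \<times> W) \<inter> A = {}" by blast
      have "inj_on (\<lambda>x. \<phi> (i, x)) W" using inj i by (auto simp: inj_on_def)
      moreover have "(\<lambda>x. \<phi> (i, x)) ` W \<subseteq> {1..n} - A" using img i by auto
      moreover have "(\<lambda>x. \<phi> (i, x)) ` e \<in> E" if "e \<in> F" for e
      proof -
        have "Pair i ` e \<in> ?F" using that i by auto
        then have "\<phi> ` Pair i ` e \<in> E" by (rule edges)
        then show ?thesis by (simp add: image_image)
      qed
      ultimately show "\<exists>\<phi>. inj_on \<phi> W \<and> \<phi> ` W \<subseteq> {1..n} - A \<and> (\<forall>e\<in>F. \<phi> ` e \<in> E)"
        by (intro exI[of _ "\<lambda>x. \<phi> (i, x)"]) simp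
    qed
  qed
qed

text \<open>A dense extension has q \<le> 2^m d for its q new edges and d new cycles, so its
  exponent differs from that of \<open>F\<close> by \<epsilon> q - d < 0. Copies contained in one of
  the finitely many dense patterns are thus too few to exhaust the copies of
  \<open>F\<close>.\<close>

lemma whp_strong_copy:
  fixes h :: nat
  assumes bal: "balanced {..<h} F"
  shows "whp (\<lambda>n E. \<exists>\<phi>. inj_on \<phi> {..<h} \<and> \<phi> ` {..<h} \<subseteq> {1..n} \<and>
    (\<forall>e\<subseteq>{..<h}. e \<in> F \<longleftrightarrow> \<phi> ` e \<in> E) \<and> strong N (2 ^ m) {1..n} E (\<phi> ` {..<h}))"
proof -
  have F: "e \<subseteq> {..<h} \<and> card e = s" if "e \<in> F" for e using bal that by (auto simp: balanced_def)
  have finF: "finite F" using F by (intro finite_subset[of F "Pow {..<h}"]) auto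
  have neF: "ne F {..<h} = card F" unfolding ne_def using F by (intro arg_cong[where f = card]) auto
  \<comment> \<open>The new cycles number (s - 1) q - (h' - h). The case \<open>h' = h\<close> is
    included: it stands for surplus edges on the copy itself.\<close>
  define over where "over h' q \<longleftrightarrow> h \<le> h' \<and> 1 \<le> q \<and> int q \<le> 2 ^ m * ((int s - 1) * int q - (int h' - int h))"
    for h' q :: nat
  define I where "I = {(h', F'). h' \<le> h + N \<and> F' \<subseteq> {e. e \<subseteq> {..<h'} \<and> card e = s} \<and> F \<subseteq> F' \<and>
    over h' (card F' - card F)}"
  have "I \<subseteq> Sigma {..h + N} (\<lambda>v. Pow (Pow {..<v}))" by (auto simp: I_def)
  then have finI: "finite I" by (rule finite_subset) auto
  \<comment> \<open>All patterns together then account for less than the quarter of n to the power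
    \<open>wt F {..<h}\<close> that \<open>whp_many_copies\<close> guarantees.\<close>
  define c where "c = 1 / (4 * (real (card I) + 1))"
  have c: "0 < c" "real (card I) * c < 1 / 4" by (auto simp: c_def field_simps)
  have "whp (\<lambda>n E. \<forall>i\<in>I. real (card (copies n {..<fst i} (snd i) E)) < c * real n powr wt F {..<h})"
  proof (rule whp_ball[OF finI], rule whp_few_copies)
    fix i e assume i: "i \<in> I"
    have sub: "snd i \<subseteq> {e. e \<subseteq> {..<fst i} \<and> card e = s}" "F \<subseteq> snd i"
      and ov: "over (fst i) (card (snd i) - card F)"
      using i by (auto simp: I_def case_prod_beta)
    { assume "e \<in> snd i"
      then show "e \<subseteq> {..<fst i} \<and> card e = s" using sub(1) by blast }
    have "finite (snd i)" by (rule finite_subset[of _ "Pow {..<fst i}"]) (use sub(1) in auto)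
    then have le: "card F \<le> card (snd i)" using sub(2) by (rule card_mono)
    define q where "q = card (snd i) - card F"
    have q: "real (card (snd i)) = real (card F) + real q" using le by (simp add: q_def)
    have "1 \<le> q" and "int q \<le> 2 ^ m * ((int s - 1) * int q - (int (fst i) - int h))"
      using ov by (auto simp: over_def q_def)
    define d where "d = (int s - 1) * int q - (int (fst i) - int h)"
    have "int q \<le> 2 ^ m * d" unfolding d_def by fact
    then have "real_of_int (int q) \<le> real_of_int (2 ^ m * d)" by (simp only: of_int_le_iff)
    then have "\<epsilon> * real q \<le> \<epsilon> * (2 ^ m * real_of_int d)" using eps_pos by (intro mult_left_mono) auto
    moreover have "0 < (2::int) ^ m * d" using \<open>int q \<le> 2 ^ m * d\<close> \<open>1 \<le> q\<close> by linarith
    then have "0 < d" by (simp add: zero_less_mult_iff)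
    then have "\<epsilon> * 2 ^ m * real_of_int d < 1 * real_of_int d"
      using eps_less by (intro mult_strict_right_mono) auto
    ultimately have "\<epsilon> * real q < real_of_int d" by (simp add: mult.assoc)
    then show "real (card {..<fst i}) - (real s - 1 - \<epsilon>) * real (card (snd i)) < wt F {..<h}"
      unfolding wt_alt neF q by (simp add: d_def algebra_simps)
  qed (auto simp: c)
  with whp_many_copies[OF bal]
  have "whp (\<lambda>n E. real n powr wt F {..<h} / 4 \<le> real (card (copies n {..<h} F E)) \<and>
      (\<forall>i\<in>I. real (card (copies n {..<fst i} (snd i) E)) < c * real n powr wt F {..<h}))"
    by (rule whp_conj)
  then show ?thesis
  proof (rule whp_mono, intro eventually_mono[OF eventually_ge_at_top[of "1::nat"]] ballI impI)
    fix n E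
    assume n: "1 \<le> n" and E: "E \<in> set_pmf (G n)"
      and counts: "real n powr wt F {..<h} / 4 \<le> real (card (copies n {..<h} F E)) \<and>
        (\<forall>i\<in>I. real (card (copies n {..<fst i} (snd i) E)) < c * real n powr wt F {..<h})"
    define L where "L = real n powr wt F {..<h}"
    have L: "0 < L" using n by (simp add: L_def)
    \<comment> \<open>A copy with a dense extension is the restriction of a copy of some pattern;
      restricting cannot increase the number.\<close>
    define bad where "bad = (\<Union>i\<in>I. (\<lambda>\<psi>. restrict \<psi> {..<h}) ` copies n {..<fst i} (snd i) E)"
    have "card bad \<le> (\<Sum>i\<in>I. card ((\<lambda>\<psi>. restrict \<psi> {..<h}) ` copies n {..<fst i} (snd i) E))"
      unfolding bad_def by (rule card_UN_le[OF finI])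
    also have "\<dots> \<le> (\<Sum>i\<in>I. card (copies n {..<fst i} (snd i) E))"
      by (intro sum_mono card_image_le finite_copies) simp
    finally have "real (card bad) \<le> (\<Sum>i\<in>I. real (card (copies n {..<fst i} (snd i) E)))"
      by (simp only: of_nat_sum[symmetric] of_nat_le_iff)
    also have "\<dots> \<le> (\<Sum>i\<in>I. c * L)" using counts by (intro sum_mono) (auto simp: L_def less_imp_le)
    also have "\<dots> = (real (card I) * c) * L" by simp
    also have "\<dots> < 1 / 4 * L" using c(2) L by (rule mult_strict_right_mono)
    also have "\<dots> \<le> real (card (copies n {..<h} F E))" using counts by (simp add: L_def)
    finally have "card bad < card (copies n {..<h} F E)" by simp
    moreover have "finite bad" unfolding bad_def using finI by (intro finite_UN_I finite_imageI finite_copies) auto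
    ultimately have "\<not> copies n {..<h} F E \<subseteq> bad" using card_mono[of bad] by (meson not_le)
    then obtain \<phi> where \<phi>: "\<phi> \<in> copies n {..<h} F E" "\<phi> \<notin> bad" by blast
    have inj: "inj_on \<phi> {..<h}" and ext: "\<phi> \<in> extensional {..<h}" and img: "\<phi> ` {..<h} \<subseteq> {1..n}"
      and sub: "(`) \<phi> ` F \<subseteq> E"
      using \<phi>(1) by (auto simp: copies_def injections_def PiE_def)
    have edges: "\<phi> ` e \<in> E" if "e \<in> F" for e using sub imageI[OF that] by (rule subsetD)
    have cardH: "card (\<phi> ` {..<h}) = h" using card_image[OF inj] by simp
    have no_over: "\<not> over (card Y) (ne E Y - card F)"
      if Y: "\<phi> ` {..<h} \<subseteq> Y" "Y \<subseteq> {1..n}" "card Y \<le> h + N" for Y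
    proof
      assume ov: "over (card Y) (ne E Y - card F)"
      have finY: "finite Y" using Y(2) by (rule finite_subset) simp
      have hY: "h \<le> card Y" using card_mono[OF finY Y(1)] cardH by simp
      have "card {h..<card Y} = card (Y - \<phi> ` {..<h})"
        using cardH Y(1) finY by (simp add: card_Diff_subset finite_subset)
      then obtain g where g: "bij_betw g {h..<card Y} (Y - \<phi> ` {..<h})"
        using finite_same_card_bij[of "{h..<card Y}" "Y - \<phi> ` {..<h}"] finY by auto
      define \<psi>0 where "\<psi>0 x = (if x \<in> {..<h} then \<phi> x else g x)" for x
      define \<psi> where "\<psi> = restrict \<psi>0 {..<card Y}"
      have un: "{..<h} \<union> {h..<card Y} = {..<card Y}" using hY by auto
      have "inj_on \<psi>0 ({..<h} \<union> {h..<card Y})"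
        unfolding \<psi>0_def using inj g by (intro inj_on_disjoint_Un) (auto simp: bij_betw_def)
      then have inj0: "inj_on \<psi> {..<card Y}" unfolding un \<psi>_def by (simp add: inj_on_restrict_eq)
      have "\<psi>0 ` {..<h} = \<phi> ` {..<h}" by (intro image_cong) (auto simp: \<psi>0_def)
      moreover have "\<psi>0 ` {h..<card Y} = g ` {h..<card Y}" by (intro image_cong) (auto simp: \<psi>0_def)
      ultimately have "\<psi>0 ` ({..<h} \<union> {h..<card Y}) = Y"
        unfolding image_Un using g Y(1) by (auto simp: bij_betw_def)
      then have img0: "\<psi> ` {..<card Y} = Y" unfolding un \<psi>_def by simp
      have same: "\<psi> x = \<phi> x" if "x < h" for x using that hY by (simp add: \<psi>_def \<psi>0_def)
      define F' where "F' = {e. e \<subseteq> {..<card Y} \<and> \<psi> ` e \<in> E}"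
      have "ne E (\<psi> ` {..<card Y}) = ne F' {..<card Y}" by (rule ne_image_eq[OF inj0]) (auto simp: F'_def)
      moreover have "{e \<in> F'. e \<subseteq> {..<card Y}} = F'" by (auto simp: F'_def)
      ultimately have cardF': "card F' = ne E Y" unfolding img0 by (simp add: ne_def)
      have "card e = s" if "e \<in> F'" for e
      proof -
        have "card (\<psi> ` e) = card e" using that by (intro card_image inj_on_subset[OF inj0]) (auto simp: F'_def)
        then show ?thesis using that edge_G(2)[OF E, of "\<psi> ` e"] by (simp add: F'_def)
      qed
      then have F's: "F' \<subseteq> {e. e \<subseteq> {..<card Y} \<and> card e = s}" by (auto simp: F'_def)
      have "F \<subseteq> F'"
      proof
        fix e assume e: "e \<in> F"
        then have eh: "e \<subseteq> {..<h}" using F by blast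
        then have "\<psi> ` e = \<phi> ` e" using same by (intro image_cong) auto
        moreover have "e \<subseteq> {..<card Y}" using eh hY by auto
        ultimately show "e \<in> F'" using edges[OF e] by (simp add: F'_def)
      qed
      then have "(card Y, F') \<in> I" using F's Y(3) ov cardF' by (simp add: I_def)
      moreover have "\<psi> \<in> copies n {..<card Y} F' E"
      proof -
        have "(`) \<psi> ` F' \<subseteq> E" by (auto simp: F'_def)
        moreover have "\<psi> \<in> {..<card Y} \<rightarrow>\<^sub>E {1..n}"
        proof (rule PiE_I)
          fix x assume "x \<in> {..<card Y}"
          then show "\<psi> x \<in> {1..n}" using img0 Y(2) by blast
        qed (simp add: \<psi>_def)
        ultimately show ?thesis using inj0 by (simp add: copies_def injections_def)
      qed
      moreover have "restrict \<psi> {..<h} = \<phi>"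
        using ext same by (intro extensionalityI[of _ "{..<h}"]) auto
      ultimately have "\<phi> \<in> bad" unfolding bad_def by force
      then show False using \<phi>(2) by simp
    qed
    have le: "ne F {..<h} \<le> ne E (\<phi> ` {..<h})" by (rule ne_image_le[OF inj]) (auto intro: edges)
    have neH: "ne E (\<phi> ` {..<h}) = card F"
    proof (rule ccontr)
      assume "ne E (\<phi> ` {..<h}) \<noteq> card F"
      then have q: "1 \<le> ne E (\<phi> ` {..<h}) - card F" using le neF by simp
      have "1 * 1 \<le> (2::int) ^ m * (int s - 1)" using s_ge by (intro mult_mono) auto
      then have "1 * int (ne E (\<phi> ` {..<h}) - card F) \<le> 2 ^ m * (int s - 1) * int (ne E (\<phi> ` {..<h}) - card F)"
        by (intro mult_right_mono) auto
      then have "over h (ne E (\<phi> ` {..<h}) - card F)" using q by (simp add: over_def mult.assoc)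
      then show False using no_over[OF order_refl img] cardH by simp
    qed
    have "e \<in> F \<longleftrightarrow> \<phi> ` e \<in> E" if "e \<subseteq> {..<h}" for e
      by (rule edges_image_eq[OF inj _ _ _ that]) (use neH neF edges in auto)
    moreover have "strong N (2 ^ m) {1..n} E (\<phi> ` {..<h})"
      unfolding strong_def
    proof (intro allI impI, rule ccontr)
      fix Y assume Y: "\<phi> ` {..<h} \<subset> Y" "Y \<subseteq> {1..n}" "card Y \<le> N"
        and "\<not> int (2 ^ m) * (cyc E Y - cyc E (\<phi> ` {..<h})) < int (ne E Y) - int (ne E (\<phi> ` {..<h}))"
      then have dense: "int (ne E Y) - int (card F) \<le> 2 ^ m * (cyc E Y - cyc E (\<phi> ` {..<h}))"
        by (simp add: neH)
      have finY: "finite Y" using Y(2) by (rule finite_subset) simp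
      have lt: "h < card Y" using psubset_card_mono[OF finY Y(1)] cardH by simp
      have "ne E (\<phi> ` {..<h}) \<le> ne E Y" using finY Y(1) by (intro ne_mono) auto
      then have leY: "card F \<le> ne E Y" by (simp add: neH)
      have cyc_eq: "cyc E Y - cyc E (\<phi> ` {..<h}) = (int s - 1) * int (ne E Y - card F) - (int (card Y) - int h)"
        using leY by (simp add: cyc_def neH cardH of_nat_diff algebra_simps)
      \<comment> \<open>Without a new edge the new vertices would lower \<open>cyc\<close>, which
        \<open>dense\<close> does not permit.\<close>
      have "1 \<le> ne E Y - card F"
      proof (rule ccontr)
        assume "\<not> ?thesis"
        then have "ne E Y = card F" using leY by simp
        then have "0 \<le> (2::int) ^ m * - (int (card Y) - int h)" using dense cyc_eq by simp
        then show False using lt by (simp add: zero_le_mult_iff)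
      qed
      then have "over (card Y) (ne E Y - card F)"
        using lt dense leY unfolding over_def cyc_eq by (simp add: of_nat_diff)
      then show False using no_over[OF psubset_imp_subset[OF Y(1)] Y(2)] Y(3) by simp
    qed
    ultimately show "\<exists>\<phi>. inj_on \<phi> {..<h} \<and> \<phi> ` {..<h} \<subseteq> {1..n} \<and>
      (\<forall>e\<subseteq>{..<h}. e \<in> F \<longleftrightarrow> \<phi> ` e \<in> E) \<and> strong N (2 ^ m) {1..n} E (\<phi> ` {..<h})"
      using inj img by (intro exI[of _ \<phi>]) simp
  qed
qed

lemma finite_balanced: "finite {(h, F). h \<le> (N::nat) \<and> balanced {..<h} F}"
  by (rule finite_subset[of _ "Sigma {..N} (\<lambda>h. Pow (Pow {..<h}))"]) (auto simp: balanced_def)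

lemma whp_rich: "whp (\<lambda>n. rich {1..n})"
proof -
  have A: "whp (\<lambda>n E. \<forall>i\<in>{(h, F). h \<le> N2 \<and> balanced {..<h} F}. \<forall>A. finite A \<longrightarrow> card A \<le> N2 \<longrightarrow>
      (\<exists>\<phi>. inj_on \<phi> {..<fst i} \<and> \<phi> ` {..<fst i} \<subseteq> {1..n} - A \<and> (\<forall>e\<in>snd i. \<phi> ` e \<in> E)))"
    by (rule whp_ball[OF finite_balanced], rule whp_copy_avoiding) auto
  have B: "whp (\<lambda>n E. \<forall>i\<in>{(h, F). h \<le> N1 \<and> balanced {..<h} F}.
      \<exists>\<phi>. inj_on \<phi> {..<fst i} \<and> \<phi> ` {..<fst i} \<subseteq> {1..n} \<and>
        (\<forall>e\<subseteq>{..<fst i}. e \<in> snd i \<longleftrightarrow> \<phi> ` e \<in> E) \<and> strong N1 (2 ^ m) {1..n} E (\<phi> ` {..<fst i}))"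
    by (rule whp_ball[OF finite_balanced], rule whp_strong_copy) auto
  show ?thesis
  proof (rule whp_mono[OF whp_conj[OF whp_wt_nonneg[of N2] whp_conj[OF whp_pendant_edge[of N2] whp_conj[OF A B]]]],
      intro eventually_mono[OF eventually_ge_at_top[of N2]] ballI impI, elim conjE)
    fix n E
    assume n: "N2 \<le> n" and E: "E \<in> set_pmf (G n)"
      and w: "\<forall>S\<subseteq>{1..n}. card S \<le> N2 \<longrightarrow> 0 \<le> wt E S"
      and t: "\<forall>B\<subseteq>{1..n}. card B \<le> N2 \<longrightarrow> (\<forall>v\<in>B. \<exists>e\<in>E. e \<inter> B = {v})"
      and a: "\<forall>i\<in>{(h, F). h \<le> N2 \<and> balanced {..<h} F}. \<forall>A. finite A \<longrightarrow> card A \<le> N2 \<longrightarrow>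
        (\<exists>\<phi>. inj_on \<phi> {..<fst i} \<and> \<phi> ` {..<fst i} \<subseteq> {1..n} - A \<and> (\<forall>e\<in>snd i. \<phi> ` e \<in> E))"
      and b: "\<forall>i\<in>{(h, F). h \<le> N1 \<and> balanced {..<h} F}.
        \<exists>\<phi>. inj_on \<phi> {..<fst i} \<and> \<phi> ` {..<fst i} \<subseteq> {1..n} \<and>
          (\<forall>e\<subseteq>{..<fst i}. e \<in> snd i \<longleftrightarrow> \<phi> ` e \<in> E) \<and> strong N1 (2 ^ m) {1..n} E (\<phi> ` {..<fst i})"
    have e: "\<forall>e\<in>E. e \<subseteq> {1..n} \<and> card e = s" using edge_G[OF E] by blast
    have a': "\<exists>\<phi>. inj_on \<phi> {..<h} \<and> \<phi> ` {..<h} \<subseteq> {1..n} - A \<and> (\<forall>e\<in>F. \<phi> ` e \<in> E)"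
      if "h \<le> N2" "balanced {..<h} F" "finite A" "card A \<le> N2" for h F A
      using bspec[OF a, of "(h, F)"] that by simp
    have b': "\<exists>\<phi>. inj_on \<phi> {..<h} \<and> \<phi> ` {..<h} \<subseteq> {1..n} \<and>
          (\<forall>e\<subseteq>{..<h}. e \<in> F \<longleftrightarrow> \<phi> ` e \<in> E) \<and> strong N1 (2 ^ m) {1..n} E (\<phi> ` {..<h})"
      if "h \<le> N1" "balanced {..<h} F" for h F
      using bspec[OF b, of "(h, F)"] that by simp
    show "rich {1..n} E"
      unfolding rich_def
    proof (intro conjI)
      show "\<forall>h\<le>N2. \<forall>F. balanced {..<h} F \<longrightarrow> (\<forall>A. finite A \<longrightarrow> card A \<le> N2 \<longrightarrow>
        (\<exists>\<phi>. inj_on \<phi> {..<h} \<and> \<phi> ` {..<h} \<subseteq> {1..n} - A \<and> (\<forall>e\<in>F. \<phi> ` e \<in> E)))"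
        by (intro allI impI a')
      show "\<forall>h\<le>N1. \<forall>F. balanced {..<h} F \<longrightarrow>
        (\<exists>\<phi>. inj_on \<phi> {..<h} \<and> \<phi> ` {..<h} \<subseteq> {1..n} \<and> (\<forall>e\<subseteq>{..<h}. e \<in> F \<longleftrightarrow> \<phi> ` e \<in> E) \<and>
          strong N1 (2 ^ m) {1..n} E (\<phi> ` {..<h}))"
        by (intro allI impI b')
      show "finite {1..n}" "N2 \<le> card {1..n}" using n by simp_all
    qed (fact e w t)+
  qed
qed

end

section \<open>The zero-one law\<close>

text \<open>The truth of a sentence does not depend on the assignment; nonempty vertex sets ensure
  that \<open>fo_models\<close> is not vacuous.\<close>

lemma agree_sentence:
  assumes "agree V E V' E' k {} \<theta>" "fo_free f = {}" "quantifier_depth f \<le> k" "V \<noteq> {}" "V' \<noteq> {}"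
  shows "fo_models V E f \<longleftrightarrow> fo_models V' E' f"
proof -
  have eq: "fo_sat V E v f = fo_sat V' E' v' f" for v v'
    by (rule agreeD[OF assms(1,3)]) (use assms(2) in auto)
  obtain x x' where "x \<in> V" "x' \<in> V'" using assms by auto
  then have "range (\<lambda>_. x) \<subseteq> V" "range (\<lambda>_. x') \<subseteq> V'" by auto
  then show ?thesis using eq unfolding fo_models_def by metis
qed

text \<open>Good hypergraphs agree even for different n, so the sentence holds in all of them or in
  none. Its probability is therefore within the failure probability of \<open>good\<close> from one
  and the same value, 1 or 0, for every n.\<close>

lemma zero_one_lawI:
  assumes good: "(\<lambda>n. measure_pmf.prob (random_hypergraph s n (p n)) {E. \<not> good n E}) \<longlonglongrightarrow> 0"
    and agree: "\<And>n n' E E'. E \<in> set_pmf (random_hypergraph s n (p n)) \<Longrightarrow>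
      E' \<in> set_pmf (random_hypergraph s n' (p n')) \<Longrightarrow> good n E \<Longrightarrow> good n' E' \<Longrightarrow>
      {1..n} \<noteq> {} \<and> (\<exists>\<theta>. agree {1..n} E {1..n'} E' k {} \<theta>)"
  shows "zero_one_law s k p"
  unfolding zero_one_law_def
proof (intro allI impI)
  fix f assume f: "fo_sentence s f \<and> quantifier_depth f \<le> k"
  let ?M = "\<lambda>n. random_hypergraph s n (p n)"
  let ?P = "\<lambda>n. measure_pmf.prob (?M n) {E. fo_models {1..n} E f}"
  have same: "fo_models {1..n} E f \<longleftrightarrow> fo_models {1..n'} E' f"
    if h: "E \<in> set_pmf (?M n)" "E' \<in> set_pmf (?M n')" "good n E" "good n' E'" for n n' E E'
  proof -
    obtain \<theta> where "agree {1..n} E {1..n'} E' k {} \<theta>" using agree[OF h] by blast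
    moreover have "{1..n} \<noteq> {}" "{1..n'} \<noteq> {}" using agree[OF h] agree[OF h(2,1,4,3)] by auto
    ultimately show ?thesis using f agree_sentence unfolding fo_sentence_def by blast
  qed
  show "?P \<longlonglongrightarrow> 0 \<or> ?P \<longlonglongrightarrow> 1"
  proof (cases "\<exists>n. \<exists>E\<in>set_pmf (?M n). good n E \<and> fo_models {1..n} E f")
    case True
    then obtain n0 E0 where E0: "E0 \<in> set_pmf (?M n0)" "good n0 E0" "fo_models {1..n0} E0 f" by blast
    have holds: "fo_models {1..n} E f" if "E \<in> set_pmf (?M n)" "good n E" for n E
      using same[OF E0(1) that(1) E0(2) that(2)] E0(3) by simp
    have low: "1 - measure_pmf.prob (?M n) {E. \<not> good n E} \<le> ?P n" for n
    proof -
      have "measure_pmf.prob (?M n) {E. \<not> fo_models {1..n} E f} \<le> measure_pmf.prob (?M n) {E. \<not> good n E}"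
        by (intro measure_pmf.finite_measure_mono_AE AE_pmfI) (use holds in auto)
      moreover have "measure_pmf.prob (?M n) {E. \<not> fo_models {1..n} E f} = 1 - ?P n"
        unfolding Collect_neg_eq Compl_eq_Diff_UNIV by (rule measure_pmf.prob_compl[of _ "?M n", simplified])
      ultimately show ?thesis by linarith
    qed
    have "(\<lambda>n. 1 - measure_pmf.prob (?M n) {E. \<not> good n E}) \<longlonglongrightarrow> 1 - 0"
      by (intro tendsto_diff tendsto_const good)
    then have lim: "(\<lambda>n. 1 - measure_pmf.prob (?M n) {E. \<not> good n E}) \<longlonglongrightarrow> 1" by simp
    have "?P \<longlonglongrightarrow> 1"
      by (rule tendsto_sandwich[OF always_eventually always_eventually lim tendsto_const])
        (intro allI low measure_pmf.prob_le_1)+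
    then show ?thesis by blast
  next
    case False
    have up: "?P n \<le> measure_pmf.prob (?M n) {E. \<not> good n E}" for n
      by (intro measure_pmf.finite_measure_mono_AE AE_pmfI) (use False in auto)
    have "?P \<longlonglongrightarrow> 0"
      by (rule tendsto_sandwich[OF always_eventually always_eventually tendsto_const good])
        (intro allI up measure_nonneg)+
    then show ?thesis by blast
  qed
qed

text \<open>With fewer than \<open>s\<close> quantifiers in scope, no edge atom can hold.\<close>

lemma zero_one_law_few_quantifiers:
  assumes "k < s"
  shows "zero_one_law s k p"
proof (rule zero_one_lawI[where good = "\<lambda>n E. k \<le> n \<and> 1 \<le> n"])
  show "(\<lambda>n. measure_pmf.prob (random_hypergraph s n (p n)) {E. \<not> (k \<le> n \<and> 1 \<le> n)}) \<longlonglongrightarrow> 0"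
    by (rule tendsto_eventually, rule eventually_mono[OF eventually_ge_at_top[of "k + 1"]]) auto
  fix n n' E E'
  assume E: "E \<in> set_pmf (random_hypergraph s n (p n))" "E' \<in> set_pmf (random_hypergraph s n' (p n'))"
    and n: "k \<le> n \<and> 1 \<le> n" "k \<le> n' \<and> 1 \<le> n'"
  \<comment> \<open>All s > k vertices of an edge lie outside the empty set, and
    \<open>k \<le> n\<close> provides enough vertices to choose from.\<close>
  have thin: "thinly_attached s k {1..n} E {}" "{} \<notin> E"
    if "E \<in> set_pmf (random_hypergraph s n (p n))" "k \<le> n \<and> 1 \<le> n" for n E
    using set_random_hypergraph[OF that(1), of "{}"] set_random_hypergraph[OF that(1)] that(2) assms
    by (auto simp: thinly_attached_def)
  have "conf (thinly_attached s k) {1..n} E {1..n'} E' {} id"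
    using thin[OF E(1) n(1)] thin[OF E(2) n(2)] by (simp add: conf_def partial_iso_def)
  then have "agree {1..n} E {1..n'} E' k {} id" by (rule thinly_attached_agree)
  then show "{1..n} \<noteq> {} \<and> (\<exists>\<theta>. agree {1..n} E {1..n'} E' k {} \<theta>)" using n by auto
qed

lemma (in sparse_exponent) zero_one_law_many_quantifiers:
  "zero_one_law s (m + s - 1) (\<lambda>n. real n powr - (real s - 1 - \<epsilon>))"
proof (rule zero_one_lawI[where good = "\<lambda>n. rich {1..n}"])
  show "(\<lambda>n. measure_pmf.prob (random_hypergraph s n (real n powr - (real s - 1 - \<epsilon>))) {E. \<not> rich {1..n} E}) \<longlonglongrightarrow> 0"
    using whp_rich unfolding whp_def G_def .
  fix n n' :: nat and E E' assume rich: "rich {1..n} E" "rich {1..n'} E'"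
  have "{1..n} \<noteq> {}"
  proof
    assume empty: "{1..n} = {}"
    have "0 < N2" using N1_less_N2 by simp
    then show False using rich_simps(2)[OF rich(1)] unfolding empty by simp
  qed
  then show "{1..n} \<noteq> {} \<and> (\<exists>\<theta>. agree {1..n} E {1..n'} E' (m + s - 1) {} \<theta>)" using rich_agree[OF rich] by blast
qed

theorem theorem8:
  fixes s k :: nat and \<alpha> :: real
  assumes "s \<ge> 2" and "k \<ge> 1"
    and "\<alpha> \<in> {real s - 1 - 1 / 2 powi (int k - int s + 1) <..< real s - 1}
               - exceptional_exponents s k"
  shows "zero_one_law s k (\<lambda>n. real n powr (- \<alpha>))"
proof (cases "k < s")
  case True
  then show ?thesis by (rule zero_one_law_few_quantifiers)
next
  case False
  define m where "m = k - s + 1"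
  define \<epsilon> where "\<epsilon> = real s - 1 - \<alpha>"
  have "int k - int s + 1 = int m" using False by (simp add: m_def)
  then have pw: "(2::real) powi (int k - int s + 1) = 2 ^ m" by simp
  have eps: "0 < \<epsilon>" "\<epsilon> < 1 / 2 ^ m" using assms(3) unfolding pw by (auto simp: \<epsilon>_def)
  have nonexc: "\<alpha> \<notin> exceptional_exponents s k" using assms(3) by simp
  interpret sparse_exponent s m \<epsilon>
  proof
    show "2 \<le> s" by fact
    show "1 \<le> m" by (simp add: m_def)
    show "0 < \<epsilon>" by fact
    show less: "\<epsilon> * 2 ^ m < 1" using eps by (simp add: field_simps)
    fix e c :: nat assume c: "1 \<le> c" "\<epsilon> * real e = real c"
    show "2 ^ m * Suc c < e"
    proof (rule ccontr)
      assume "\<not> 2 ^ m * Suc c < e"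
      then have le: "e \<le> 2 ^ m * c + 2 ^ m" by simp
      have e0: "0 < e" using c by (cases e) auto
      have "real c * 2 ^ m = (\<epsilon> * 2 ^ m) * real e" using c(2) by simp
      also have "\<dots> < 1 * real e" using less e0 by (intro mult_strict_right_mono) auto
      finally have "real (c * 2 ^ m) < real e" by simp
      then have lt: "2 ^ m * c < e" by (simp only: of_nat_less_iff mult.commute)
      \<comment> \<open>With b = c the exponent would be exceptional, as e = 2^m c + a: a \<ge> 1
        comes from \<epsilon> 2^m < 1, and a \<le> 2^m from the negated claim.\<close>
      define a where "a = e - 2 ^ m * c"
      have a: "1 \<le> a" "a \<le> 2 ^ m" using lt le by (auto simp: a_def)
      have "real a = real e - 2 ^ m * real c" using lt by (simp add: a_def of_nat_diff)
      then have "2 ^ m + real a / real c = real e / real c" using c(1) by (simp add: field_simps)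
      then have "1 / (2 ^ m + real a / real c) = real c / real e" by simp
      also have "\<dots> = \<epsilon>" using c(2) e0 by (simp add: field_simps)
      finally have "\<alpha> = real s - 1 - 1 / (2 powi (int k - int s + 1) + real a / real c)"
        unfolding pw by (simp add: \<epsilon>_def)
      moreover have "real a \<le> 2 powi (int k - int s + 1)"
        unfolding pw using a(2) by (metis of_nat_le_iff of_nat_numeral of_nat_power)
      ultimately have "\<alpha> \<in> exceptional_exponents s k"
        unfolding exceptional_exponents_def using a(1) c(1) by blast
      then show False using nonexc by simp
    qed
  qed
  have "m + s - 1 = k" using False assms(1) by (simp add: m_def)
  then show ?thesis using zero_one_law_many_quantifiers by (simp add: \<epsilon>_def)
qed

end
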